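(* Let $\Lambda=\mathrm{Diag}(\alpha_1,\dots,\alpha_N)$ be a complex diagonal matrix with $\mathrm{Re}\,\alpha_N\le\dots\le\mathrm{Re}\,\alpha_1<0$, and let $(\varphi_{s,t})_{0\le s\le t}$ be a dilation evolution family on the unit ball $\mathbb{B}\subset\mathbb{C}^N$ with $\varphi_{s,t}(z)=e^{\Lambda(t-s)}z+O(|z|^2)$. Then there exists a dilation Loewner chain $(f_s)_{s\ge0}$, $f_s\colon\mathbb{B}\to\mathbb{C}^N$, associated to $(\varphi_{s,t})$ such that $\bigcup_{s\ge0}f_s(\mathbb{B})=\mathbb{C}^N$. If no real resonances occur among the eigenvalues of $\Lambda$, then $(f_s)$ is a normal chain. Moreover, a family of holomorphic mappings $g_s\colon\mathbb{B}\to\mathbb{C}^N$, $s\ge0$, is a subordination chain associated to $(\varphi_{s,t})$ if and only if there exists an entire mapping $\Psi\colon\mathbb{C}^N\to\mathbb{C}^N$ such that $g_s=\Psi\circ f_s$ for all $s\ge0$.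
   Context: $N\ge2$ is an integer and $\mathbb{B}$ is the open Euclidean unit ball of $\mathbb{C}^N$. Univalent means injective holomorphic. $O(|z|^2)$ refers to $z\to0$. A dilation evolution family (for $\Lambda$) is a family $(\varphi_{s,t})_{0\le s\le t}$, with $s,t$ real, of holomorphic self-mappings of $\mathbb{B}$ such that for all $0\le s\le u\le t$: $\varphi_{s,s}=\mathrm{id}_{\mathbb{B}}$, $\varphi_{s,t}=\varphi_{u,t}\circ\varphi_{s,u}$, and $\varphi_{s,t}(z)=e^{\Lambda(t-s)}z+O(|z|^2)$. A family $(f_s)_{s\ge0}$ of holomorphic mappings $f_s\colon\mathbb{B}\to\mathbb{C}^N$ is a subordination chain if for all $0\le s\le t$ there is a holomorphic transition mapping $\psi_{s,t}\colon\mathbb{B}\to\mathbb{B}$ with $f_s=f_t\circ\psi_{s,t}$. It is associated to a dilation evolution family $(\varphi_{s,t})$ if the transition mappings can be taken to be $\varphi_{s,t}$, i.e. $f_s=f_t\circ\varphi_{s,t}$ for all $0\le s\le t$. A dilation Loewner chain is a subordination chain such that each $f_s$ is univalent and $f_s(z)=e^{-\Lambda s}z+O(|z|^2)$. It is normal if $(e^{\Lambda s}f_s)_{s\ge0}$ is a normal family on $\mathbb{B}$ (every sequence in it has a subsequence converging uniformly on compacta to a holomorphic mapping $\mathbb{B}\to\mathbb{C}^N$). A real resonance is an identity $\mathrm{Re}\big(\sum_{j=1}^N k_j\alpha_j\big)=\mathrm{Re}\,\alpha_l$ for some $1\le l\le N$ and integers $k_j\ge0$ with $\sum_j k_j\ge2$.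 *)

theory Defs
  imports "HOL-Analysis.Analysis" "HOL-Library.Landau_Symbols"
begin

text \<open>
  The space $\mathbb{C}^N$ is \<open>complex ^ 'n\<close>, whose norm is the Euclidean one, so that the open unit
  ball is \<open>ball 0 1\<close>. Maps defined on the ball are total functions of which only the values on the
  ball matter, and time-indexed families are total in their real indices, of which only the
  values at indices $0 \le s \le t$ matter.
\<close>

abbreviation unit_ball :: "(complex ^ 'n) set" where
  "unit_ball \<equiv> ball 0 1"

text \<open>Meant for open \<open>U\<close>; complex linearity of the derivative is expressed by its being given by
  a complex Jacobian matrix.\<close>

definition holomorphic_map_on ::
    "(complex ^ 'n \<Rightarrow> complex ^ 'm) \<Rightarrow> (complex ^ 'n) set \<Rightarrow> bool" where
  "holomorphic_map_on F U \<longleftrightarrow>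
     (\<forall>z\<in>U. \<exists>A :: complex ^ 'n ^ 'm. (F has_derivative (\<lambda>v. A *v v)) (at z))"

definition univalent_on ::
    "(complex ^ 'n \<Rightarrow> complex ^ 'm) \<Rightarrow> (complex ^ 'n) set \<Rightarrow> bool" where
  "univalent_on F U \<longleftrightarrow> holomorphic_map_on F U \<and> inj_on F U"

definition entire_map :: "(complex ^ 'n \<Rightarrow> complex ^ 'm) \<Rightarrow> bool" where
  "entire_map F \<longleftrightarrow> holomorphic_map_on F UNIV"

definition holomorphic_self_map :: "(complex ^ 'n \<Rightarrow> complex ^ 'n) \<Rightarrow> bool" where
  "holomorphic_self_map F \<longleftrightarrow> holomorphic_map_on F unit_ball \<and> F ` unit_ball \<subseteq> unit_ball"

definition Diag :: "('n \<Rightarrow> complex) \<Rightarrow> complex ^ 'n ^ 'n" where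
  "Diag \<alpha> = (\<chi> i j. if i = j then \<alpha> i else 0)"

definition mat_exp :: "complex ^ 'n ^ 'n \<Rightarrow> complex ^ 'n ^ 'n" where
  "mat_exp A = (\<Sum>k. (1 / fact k) *\<^sub>R (((**) A ^^ k) (mat 1)))"

lemma scaleR_Diag: "t *\<^sub>R Diag \<alpha> = Diag (\<lambda>i. of_real t * \<alpha> i)"
  by (simp add: Diag_def vec_eq_iff scaleR_conv_of_real[where x = "_ :: complex"])

lemma Diag_mult_Diag: "Diag \<alpha> ** Diag \<beta> = Diag (\<lambda>i. \<alpha> i * \<beta> i)"
proof -
  have "(\<Sum>k\<in>UNIV. (if i = k then \<alpha> i else 0) * (if k = j then \<beta> k else 0))
      = (\<Sum>k\<in>UNIV. if k = i then (if i = j then \<alpha> i * \<beta> i else 0) else 0)" for i j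
    by (rule sum.cong) auto
  then show ?thesis
    by (simp add: Diag_def matrix_matrix_mult_def vec_eq_iff)
qed

lemma Diag_power: "((**) (Diag \<alpha>) ^^ k) (mat 1) = Diag (\<lambda>i. \<alpha> i ^ k)"
proof (induction k)
  case 0
  then show ?case by (simp add: mat_def Diag_def)
next
  case (Suc k)
  then show ?case by (simp add: Diag_mult_Diag)
qed

lemma mat_exp_Diag: "mat_exp (Diag \<alpha>) = Diag (\<lambda>i. exp (\<alpha> i))"
proof -
  have "(\<lambda>k. (1 / fact k) *\<^sub>R Diag (\<lambda>i. \<alpha> i ^ k)) sums Diag (\<lambda>i. exp (\<alpha> i))"
    unfolding sums_def
  proof (intro vec_tendstoI)
    fix i j
    have "(\<lambda>n. \<Sum>k<n. \<alpha> i ^ k /\<^sub>R fact k) \<longlonglongrightarrow> exp (\<alpha> i)"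
      using exp_converges[of "\<alpha> i"] by (simp add: sums_def)
    then show "(\<lambda>n. (\<Sum>k<n. (1 / fact k) *\<^sub>R Diag (\<lambda>i. \<alpha> i ^ k)) $ i $ j)
        \<longlonglongrightarrow> Diag (\<lambda>i. exp (\<alpha> i)) $ i $ j"
      by (cases "i = j") (simp_all add: Diag_def divide_inverse)
  qed
  then show ?thesis
    by (simp add: mat_exp_def Diag_power sums_iff)
qed

lemma mat_exp_scaleR_Diag_mult_vec:
  "mat_exp (t *\<^sub>R Diag \<alpha>) *v z = (\<chi> i. exp (of_real t * \<alpha> i) * z $ i)"
proof -
  have "(\<Sum>j\<in>UNIV. (if i = j then c else 0) * z $ j) = c * z $ i" for c i
  proof -
    have "(\<Sum>j\<in>UNIV. (if i = j then c else 0) * z $ j)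
        = (\<Sum>j\<in>UNIV. if j = i then c * z $ i else 0)"
      by (rule sum.cong) auto
    then show ?thesis by simp
  qed
  then show ?thesis
    unfolding scaleR_Diag mat_exp_Diag
    by (simp add: Diag_def matrix_vector_mult_def vec_eq_iff)
qed

text \<open>$F(z) = A z + O(|z|^2)$ as $z \to 0$.\<close>

definition linear_expansion ::
    "(complex ^ 'n \<Rightarrow> complex ^ 'n) \<Rightarrow> complex ^ 'n ^ 'n \<Rightarrow> bool" where
  "linear_expansion F A \<longleftrightarrow> (\<lambda>z. norm (F z - A *v z)) \<in> O[nhds 0](\<lambda>z. (norm z)\<^sup>2)"

definition dilation_evolution_family ::
    "complex ^ 'n ^ 'n \<Rightarrow> (real \<Rightarrow> real \<Rightarrow> complex ^ 'n \<Rightarrow> complex ^ 'n) \<Rightarrow> bool" where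
  "dilation_evolution_family \<Lambda> \<phi> \<longleftrightarrow>
     (\<forall>s t. 0 \<le> s \<and> s \<le> t \<longrightarrow> holomorphic_self_map (\<phi> s t)) \<and>
     (\<forall>s\<ge>0. \<forall>z\<in>unit_ball. \<phi> s s z = z) \<and>
     (\<forall>s u t. 0 \<le> s \<and> s \<le> u \<and> u \<le> t \<longrightarrow>
        (\<forall>z\<in>unit_ball. \<phi> s t z = \<phi> u t (\<phi> s u z))) \<and>
     (\<forall>s t. 0 \<le> s \<and> s \<le> t \<longrightarrow> linear_expansion (\<phi> s t) (mat_exp ((t - s) *\<^sub>R \<Lambda>)))"

definition subordination_chain :: "(real \<Rightarrow> complex ^ 'n \<Rightarrow> complex ^ 'n) \<Rightarrow> bool" where
  "subordination_chain f \<longleftrightarrow>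
     (\<forall>s\<ge>0. holomorphic_map_on (f s) unit_ball) \<and>
     (\<forall>s t. 0 \<le> s \<and> s \<le> t \<longrightarrow>
        (\<exists>\<psi>. holomorphic_self_map \<psi> \<and> (\<forall>z\<in>unit_ball. f s z = f t (\<psi> z))))"

definition associated_to ::
    "(real \<Rightarrow> complex ^ 'n \<Rightarrow> complex ^ 'n) \<Rightarrow>
     (real \<Rightarrow> real \<Rightarrow> complex ^ 'n \<Rightarrow> complex ^ 'n) \<Rightarrow> bool" where
  "associated_to f \<phi> \<longleftrightarrow>
     (\<forall>s t. 0 \<le> s \<and> s \<le> t \<longrightarrow> (\<forall>z\<in>unit_ball. f s z = f t (\<phi> s t z)))"

definition dilation_Loewner_chain ::
    "complex ^ 'n ^ 'n \<Rightarrow> (real \<Rightarrow> complex ^ 'n \<Rightarrow> complex ^ 'n) \<Rightarrow> bool" where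
  "dilation_Loewner_chain \<Lambda> f \<longleftrightarrow>
     subordination_chain f \<and>
     (\<forall>s\<ge>0. univalent_on (f s) unit_ball \<and>
             linear_expansion (f s) (mat_exp (- s *\<^sub>R \<Lambda>)))"

definition normal_family ::
    "(complex ^ 'n \<Rightarrow> complex ^ 'm) set \<Rightarrow> (complex ^ 'n) set \<Rightarrow> bool" where
  "normal_family \<F> U \<longleftrightarrow>
     (\<forall>F :: nat \<Rightarrow> complex ^ 'n \<Rightarrow> complex ^ 'm. (\<forall>n. F n \<in> \<F>) \<longrightarrow>
        (\<exists>r G. strict_mono (r :: nat \<Rightarrow> nat) \<and> holomorphic_map_on G U \<and>
           (\<forall>K. compact K \<and> K \<subseteq> U \<longrightarrow> uniform_limit K (\<lambda>n. F (r n)) G sequentially)))"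

definition normal_chain ::
    "complex ^ 'n ^ 'n \<Rightarrow> (real \<Rightarrow> complex ^ 'n \<Rightarrow> complex ^ 'n) \<Rightarrow> bool" where
  "normal_chain \<Lambda> f \<longleftrightarrow>
     normal_family {\<lambda>z. mat_exp (s *\<^sub>R \<Lambda>) *v f s z | s. s \<ge> 0} unit_ball"

definition has_real_resonance :: "('n::finite \<Rightarrow> complex) \<Rightarrow> bool" where
  "has_real_resonance \<alpha> \<longleftrightarrow>
     (\<exists>(k :: 'n \<Rightarrow> nat) l. (\<Sum>j\<in>UNIV. k j) \<ge> 2 \<and>
        Re (\<Sum>j\<in>UNIV. of_nat (k j) * \<alpha> j) = Re (\<alpha> l))"

end

theory Submission
  imports Defs "HOL-Complex_Analysis.Riemann_Mapping"
begin

text \<open>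
  Sample the evolution family at integer times and write $A = e^{\Lambda}$. A monomial of degree
  at least two in the \<open>l\<close>-th component can be removed from the transition maps by a uniformly
  bounded change of coordinates unless its weight under $A$ has the same modulus as the \<open>l\<close>-th
  eigenvalue; the surviving (real resonant) monomials involve only coordinates that decay strictly
  more slowly than the \<open>l\<close>-th. Hence, up to an error of arbitrarily high order, the sampled family is
  conjugate to the inverses of triangular polynomial automorphisms $S_n$ of $\mathbb{C}^N$ with linear
  part $A^{-1}$. Once the order of contact is large enough for the contraction to beat the expansion of
  the $S_n$, the maps $S_n \circ \dots \circ S_{m-1} \circ k_m \circ \varphi_{n,m}$ converge as
  $m \to \infty$ on a ball independent of $n$, to maps $F_n$ with
  $F_n = S_n \circ F_{n+1} \circ \varphi_{n,n+1}$, and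
  $f_s = S_0 \circ \dots \circ S_{m-1} \circ F_m \circ \varphi_{s,m}$ (any large $m$) is the chain.
  Its range is everything because backward orbits of the triangular $S_n$ tend to $0$; without
  resonances $S_n = A^{-1}$, which makes the chain normal.
\<close>

section \<open>Holomorphic maps in several variables\<close>

text \<open>The direct limit of \<open>dil (- t)\<close> applied to \<open>\<phi> s t\<close> can
  diverge: the quadratic error of a step decays like the square of the slowest contraction rate,
  while the inverse linear part expands at the fastest one. Raising the order of contact cures this,
  at the price of a normal form. Because the sampled maps vary with n, removing a monomial is not an
  algebraic equation but a difference equation \<beta> x(n+1) - x(n) = -p(n); bounded solutions for
  all bounded p require |\<beta>| to differ from 1. Hence moduli, and so real parts, decide which
  terms survive, and all estimates have to be uniform in n. A second obstacle is that neither
  continuity in time nor injectivity of the evolution family is given. Its decay on smaller balls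
  and its closeness to the identity for short times are both extracted from the linear part at the
  origin alone, by Schwarz-Pick estimates on complex lines; injectivity follows by composing short
  steps.\<close>

lemma holo_map_iff:
  fixes F :: "complex ^ 'n \<Rightarrow> complex ^ 'm"
  shows "holomorphic_map_on F U \<longleftrightarrow>
     (\<forall>z\<in>U. \<exists>L. (F has_derivative L) (at z) \<and> (\<forall>c v. L (c *s v) = c *s L v))"
proof -
  have "\<exists>A. L = (\<lambda>v. A *v v)" if "bounded_linear L" "\<And>c v. L (c *s v) = c *s L v"
    for L :: "complex ^ 'n \<Rightarrow> complex ^ 'm"
  proof -
    interpret L: bounded_linear L by fact
    have "L v = matrix L *v v" for v
    proof -
      have "L v = L (\<Sum>i\<in>UNIV. v $ i *s axis i 1)"
        by (simp add: basis_expansion)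
      also have "\<dots> = (\<Sum>i\<in>UNIV. v $ i *s L (axis i 1))"
        by (simp add: L.sum that(2))
      also have "\<dots> = matrix L *v v"
        by (simp add: matrix_mult_sum column_def matrix_def vec_eq_iff)
      finally show ?thesis .
    qed
    then show ?thesis by blast
  qed
  note rep = this
  show ?thesis
    unfolding holomorphic_map_on_def
  proof (intro ball_cong refl iffI; elim exE conjE)
    fix z and A :: "complex ^ 'n ^ 'm" assume "(F has_derivative (*v) A) (at z)"
    then show "\<exists>L. (F has_derivative L) (at z) \<and> (\<forall>c v. L (c *s v) = c *s L v)"
      by (intro exI[of _ "(*v) A"]) (simp add: vector_scalar_commute)
  next
    fix z L assume L: "(F has_derivative L) (at z)" "\<forall>c v. L (c *s v) = c *s L v"
    then obtain A where "L = (*v) A"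
      using rep[of L] has_derivative_bounded_linear by blast
    then show "\<exists>A. (F has_derivative (*v) A) (at z)" using L by auto
  qed
qed

text \<open>The derivative is kept as a function instead of a Jacobian matrix, so that the real
  derivative calculus applies unchanged; complex homogeneity is carried separately by
  \<open>holo_mapD\<close>.\<close>

definition cderiv :: "(complex ^ 'n \<Rightarrow> complex ^ 'm) \<Rightarrow> complex ^ 'n \<Rightarrow> complex ^ 'n \<Rightarrow> complex ^ 'm" where
  "cderiv F z = frechet_derivative F (at z)"

lemma cderiv_eq: "(F has_derivative L) (at z) \<Longrightarrow> cderiv F z = L"
  unfolding cderiv_def by (metis frechet_derivative_at)

lemma holo_mapD:
  assumes "holomorphic_map_on F U" "z \<in> U"
  shows "(F has_derivative cderiv F z) (at z)" "cderiv F z (c *s v) = c *s cderiv F z v"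
proof -
  obtain L where "(F has_derivative L) (at z)" "\<forall>c v. L (c *s v) = c *s L v"
    using assms unfolding holo_map_iff by blast
  then show "(F has_derivative cderiv F z) (at z)" "cderiv F z (c *s v) = c *s cderiv F z v"
    using cderiv_eq[of F L z] by auto
qed

lemma holo_mapI:
  assumes "\<And>z. z \<in> U \<Longrightarrow> (F has_derivative L z) (at z)"
    and "\<And>z c v. z \<in> U \<Longrightarrow> L z (c *s v) = c *s L z v"
  shows "holomorphic_map_on F U"
  unfolding holo_map_iff
  by (intro ballI exI conjI allI; fact assms)

lemma holo_map_subset:
  "holomorphic_map_on F U \<Longrightarrow> V \<subseteq> U \<Longrightarrow> holomorphic_map_on F V"
  by (auto simp: holomorphic_map_on_def)

lemma holo_map_continuous:
  "holomorphic_map_on F U \<Longrightarrow> continuous_on U F"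
  using has_derivative_continuous[OF holo_mapD(1)]
  by (intro continuous_at_imp_continuous_on) blast

lemma holo_map_transform:
  assumes "holomorphic_map_on F U" "open U" "\<And>z. z \<in> U \<Longrightarrow> F z = G z"
  shows "holomorphic_map_on G U"
proof (rule holo_mapI)
  fix z assume z: "z \<in> U"
  show "(G has_derivative cderiv F z) (at z)"
    using has_derivative_transform_within_open[OF holo_mapD(1)[OF assms(1) z] assms(2) z]
      assms(3) by simp
  show "cderiv F z (c *s v) = c *s cderiv F z v" for c v
    by (rule holo_mapD(2)[OF assms(1) z])
qed

lemma holo_map_compose:
  assumes "holomorphic_map_on F U" "holomorphic_map_on G V" "F ` U \<subseteq> V"
  shows "holomorphic_map_on (\<lambda>z. G (F z)) U"
proof (rule holo_mapI)
  fix z assume z: "z \<in> U"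
  then have *: "F z \<in> V" using assms(3) by auto
  show "((\<lambda>z. G (F z)) has_derivative (\<lambda>v. cderiv G (F z) (cderiv F z v))) (at z)"
    using has_derivative_compose[OF holo_mapD(1)[OF assms(1) z]
        holo_mapD(1)[OF assms(2) *]] .
  show "cderiv G (F z) (cderiv F z (c *s v)) = c *s cderiv G (F z) (cderiv F z v)" for c v
    using holo_mapD(2)[OF assms(1) z] holo_mapD(2)[OF assms(2) *] by simp
qed

lemma holo_map_add:
  assumes "holomorphic_map_on F U" "holomorphic_map_on G U"
  shows "holomorphic_map_on (\<lambda>z. F z + G z) U"
  by (rule holo_mapI[where L = "\<lambda>z v. cderiv F z v + cderiv G z v"])
    (auto intro!: has_derivative_add simp: assms[THEN holo_mapD(1)]
        assms[THEN holo_mapD(2)] vector_add_ldistrib)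

lemma holo_map_scale:
  fixes F :: "complex ^ 'n \<Rightarrow> complex ^ 'm"
  assumes "holomorphic_map_on F U"
  shows "holomorphic_map_on (\<lambda>z. c *s F z) U"
proof -
  have bl: "bounded_linear (\<lambda>v. c *s v :: complex ^ 'm)"
    by (rule linear_conv_bounded_linear[THEN iffD1], rule linearI)
       (simp_all add: vec_eq_iff algebra_simps)
  show ?thesis
    by (rule holo_mapI[where L = "\<lambda>z v. c *s cderiv F z v"])
     (auto intro!: bounded_linear.has_derivative[OF bl] simp: assms[THEN holo_mapD(1)]
        assms[THEN holo_mapD(2)] vector_smult_assoc mult.commute)
qed

lemma holo_map_diff:
  assumes "holomorphic_map_on F U" "holomorphic_map_on G U"
  shows "holomorphic_map_on (\<lambda>z. F z - G z) U"
  using holo_map_add[OF assms(1) holo_map_scale[OF assms(2), of "-1"]]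
  by (simp add: vector_sneg_minus1[symmetric])

lemma holo_map_id [simp]: "holomorphic_map_on (\<lambda>z. z) U"
  by (rule holo_mapI[where L = "\<lambda>z v. v"]) auto

lemma holo_map_const [simp]: "holomorphic_map_on (\<lambda>z. c) U"
  by (rule holo_mapI[where L = "\<lambda>z v. 0"]) auto

lemma norm_smult [simp]: "norm (c *s v) = norm c * norm (v :: complex ^ 'n)"
  by (simp add: norm_vec_def L2_set_def norm_mult power_mult_distrib
      sum_distrib_left[symmetric] real_sqrt_mult)

lemma norm_le_card:
  fixes x :: "complex ^ 'n"
  assumes "\<And>i. norm (x $ i) \<le> B"
  shows "norm x \<le> real CARD('n) * B"
proof -
  have "norm x \<le> (\<Sum>i\<in>UNIV. norm (x $ i))" by (simp add: norm_vec_def L2_set_le_sum)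
  also have "\<dots> \<le> (\<Sum>i\<in>(UNIV::'n set). B)" by (intro sum_mono assms)
  finally show ?thesis by simp
qed

section \<open>One-variable slices and Cauchy estimates\<close>

lemma slice_deriv:
  assumes "holomorphic_map_on F U" "z + \<zeta> *s v \<in> U"
  shows "((\<lambda>\<zeta>. F (z + \<zeta> *s v) $ i) has_field_derivative cderiv F (z + \<zeta> *s v) v $ i) (at \<zeta>)"
proof -
  have bl: "bounded_linear (\<lambda>\<zeta>::complex. \<zeta> *s v)"
    by (rule linear_conv_bounded_linear[THEN iffD1], rule linearI)
       (simp_all add: vec_eq_iff algebra_simps)
  have "((\<lambda>\<zeta>. z + \<zeta> *s v) has_derivative (\<lambda>x. 0 + x *s v)) (at \<zeta>)"
    by (intro has_derivative_add has_derivative_const bounded_linear_imp_has_derivative bl)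
  from has_derivative_compose[OF this holo_mapD(1)[OF assms]]
  have "((\<lambda>\<zeta>. F (z + \<zeta> *s v)) has_derivative (\<lambda>x. x *s cderiv F (z + \<zeta> *s v) v)) (at \<zeta>)"
    using holo_mapD(2)[OF assms] by simp
  then have "((\<lambda>\<zeta>. F (z + \<zeta> *s v) $ i) has_derivative (\<lambda>x. (x *s cderiv F (z + \<zeta> *s v) v) $ i)) (at \<zeta>)"
    by (rule bounded_linear.has_derivative[OF bounded_linear_vec_nth])
  moreover have "(\<lambda>x. (x *s cderiv F (z + \<zeta> *s v) v) $ i) = (*) (cderiv F (z + \<zeta> *s v) v $ i)"
    by (simp add: fun_eq_iff mult.commute)
  ultimately show ?thesis
    by (simp only: has_field_derivative_def)
qed

lemma slice_holomorphic:
  assumes "holomorphic_map_on F U" "\<And>\<zeta>. \<zeta> \<in> S \<Longrightarrow> z + \<zeta> *s v \<in> U" "open S"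
  shows "(\<lambda>\<zeta>. F (z + \<zeta> *s v) $ i) holomorphic_on S"
  unfolding holomorphic_on_open[OF assms(3)]
  using slice_deriv[OF assms(1) assms(2)] by (intro ballI exI)

lemma cderiv_zero [simp]: "holomorphic_map_on F U \<Longrightarrow> z \<in> U \<Longrightarrow> cderiv F z 0 = 0"
  by (rule linear_0, rule bounded_linear.linear, rule has_derivative_bounded_linear, rule holo_mapD(1))

lemma norm_component_le: "norm (x $ i) \<le> norm (x :: complex ^ 'n)"
  using member_le_L2_set[of UNIV i "\<lambda>i. norm (x $ i)"] by (simp add: norm_vec_def)

text \<open>Cauchy's inequality for each component on a disc in direction \<open>v\<close>. Passing
  from components to the norm costs the factor \<open>CARD('m)\<close>, shrinking the disc the
  factor 2.\<close>

lemma cderiv_bound: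
  fixes F :: "complex ^ 'n \<Rightarrow> complex ^ 'm"
  assumes F: "holomorphic_map_on F (ball z r)" and r: "0 < r"
    and M: "\<And>x. x \<in> ball z r \<Longrightarrow> norm (F x) \<le> M"
  shows "norm (cderiv F z v) \<le> 2 * real CARD('m) * M / r * norm v"
proof (cases "v = 0")
  case True
  then show ?thesis using F r by simp
next
  case False
  \<comment> \<open>Half of the critical radius, so that the closed disc stays inside the open
    ball.\<close>
  define \<rho> where "\<rho> = r / (2 * norm v)"
  have \<rho>: "\<rho> > 0" "\<rho> * norm v = r / 2" using False r by (auto simp: \<rho>_def)
  have in_ball: "z + \<zeta> *s v \<in> ball z r" if "norm \<zeta> \<le> \<rho>" for \<zeta>
  proof -
    have "norm \<zeta> * norm v \<le> \<rho> * norm v" using that by (intro mult_right_mono) auto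
    then show ?thesis using \<rho> r by (simp add: dist_norm)
  qed
  have "norm (cderiv F z v $ i) \<le> 2 * M / r * norm v" for i
  proof -
    let ?f = "\<lambda>\<zeta>. F (z + \<zeta> *s v) $ i"
    have d: "(?f has_field_derivative cderiv F (z + \<zeta> *s v) v $ i) (at \<zeta>)" if "norm \<zeta> \<le> \<rho>" for \<zeta>
      using slice_deriv[OF F in_ball[OF that]] .
    have "norm ((deriv ^^ 1) ?f 0) \<le> fact 1 * M / \<rho> ^ 1"
    proof (rule Cauchy_inequality)
      show "?f holomorphic_on ball 0 \<rho>"
      proof (rule slice_holomorphic[OF F])
        show "z + \<zeta> *s v \<in> ball z r" if "\<zeta> \<in> ball 0 \<rho>" for \<zeta>
          using that by (intro in_ball) simp
      qed simp
      show "continuous_on (cball 0 \<rho>) ?f"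
        by (intro continuous_at_imp_continuous_on ballI DERIV_isCont[OF d]) simp
      show "norm (?f x) \<le> M" if "norm (0 - x) = \<rho>" for x
        using order_trans[OF norm_component_le M[OF in_ball]] that by simp
    qed (rule \<rho>)
    moreover have "deriv ?f 0 = cderiv F z v $ i"
      using d[of 0] \<rho> by (intro DERIV_imp_deriv) simp
    ultimately show ?thesis using r False by (simp add: \<rho>_def field_simps)
  qed
  from norm_le_card[of "cderiv F z v", OF this] show ?thesis by (simp add: field_simps)
qed

lemma holomorphic_lipschitz:
  fixes F :: "complex ^ 'n \<Rightarrow> complex ^ 'm"
  assumes F: "holomorphic_map_on F (ball z r)" and r: "0 < r"
    and M: "\<And>x. x \<in> ball z r \<Longrightarrow> norm (F x) \<le> M"
    and xy: "x \<in> ball z (r / 2)" "y \<in> ball z (r / 2)"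
  shows "norm (F x - F y) \<le> 4 * real CARD('m) * M / r * norm (x - y)"
proof (rule differentiable_bound[OF convex_ball _ _ xy])
  fix w assume w: "w \<in> ball z (r / 2)"
  have sub: "ball w (r / 2) \<subseteq> ball z r"
  proof
    fix y assume "y \<in> ball w (r / 2)"
    then show "y \<in> ball z r" using w dist_triangle[of z y w] by simp
  qed
  then have wz: "w \<in> ball z r" using r by (meson centre_in_ball half_gt_zero subsetD)
  show "(F has_derivative cderiv F w) (at w within ball z (r / 2))"
    using holo_mapD(1)[OF F wz] has_derivative_at_withinI by blast
  show "onorm (cderiv F w) \<le> 4 * real CARD('m) * M / r"
  proof (rule onorm_le)
    fix v
    have "norm (cderiv F w v) \<le> 2 * real CARD('m) * M / (r / 2) * norm v"
      using sub r by (intro cderiv_bound holo_map_subset[OF F] M) auto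
    then show "norm (cderiv F w v) \<le> 4 * real CARD('m) * M / r * norm v" by simp
  qed
qed

text \<open>Weierstrass' theorem: \<open>cderiv_bound\<close> applied to differences makes the
  derivatives uniformly Cauchy near each point, so the sequence may be differentiated termwise, and
  complex homogeneity passes to the limit.\<close>

lemma holo_map_uniform_limit:
  fixes F :: "nat \<Rightarrow> complex ^ 'n \<Rightarrow> complex ^ 'm"
  assumes F: "\<And>p. holomorphic_map_on (F p) U" and U: "open U"
    and lim: "uniform_limit U F G sequentially"
  shows "holomorphic_map_on G U"
  unfolding holo_map_iff
proof
  fix z0 assume z0: "z0 \<in> U"
  then obtain r0 where r0: "r0 > 0" "ball z0 r0 \<subseteq> U" using U open_contains_ball by blast
  define r where "r = r0 / 2"
  have r: "r > 0" using r0 by (simp add: r_def)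
  have sub: "ball x r \<subseteq> U" if "x \<in> ball z0 r" for x
  proof
    fix y assume "y \<in> ball x r"
    then have "dist z0 y < r + r" using that dist_triangle[of z0 y x] by simp
    then show "y \<in> U" using r0 by (auto simp: r_def)
  qed
  have inU: "x \<in> U" if "x \<in> ball z0 r" for x using sub[OF that] r by auto
  define C where "C = 2 * real CARD('m) / r"
  have C: "C > 0" using r by (simp add: C_def)
  define g' where "g' x v = lim (\<lambda>p. cderiv (F p) x v)" for x v
  have diff: "norm (cderiv (F p) x v - cderiv (F q) x v) \<le> C * e * norm v"
    if "\<And>y. y \<in> U \<Longrightarrow> norm (F p y - F q y) \<le> e" "x \<in> ball z0 r" for p q e x v
  proof -
    have "((\<lambda>z. F p z - F q z) has_derivative (\<lambda>v. cderiv (F p) x v - cderiv (F q) x v)) (at x)"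
      by (intro has_derivative_diff holo_mapD(1)[OF F] inU that)
    then have "cderiv (F p) x v - cderiv (F q) x v = cderiv (\<lambda>z. F p z - F q z) x v"
      by (simp add: cderiv_eq)
    also have "norm \<dots> \<le> 2 * real CARD('m) * e / r * norm v"
      proof (intro cderiv_bound holo_map_diff holo_map_subset[OF F sub] r)
      fix y assume "y \<in> ball x r"
      then have "y \<in> U" using sub[OF that(2)] by blast
      then show "norm (F p y - F q y) \<le> e" by (rule that(1))
    qed (rule that(2))+
    finally show ?thesis by (simp add: C_def)
  qed
  have cau: "\<exists>N. \<forall>p\<ge>N. \<forall>q\<ge>N. \<forall>x\<in>ball z0 r. \<forall>v. norm (cderiv (F p) x v - cderiv (F q) x v) \<le> e * norm v"
    if e: "e > 0" for e
  proof -
    have "e / (2 * C) > 0" using e C by simp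
    then obtain N where N: "\<And>p y. p \<ge> N \<Longrightarrow> y \<in> U \<Longrightarrow> dist (F p y) (G y) < e / (2 * C)"
      using lim unfolding uniform_limit_sequentially_iff by blast
    have "norm (cderiv (F p) x v - cderiv (F q) x v) \<le> C * (e / C) * norm v"
      if "p \<ge> N" "q \<ge> N" "x \<in> ball z0 r" for p q x v
    proof (rule diff[OF _ that(3)])
      fix y assume "y \<in> U"
      then have "dist (F p y) (F q y) < e / (2 * C) + e / (2 * C)"
        using N[OF that(1), of y] N[OF that(2), of y] dist_triangle2[of "F p y" "F q y" "G y"] by linarith
      then show "norm (F p y - F q y) \<le> e / C" by (simp add: dist_norm)
    qed
    then show ?thesis using C by (intro exI[of _ N]) auto
  qed
  have tend: "(\<lambda>p. cderiv (F p) x v) \<longlonglongrightarrow> g' x v" if "x \<in> ball z0 r" for x v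
  proof -
    have "Cauchy (\<lambda>p. cderiv (F p) x v)"
    proof (rule metric_CauchyI)
      fix e :: real assume e: "e > 0"
      have "e / (norm v + 1) > 0" using e by (simp add: add_nonneg_pos)
      from cau[OF this] obtain N where N: "\<forall>p\<ge>N. \<forall>q\<ge>N. norm (cderiv (F p) x v - cderiv (F q) x v) \<le> e / (norm v + 1) * norm v"
        using \<open>x \<in> ball z0 r\<close> by blast
      have "e / (norm v + 1) * norm v < e" using e by (simp add: divide_simps add_nonneg_pos)
      then show "\<exists>N. \<forall>p\<ge>N. \<forall>q\<ge>N. dist (cderiv (F p) x v) (cderiv (F q) x v) < e"
        using N unfolding dist_norm by (meson order_le_less_trans)
    qed
    then show ?thesis unfolding g'_def by (simp add: Cauchy_convergent flip: convergent_LIMSEQ_iff)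
  qed
  have "\<exists>g. \<forall>x\<in>ball z0 r. (\<lambda>n. F n x) \<longlonglongrightarrow> g x \<and> (g has_derivative g' x) (at x within ball z0 r)"
  proof (rule has_derivative_sequence[where f' = "\<lambda>p. cderiv (F p)" and ?x0.0 = z0])
    show "convex (ball z0 r)" by simp
    show "(F n has_derivative cderiv (F n) x) (at x within ball z0 r)" if "x \<in> ball z0 r" for n x
      using holo_mapD(1)[OF F inU[OF that]] has_derivative_at_withinI by blast
    show "z0 \<in> ball z0 r" using r by simp
    show "(\<lambda>n. F n z0) \<longlonglongrightarrow> G z0" by (rule tendsto_uniform_limitI[OF lim z0])
    fix e :: real assume "e > 0"
    then obtain N where N: "\<forall>p\<ge>N. \<forall>q\<ge>N. \<forall>x\<in>ball z0 r. \<forall>v. norm (cderiv (F p) x v - cderiv (F q) x v) \<le> e * norm v"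
      using cau by blast
    have "norm (cderiv (F n) x h - g' x h) \<le> e * norm h" if "n \<ge> N" "x \<in> ball z0 r" for n x h
    proof (rule tendsto_upperbound)
      show "(\<lambda>q. norm (cderiv (F n) x h - cderiv (F q) x h)) \<longlonglongrightarrow> norm (cderiv (F n) x h - g' x h)"
        by (intro tendsto_intros tend that)
      show "\<forall>\<^sub>F q in sequentially. norm (cderiv (F n) x h - cderiv (F q) x h) \<le> e * norm h"
        by (rule eventually_mono[OF eventually_ge_at_top[of N]]) (use N that in blast)
    qed simp
    then show "\<forall>\<^sub>F n in sequentially. \<forall>x\<in>ball z0 r. \<forall>h. norm (cderiv (F n) x h - g' x h) \<le> e * norm h"
      unfolding eventually_sequentially by blast
  qed
  then obtain g where g: "\<And>x. x \<in> ball z0 r \<Longrightarrow> (\<lambda>n. F n x) \<longlonglongrightarrow> g x"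
    "\<And>x. x \<in> ball z0 r \<Longrightarrow> (g has_derivative g' x) (at x within ball z0 r)" by blast
  have gG: "g x = G x" if "x \<in> ball z0 r" for x
    by (rule LIMSEQ_unique[OF g(1)[OF that] tendsto_uniform_limitI[OF lim inU[OF that]]])
  have "(g has_derivative g' z0) (at z0)"
    using g(2)[of z0] r at_within_open[of z0 "ball z0 r"] by simp
  then have "(G has_derivative g' z0) (at z0)"
    by (rule has_derivative_transform_within_open[OF _ open_ball[of z0 r]]) (use r gG in auto)
  moreover have "g' z0 (c *s v) = c *s g' z0 v" for c v
  proof -
    have z: "z0 \<in> ball z0 r" using r by simp
    have "(\<lambda>p. c *s cderiv (F p) z0 v) \<longlonglongrightarrow> c *s g' z0 v"
      by (rule vec_tendstoI) (auto intro!: tendsto_intros tend[OF z])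
    moreover have "(\<lambda>p. c *s cderiv (F p) z0 v) \<longlonglongrightarrow> g' z0 (c *s v)"
      using tend[OF z, of "c *s v"] by (simp add: holo_mapD(2)[OF F z0])
    ultimately show ?thesis by (blast intro: LIMSEQ_unique)
  qed
  ultimately show "\<exists>L. (G has_derivative L) (at z0) \<and> (\<forall>c v. L (c *s v) = c *s L v)" by blast
qed

text \<open>Taylor's formula with the second derivative bounded by Cauchy's inequality on discs of
  radius \<rho>/4 about points of the half disc: 2! M / (\<rho>/4)^2 = 32 M / \<rho>^2.\<close>

lemma holomorphic_second_order_bound:
  fixes f :: "complex \<Rightarrow> complex"
  assumes f: "f holomorphic_on ball 0 \<rho>" and \<rho>: "\<rho> > 0"
    and M: "\<And>x. x \<in> ball 0 \<rho> \<Longrightarrow> norm (f x) \<le> M" and h: "norm h < \<rho> / 2"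
  shows "norm (f h - f 0 - deriv f 0 * h) \<le> 32 * M / \<rho>\<^sup>2 * norm h ^ 2"
proof -
  have "norm ((deriv ^^ 0) f h - (\<Sum>i\<le>1. (deriv ^^ i) f 0 * (h - 0) ^ i / fact i))
      \<le> (32 * M / \<rho>\<^sup>2) * norm (h - 0) ^ Suc 1 / fact 1"
  proof (rule complex_Taylor[where S = "ball 0 (\<rho> / 2)"])
    show "((deriv ^^ i) f has_field_derivative (deriv ^^ Suc i) f x) (at x within ball 0 (\<rho> / 2))"
      if "x \<in> ball 0 (\<rho> / 2)" for i x
    proof -
      have "(deriv ^^ i) f holomorphic_on ball 0 \<rho>"
        by (intro holomorphic_higher_deriv f) simp
      moreover have "x \<in> ball 0 \<rho>" using that \<rho> by auto
      ultimately have "((deriv ^^ i) f has_field_derivative deriv ((deriv ^^ i) f) x) (at x)"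
        by (intro holomorphic_derivI[of _ "ball 0 \<rho>"]) auto
      then show ?thesis by (simp add: has_field_derivative_at_within)
    qed
    show "norm ((deriv ^^ Suc 1) f x) \<le> 32 * M / \<rho>\<^sup>2" if "x \<in> ball 0 (\<rho> / 2)" for x
    proof -
      have sub: "cball x (\<rho> / 4) \<subseteq> ball 0 \<rho>"
      proof
        fix y assume "y \<in> cball x (\<rho> / 4)"
        then show "y \<in> ball 0 \<rho>" using that dist_triangle[of 0 y x] \<rho> by auto
      qed
      have "norm ((deriv ^^ 2) f x) \<le> fact 2 * M / (\<rho> / 4) ^ 2"
      proof (rule Cauchy_inequality)
        show "f holomorphic_on ball x (\<rho> / 4)"
          using sub ball_subset_cball by (blast intro: holomorphic_on_subset[OF f])
        show "continuous_on (cball x (\<rho> / 4)) f"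
          using f holomorphic_on_imp_continuous_on continuous_on_subset sub by blast
        show "norm (f y) \<le> M" if "norm (x - y) = \<rho> / 4" for y
          using that sub by (intro M) (auto simp: dist_norm)
      qed (use \<rho> in auto)
      then show ?thesis by (simp add: power2_eq_square numeral_2_eq_2)
    qed
  qed (use h \<rho> in auto)
  then show ?thesis by (simp add: diff_diff_eq numeral_2_eq_2)
qed

text \<open>Difference quotients in direction \<open>v\<close> are holomorphic in the base point,
  and the second-order bound makes them converge locally uniformly, so
  \<open>holo_map_uniform_limit\<close> applies.\<close>

lemma holo_map_cderiv:
  fixes F :: "complex ^ 'n \<Rightarrow> complex ^ 'm"
  assumes F: "holomorphic_map_on F U" and U: "open U"
  shows "holomorphic_map_on (\<lambda>z. cderiv F z v) U"
proof (cases "v = 0")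
  case True
  have "holomorphic_map_on (\<lambda>z. 0 :: complex ^ 'm) U" by simp
  then show ?thesis
    by (rule holo_map_transform[OF _ U]) (use True F in simp)
next
  case False
  have "\<exists>r>0. ball z0 r \<subseteq> U \<and> holomorphic_map_on (\<lambda>z. cderiv F z v) (ball z0 r)" if z0: "z0 \<in> U" for z0
  proof -
    obtain r0 where r0: "r0 > 0" "cball z0 r0 \<subseteq> U" using U z0 open_contains_cball by blast
    define r where "r = r0 / 2"
    have r: "r > 0" using r0 by (simp add: r_def)
    have "compact (F ` cball z0 r0)"
      by (intro compact_continuous_image continuous_on_subset[OF holo_map_continuous[OF F]] r0) simp
    then obtain M where M: "\<And>x. x \<in> cball z0 r0 \<Longrightarrow> norm (F x) \<le> M"
      using compact_imp_bounded[of "F ` cball z0 r0"] unfolding bounded_iff by blast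
    define \<rho> where "\<rho> = r / norm v"
    have \<rho>: "\<rho> > 0" "\<rho> * norm v = r" using False r by (auto simp: \<rho>_def)
    have inb: "z + \<zeta> *s v \<in> cball z0 r0" if "z \<in> ball z0 r" "norm \<zeta> \<le> \<rho>" for z \<zeta>
    proof -
      have "norm \<zeta> * norm v \<le> r" using that(2) \<rho> mult_right_mono[of "norm \<zeta>" \<rho> "norm v"] by simp
      then show ?thesis using that(1) dist_triangle[of z0 "z + \<zeta> *s v" z] by (simp add: r_def dist_norm)
    qed
    \<comment> \<open>The offset 3 puts already the first increment strictly below \<rho>/2, as the
      second-order bound demands.\<close>
    define h where "h p = complex_of_real (\<rho> / real (p + 3))" for p :: nat
    have nh: "norm (h p) = \<rho> / real (p + 3)" for p using \<rho> by (simp only: h_def norm_of_real) simp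
    have hlt: "norm (h p) < \<rho> / 2" for p
      unfolding nh using \<rho> by (intro divide_strict_left_mono) auto
    have h0: "h p \<noteq> 0" for p using nh[of p] \<rho> by auto
    define Q where "Q p z = (1 / h p) *s (F (z + h p *s v) - F z)" for p z
    have sub: "ball z0 r \<subseteq> U" using r0 r by (auto simp: r_def)
    have "holomorphic_map_on (\<lambda>z. cderiv F z v) (ball z0 r)"
    proof (rule holo_map_uniform_limit)
      show "holomorphic_map_on (Q p) (ball z0 r)" for p
        unfolding Q_def
      proof (intro holo_map_scale holo_map_diff holo_map_subset[OF F sub])
        show "holomorphic_map_on (\<lambda>z. F (z + h p *s v)) (ball z0 r)"
        proof (rule holo_map_compose[OF _ F])
          show "holomorphic_map_on (\<lambda>z. z + h p *s v) (ball z0 r)"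
            by (intro holo_map_add) auto
          show "(\<lambda>z. z + h p *s v) ` ball z0 r \<subseteq> U"
            using inb hlt[of p] r0 \<rho> by fastforce
        qed
      qed
      show "uniform_limit (ball z0 r) Q (\<lambda>z. cderiv F z v) sequentially"
      proof (rule uniform_limitI)
        fix e :: real assume e: "e > 0"
        define K where "K = real CARD('m) * (32 * \<bar>M\<bar> / \<rho>\<^sup>2)"
        have bd: "norm (Q p z - cderiv F z v) \<le> K * norm (h p)" if z: "z \<in> ball z0 r" for p z
        proof -
          have "norm ((Q p z - cderiv F z v) $ i) \<le> 32 * \<bar>M\<bar> / \<rho>\<^sup>2 * norm (h p)" for i
          proof -
            let ?f = "\<lambda>\<zeta>. F (z + \<zeta> *s v) $ i"
            have "norm (?f (h p) - ?f 0 - deriv ?f 0 * h p) \<le> 32 * \<bar>M\<bar> / \<rho>\<^sup>2 * norm (h p) ^ 2"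
            proof (rule holomorphic_second_order_bound[OF _ \<rho>(1) _ hlt])
              show "?f holomorphic_on ball 0 \<rho>"
              proof (rule slice_holomorphic[OF F])
                show "z + \<zeta> *s v \<in> U" if "\<zeta> \<in> ball 0 \<rho>" for \<zeta>
                  using inb[OF z, of \<zeta>] that r0 by auto
              qed simp
              show "norm (?f x) \<le> \<bar>M\<bar>" if "x \<in> ball 0 \<rho>" for x
              proof -
                have "norm (?f x) \<le> norm (F (z + x *s v))" by (rule norm_component_le)
                also have "\<dots> \<le> M" using that by (intro M inb z) auto
                finally show ?thesis by simp
              qed
            qed
            also have "deriv ?f 0 = cderiv F z v $ i"
              using slice_deriv[OF F, of z 0 v i] z sub by (intro DERIV_imp_deriv) auto
            also have "?f (h p) - ?f 0 - cderiv F z v $ i * h p = h p * (Q p z - cderiv F z v) $ i"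
              using h0[of p] by (simp add: Q_def algebra_simps)
            finally have "norm (h p) * norm ((Q p z - cderiv F z v) $ i) \<le> norm (h p) * (32 * \<bar>M\<bar> / \<rho>\<^sup>2 * norm (h p))"
              by (simp only: norm_mult power2_eq_square mult_ac)
            then show ?thesis using h0[of p] by (simp only: mult_le_cancel_left) (auto simp: not_less)
          qed
          from norm_le_card[of "Q p z - cderiv F z v", OF this] show ?thesis
            by (simp only: K_def mult.assoc)
        qed
        have "(\<lambda>p. K * (\<rho> / real (p + 3))) \<longlonglongrightarrow> K * 0"
          by (rule tendsto_mult_left, rule LIMSEQ_ignore_initial_segment[OF lim_const_over_n])
        then have "\<forall>\<^sub>F p in sequentially. K * norm (h p) < e"
          using e unfolding nh by (intro order_tendstoD) auto
        then show "\<forall>\<^sub>F p in sequentially. \<forall>z\<in>ball z0 r. dist (Q p z) (cderiv F z v) < e"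
          by eventually_elim (use bd order_le_less_trans in \<open>unfold dist_norm, blast\<close>)
      qed
    qed simp
    then show ?thesis using sub r by blast
  qed
  then show ?thesis unfolding holomorphic_map_on_def
    by (meson centre_in_ball)
qed

text \<open>Mean value inequality for \<open>F\<close> minus its linear part at 0. The directional
  derivative is itself holomorphic, so two nested Cauchy estimates make it Lipschitz, which yields
  the factor \<open>s\<close>. Taking y = 0 gives the quadratic Taylor bound; general x, y give
  near-identity estimates.\<close>

lemma holomorphic_remainder_bound:
  fixes F :: "complex ^ 'n \<Rightarrow> complex ^ 'm"
  assumes F: "holomorphic_map_on F (ball 0 \<rho>)" and \<rho>: "0 < \<rho>"
    and M: "\<And>x. x \<in> ball 0 \<rho> \<Longrightarrow> norm (F x) \<le> M"
    and xy: "norm x \<le> s" "norm y \<le> s" "s < \<rho> / 4"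
  shows "norm (F x - F y - cderiv F 0 (x - y)) \<le> 32 * (real CARD('m))\<^sup>2 * M / \<rho>\<^sup>2 * s * norm (x - y)"
proof -
  have lin: "bounded_linear (cderiv F 0)"
    using holo_mapD(1)[OF F, of 0] \<rho> has_derivative_bounded_linear by auto
  have zs: "x \<in> cball 0 s" "y \<in> cball 0 s" using xy by auto
  have bd: "norm (cderiv F z v) \<le> 4 * real CARD('m) * M / \<rho> * norm v" if "z \<in> ball 0 (\<rho> / 2)" for z v
  proof -
    have sub: "ball z (\<rho> / 2) \<subseteq> ball 0 \<rho>"
    proof
      fix y assume "y \<in> ball z (\<rho> / 2)"
      then show "y \<in> ball 0 \<rho>" using that dist_triangle[of 0 y z] by simp
    qed
    have "norm (cderiv F z v) \<le> 2 * real CARD('m) * M / (\<rho> / 2) * norm v"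
      using sub \<rho> by (intro cderiv_bound holo_map_subset[OF F] M) auto
    then show ?thesis by simp
  qed
  have "norm ((F x - cderiv F 0 x) - (F y - cderiv F 0 y)) \<le> 32 * (real CARD('m))\<^sup>2 * M / \<rho>\<^sup>2 * s * norm (x - y)"
  proof (rule differentiable_bound[OF convex_cball _ _ zs])
    fix z :: "complex ^ 'n" assume z: "z \<in> cball 0 s"
    then have zl: "z \<in> ball 0 \<rho>" "z \<in> ball 0 (\<rho> / 4)" using xy \<rho> by auto
    show "((\<lambda>z. F z - cderiv F 0 z) has_derivative (\<lambda>v. cderiv F z v - cderiv F 0 v)) (at z within cball 0 s)"
      using has_derivative_at_withinI[OF holo_mapD(1)[OF F zl(1)]]
      by (intro has_derivative_diff bounded_linear_imp_has_derivative lin)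
    show "onorm (\<lambda>v. cderiv F z v - cderiv F 0 v) \<le> 32 * (real CARD('m))\<^sup>2 * M / \<rho>\<^sup>2 * s"
    proof (rule onorm_le)
      fix v
      have M0: "M \<ge> 0" using M[of 0] \<rho> norm_ge_zero[of "F 0"] by (simp del: norm_ge_zero)
      have "norm (cderiv F z v - cderiv F 0 v) \<le> 4 * real CARD('m) * (4 * real CARD('m) * M / \<rho> * norm v) / (\<rho> / 2) * norm (z - 0)"
        using zl \<rho> bd
        by (intro holomorphic_lipschitz[where z = 0] holo_map_cderiv
            holo_map_subset[OF F]) auto
      also have "\<dots> = 32 * (real CARD('m))\<^sup>2 * M / \<rho>\<^sup>2 * norm v * norm z"
        by (simp add: power2_eq_square)
      also have "\<dots> \<le> 32 * (real CARD('m))\<^sup>2 * M / \<rho>\<^sup>2 * norm v * s"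
        using z M0 by (intro mult_left_mono) auto
      finally show "norm (cderiv F z v - cderiv F 0 v) \<le> 32 * (real CARD('m))\<^sup>2 * M / \<rho>\<^sup>2 * s * norm v"
        by (simp add: mult_ac)
    qed
  qed
  moreover have "F x - F y - cderiv F 0 (x - y) = (F x - cderiv F 0 x) - (F y - cderiv F 0 y)"
    by (simp add: linear_diff[OF bounded_linear.linear[OF lin]])
  ultimately show ?thesis by (simp only:)
qed

section \<open>Word monomials and leading terms\<close>

lemma norm_axis_one: "norm (axis j (1 :: complex)) = 1"
  by (simp add: norm_vec_def L2_set_def axis_def if_distrib[of norm] if_distrib[of "\<lambda>x. x ^ 2"] cong: if_cong)

definition words :: "nat \<Rightarrow> 'n::finite list set" where
  "words d = {w. length w = d}"

definition word_mon :: "'n::finite list \<Rightarrow> complex ^ 'n \<Rightarrow> complex" where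
  "word_mon w z = prod_list (map (\<lambda>i. z $ i) w)"

lemma word_mon_simps [simp]: "word_mon [] z = 1" "word_mon (j # w) z = z $ j * word_mon w z"
  by (simp_all add: word_mon_def)

lemma word_mon_smult: "word_mon w (c *s z) = c ^ length w * word_mon w z"
  by (induction w) auto

lemma scaleR_eq_smult: "t *\<^sub>R z = complex_of_real t *s z"
  by (simp add: vec_eq_iff scaleR_conv_of_real[where 'a = complex])

lemma norm_word_mon_le: "norm (word_mon w z) \<le> norm z ^ length w"
  by (induction w) (auto simp: norm_mult intro!: mult_mono norm_component_le)

lemma finite_words [simp]: "finite (words d :: 'n::finite list set)"
  using finite_lists_length_eq[of "UNIV :: 'n set" d] by (simp add: words_def)

lemma words_0 [simp]: "words 0 = {[]}"
  by (auto simp: words_def)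

lemma sum_words_Suc:
  fixes g :: "'n::finite list \<Rightarrow> 'b::comm_monoid_add"
  shows "(\<Sum>w\<in>words (Suc d). g w) = (\<Sum>j\<in>UNIV. \<Sum>w\<in>words d. g (j # w))"
proof -
  have "words (Suc d) = (\<lambda>(j, w). j # w) ` (UNIV \<times> words d :: ('n \<times> 'n list) set)"
    by (auto simp: words_def length_Suc_conv image_iff)
  then have "(\<Sum>w\<in>words (Suc d). g w) = (\<Sum>(j, w)\<in>UNIV \<times> words d. g (j # w))"
    by (simp add: sum.reindex inj_on_def case_prod_unfold)
  then show ?thesis by (simp add: sum.cartesian_product)
qed

lemma word_mon_diff_le:
  assumes "norm x \<le> s" "norm y \<le> s"
  shows "norm (word_mon w x - word_mon w y) \<le> real (length w) * s ^ (length w - 1) * norm (x - y)"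
proof (induction w)
  case (Cons j w)
  have s: "0 \<le> s" using assms(1) norm_ge_zero order_trans by blast
  have wx: "norm (word_mon w x) \<le> s ^ length w"
    using norm_word_mon_le order_trans power_mono[OF assms(1)] norm_ge_zero by blast
  have "word_mon (j # w) x - word_mon (j # w) y
      = (x - y) $ j * word_mon w x + y $ j * (word_mon w x - word_mon w y)" by (simp add: algebra_simps)
  also have "norm \<dots> \<le> norm ((x - y) $ j) * norm (word_mon w x) + norm (y $ j) * norm (word_mon w x - word_mon w y)"
    by (metis norm_mult norm_triangle_ineq)
  also have "\<dots> \<le> norm (x - y) * s ^ length w + s * (real (length w) * s ^ (length w - 1) * norm (x - y))"
    using s wx Cons assms(2) norm_component_le[of "x - y" j] norm_component_le[of y j]
    by (intro add_mono mult_mono) auto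
  also have "s * (real (length w) * s ^ (length w - 1) * norm (x - y))
      = real (length w) * s ^ length w * norm (x - y)"
    by (cases w) auto
  finally show ?case by (simp add: algebra_simps)
qed auto

text \<open>The vector coefficient is there because holomorphy is defined for vector-valued
  maps.\<close>

lemma holo_map_word_mon: "holomorphic_map_on (\<lambda>z. word_mon w z *s c) U"
proof (induction w arbitrary: U)
  case (Cons j w)
  show ?case
  proof (rule holo_mapI)
    fix z :: "complex ^ 'a" assume "z \<in> U"
    have "((\<lambda>z. z $ j) has_derivative (\<lambda>v. v $ j)) (at z)"
      by (intro bounded_linear_imp_has_derivative bounded_linear_vec_nth)
    have bb: "bounded_bilinear (\<lambda>c v. c *s v :: complex ^ 'b)"
    proof (rule bounded_bilinear.intro)
      show "\<exists>K. \<forall>a b. norm (a *s b :: complex ^ 'b) \<le> norm a * norm b * K"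
        by (intro exI[of _ 1]) simp
    qed (simp_all add: vec_eq_iff algebra_simps)
    have "((\<lambda>z. z $ j *s (word_mon w z *s c)) has_derivative
       (\<lambda>v. z $ j *s cderiv (\<lambda>z. word_mon w z *s c) z v + v $ j *s (word_mon w z *s c))) (at z)"
      by (rule bounded_bilinear.FDERIV[OF bb _ holo_mapD(1)[OF Cons[of UNIV]]]) (fact | simp)+
    then show "((\<lambda>z. word_mon (j # w) z *s c) has_derivative
       (\<lambda>v. z $ j *s cderiv (\<lambda>z. word_mon w z *s c) z v + v $ j *s (word_mon w z *s c))) (at z)"
      by (simp add: vector_smult_assoc)
    show "z $ j *s cderiv (\<lambda>z. word_mon w z *s c) z (a *s v) + (a *s v) $ j *s (word_mon w z *s c)
        = a *s (z $ j *s cderiv (\<lambda>z. word_mon w z *s c) z v + v $ j *s (word_mon w z *s c))" for a v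
      by (simp add: holo_mapD(2)[OF Cons[of UNIV]] vec_eq_iff algebra_simps)
  qed
qed simp

lemma holo_map_sum:
  assumes "finite I" "\<And>i. i \<in> I \<Longrightarrow> holomorphic_map_on (F i) U"
  shows "holomorphic_map_on (\<lambda>z. \<Sum>i\<in>I. F i z) U"
  using assms by (induction I rule: finite_induct) (auto intro: holo_map_add)

lemma cderiv_expand:
  assumes "holomorphic_map_on F U" "z \<in> U"
  shows "cderiv F z v = (\<Sum>j\<in>UNIV. v $ j *s cderiv F z (axis j 1))"
proof -
  interpret L: bounded_linear "cderiv F z"
    using holo_mapD(1)[OF assms] has_derivative_bounded_linear by blast
  have "cderiv F z v = cderiv F z (\<Sum>j\<in>UNIV. v $ j *s axis j 1)" by (simp add: basis_expansion)
  then show ?thesis by (simp add: L.sum holo_mapD(2)[OF assms])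
qed

text \<open>Differentiation costs one order: Cauchy's estimate is applied on the ball of radius |z|
  about z, where \<open>H\<close> is at most C (2|z|)^(d+1). At z = 0 this radius degenerates, so a
  free radius \<open>s\<close> is kept and sent to 0.\<close>

lemma cderiv_bound_of_power_bound:
  fixes H :: "complex ^ 'n \<Rightarrow> complex ^ 'm"
  assumes H: "holomorphic_map_on H (ball 0 \<rho>)" and \<rho>: "\<rho> > 0" and C: "C \<ge> 0"
    and b: "\<And>z. z \<in> ball 0 \<rho> \<Longrightarrow> norm (H z) \<le> C * norm z ^ Suc d" and z: "z \<in> ball 0 (\<rho> / 2)"
  shows "norm (cderiv H z v) \<le> 2 * real CARD('m) * 2 ^ Suc d * C * norm z ^ d * norm v"
proof -
  define c where "c = 2 * real CARD('m) * 2 ^ Suc d * C * norm v"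
  have zb: "norm (cderiv H z v) \<le> c * s ^ d" if s: "norm z \<le> s" "0 < s" "s < \<rho> / 2" for s
  proof -
    have in2: "norm x \<le> 2 * s" if "x \<in> ball z s" for x
      using that s norm_triangle_sub[of x z] by (simp add: dist_norm norm_minus_commute)
    have "norm (cderiv H z v) \<le> 2 * real CARD('m) * (C * (2 * s) ^ Suc d) / s * norm v"
    proof (rule cderiv_bound[OF holo_map_subset[OF H] s(2)])
      show "ball z s \<subseteq> ball 0 \<rho>" using in2 s by force
      fix x assume x: "x \<in> ball z s"
      then have "norm (H x) \<le> C * norm x ^ Suc d" using in2[of x] s by (intro b) simp
      also have "\<dots> \<le> C * (2 * s) ^ Suc d" using in2[OF x] C by (intro mult_left_mono power_mono) auto
      finally show "norm (H x) \<le> C * (2 * s) ^ Suc d" .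
    qed
    also have "\<dots> = c * s ^ d" using s by (simp add: c_def power_mult_distrib field_simps)
    finally show ?thesis .
  qed
  have "norm (cderiv H z v) \<le> c * norm z ^ d"
  proof (cases "z = 0")
    case False
    then show ?thesis using z by (intro zb) auto
  next
    case True
    have "((\<lambda>s. c * s ^ d) \<longlongrightarrow> c * 0 ^ d) (at_right 0)" by (intro tendsto_intros)
    moreover have "\<forall>\<^sub>F s in at_right 0. norm (cderiv H z v) \<le> c * s ^ d"
      unfolding eventually_at_right_field
    proof (intro exI[of _ "\<rho> / 2"] conjI allI impI)
      fix y assume "0 < y" "y < \<rho> / 2"
      then show "norm (cderiv H z v) \<le> c * y ^ d" by (intro zb) (simp_all add: True)
    qed (use \<rho> in simp)
    ultimately show ?thesis
      using tendsto_lowerbound[of _ "c * 0 ^ d" "at_right (0::real)" "norm (cderiv H z v)"] True by simp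
  qed
  then show ?thesis by (simp add: c_def mult_ac)
qed

text \<open>The partial derivatives of \<open>H\<close> are expanded first, and \<open>H\<close> is recovered by integrating
  \<open>d/dt H(t z)\<close>. Words over the index set replace multi-indices, so the coefficients are not
  unique.\<close>

lemma leading_term_expansion:
  fixes \<rho> :: real
  assumes "\<rho> > 0"
  shows "\<exists>K\<ge>0. \<exists>\<sigma>>0. \<forall>(H :: complex ^ 'n \<Rightarrow> complex ^ 'm) C.
    C \<ge> 0 \<and> holomorphic_map_on H (ball 0 \<rho>) \<and> (\<forall>z\<in>ball 0 \<rho>. norm (H z) \<le> C * norm z ^ d) \<longrightarrow>
    (\<exists>p. (\<forall>w. norm (p w) \<le> K * C) \<and>
       (\<forall>z\<in>ball 0 \<sigma>. norm (H z - (\<Sum>w\<in>words d. word_mon w z *s p w)) \<le> K * C * norm z ^ Suc d))"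
  using assms
proof (induction d arbitrary: \<rho>)
  case 0
  \<comment> \<open>One constant for both claims: 1 serves the coefficient \<open>H 0\<close>, the
    Lipschitz constant serves the remainder.\<close>
  define K where "K = max 1 (4 * real CARD('m) / \<rho>)"
  show ?case
  proof (rule exI[of _ K], rule conjI[rotated], rule exI[of _ "\<rho> / 2"], intro conjI allI impI)
    show "0 \<le> K" "0 < \<rho> / 2" using 0 by (auto simp: K_def)
    fix H :: "complex ^ 'n \<Rightarrow> complex ^ 'm" and C :: real
    assume *: "C \<ge> 0 \<and> holomorphic_map_on H (ball 0 \<rho>) \<and> (\<forall>z\<in>ball 0 \<rho>. norm (H z) \<le> C * norm z ^ 0)"
    have "norm (H 0) \<le> C"
      using bspec[OF conjunct2[OF conjunct2[OF *]], of 0] 0 by simp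
    also have "C \<le> K * C"
      using * mult_right_mono[of 1 K C] by (simp add: K_def)
    finally have "norm (H 0) \<le> K * C" .
    moreover have "norm (H z - H 0) \<le> K * C * norm z" if "z \<in> ball 0 (\<rho> / 2)" for z
    proof -
      have "norm (H z - H 0) \<le> 4 * real CARD('m) * C / \<rho> * norm (z - 0)"
        using * 0 that by (intro holomorphic_lipschitz[where z = 0]) auto
      also have "\<dots> = (4 * real CARD('m) / \<rho>) * C * norm z" by simp
      also have "\<dots> \<le> K * C * norm z" using * by (intro mult_right_mono) (auto simp: K_def)
      finally show ?thesis .
    qed
    ultimately show "\<exists>p. (\<forall>w. norm (p w) \<le> K * C) \<and>
       (\<forall>z\<in>ball 0 (\<rho> / 2). norm (H z - (\<Sum>w\<in>words 0. word_mon w z *s p w)) \<le> K * C * norm z ^ Suc 0)"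
      by (intro exI[of _ "\<lambda>_. H 0"]) auto
  qed
next
  case (Suc d)
  define c where "c = 2 * real CARD('m) * 2 ^ Suc d"
  have c: "c \<ge> 0" by (simp add: c_def)
  have "\<rho> / 2 > 0" using Suc.prems by simp
  from Suc.IH[OF this] obtain K \<sigma> where K: "K \<ge> 0" and \<sigma>: "\<sigma> > 0" and
    IH: "\<forall>(H :: complex ^ 'n \<Rightarrow> complex ^ 'm) C.
      C \<ge> 0 \<and> holomorphic_map_on H (ball 0 (\<rho> / 2)) \<and> (\<forall>z\<in>ball 0 (\<rho> / 2). norm (H z) \<le> C * norm z ^ d) \<longrightarrow>
     (\<exists>p. (\<forall>w. norm (p w) \<le> K * C) \<and>
       (\<forall>z\<in>ball 0 \<sigma>. norm (H z - (\<Sum>w\<in>words d. word_mon w z *s p w)) \<le> K * C * norm z ^ Suc d))"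
    by (elim exE conjE) (rule that)
  define K' where "K' = real CARD('n) * K * c"
  have KK: "K * c \<le> K'"
    using mult_right_mono[of 1 "real CARD('n)" "K * c"] K c by (simp add: K'_def mult.assoc Suc_leI)
  show ?case
  proof (rule exI[of _ K'], rule conjI[rotated], rule exI[of _ "min \<sigma> \<rho>"], intro conjI allI impI)
    show "0 \<le> K'" "0 < min \<sigma> \<rho>" using K \<sigma> c Suc.prems by (auto simp: K'_def)
    fix H :: "complex ^ 'n \<Rightarrow> complex ^ 'm" and C :: real
    assume "C \<ge> 0 \<and> holomorphic_map_on H (ball 0 \<rho>) \<and> (\<forall>z\<in>ball 0 \<rho>. norm (H z) \<le> C * norm z ^ Suc d)"
    then have C: "C \<ge> 0" and H: "holomorphic_map_on H (ball 0 \<rho>)"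
      and b: "\<And>z. z \<in> ball 0 \<rho> \<Longrightarrow> norm (H z) \<le> C * norm z ^ Suc d" by auto
    have "\<exists>p. (\<forall>w. norm (p w) \<le> K * (c * C)) \<and>
       (\<forall>z\<in>ball 0 \<sigma>. norm (cderiv H z (axis j 1) - (\<Sum>w\<in>words d. word_mon w z *s p w)) \<le> K * (c * C) * norm z ^ Suc d)" for j
    proof (rule IH[rule_format], intro conjI)
      show "0 \<le> c * C" using C c by simp
      show "holomorphic_map_on (\<lambda>z. cderiv H z (axis j 1)) (ball 0 (\<rho> / 2))"
        using Suc.prems by (intro holo_map_cderiv holo_map_subset[OF H]) auto
      show "\<forall>z\<in>ball 0 (\<rho> / 2). norm (cderiv H z (axis j 1)) \<le> c * C * norm z ^ d"
        using cderiv_bound_of_power_bound[OF H Suc.prems C b, of _ "axis j 1"]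
        by (auto simp: c_def norm_axis_one)
    qed
    from choice[OF allI, OF this] obtain p where p0: "\<forall>j. (\<forall>w. norm (p j w) \<le> K * (c * C)) \<and>
       (\<forall>z\<in>ball 0 \<sigma>. norm (cderiv H z (axis j 1) - (\<Sum>w\<in>words d. word_mon w z *s p j w)) \<le> K * (c * C) * norm z ^ Suc d)" ..
    have p: "norm (p j w) \<le> K * (c * C)"
      "z \<in> ball 0 \<sigma> \<Longrightarrow> norm (cderiv H z (axis j 1) - (\<Sum>w\<in>words d. word_mon w z *s p j w)) \<le> K * (c * C) * norm z ^ Suc d" for j w z
      using p0 by blast+
    \<comment> \<open>The factor is the integral of \<open>t ^ d\<close> over [0, 1], from
      integrating the expanded partial derivatives along the ray to z. The default 0 keeps the
      coefficient bound valid at the empty word.\<close>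
    define q where "q w = (case w of [] \<Rightarrow> 0 | j # w \<Rightarrow> (1 / of_nat (Suc d)) *s p j w)" for w
    have q1: "norm (q w) \<le> K' * C" for w
    proof (cases w)
      case Nil
      then show ?thesis using K c C by (simp add: q_def K'_def)
    next
      case (Cons j w')
      have "norm (q w) = (1 / real (Suc d)) * norm (p j w')"
        unfolding q_def Cons list.case norm_smult norm_divide norm_of_nat by simp
      also have "\<dots> \<le> 1 * norm (p j w')" by (intro mult_right_mono) auto
      also have "\<dots> \<le> K * c * C" using p(1)[of j w'] by simp
      also have "\<dots> \<le> K' * C" using KK C by (intro mult_right_mono)
      finally show ?thesis .
    qed
    define S where "S z = (\<Sum>j\<in>UNIV. z $ j *s (\<Sum>w\<in>words d. word_mon w z *s p j w))" for z
    have qS: "(\<Sum>w\<in>words (Suc d). word_mon w z *s q w) = (1 / of_nat (Suc d)) *s S z" for z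
      unfolding sum_words_Suc S_def
      by (simp add: q_def vec.scale_sum_right vector_smult_assoc mult_ac del: of_nat_Suc)
    have "norm (H z - (\<Sum>w\<in>words (Suc d). word_mon w z *s q w)) \<le> K' * C * norm z ^ Suc (Suc d)"
      if z: "z \<in> ball 0 (min \<sigma> \<rho>)" for z
    proof -
      \<comment> \<open>The increment of \<open>g\<close> from 0 to 1 is the remainder to be
        estimated, and its derivative at t pairs z with the errors of the expanded partial
        derivatives at the point t z.\<close>
      define g where "g t = H (t *\<^sub>R z) - (t ^ Suc d / real (Suc d)) *\<^sub>R S z" for t :: real
      have tz: "t *\<^sub>R z \<in> ball 0 \<rho>" "t *\<^sub>R z \<in> ball 0 \<sigma>" "norm (t *\<^sub>R z) \<le> norm z" if "t \<in> {0..1}" for t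
        using that z mult_left_le_one_le[of "norm z" t] by auto
      have "norm (g 1 - g 0) \<le> K' * C * norm z ^ Suc (Suc d) * norm (1 - 0 :: real)"
      proof (rule differentiable_bound[of "{0..1}"])
        fix t :: real assume t: "t \<in> {0..1}"
        show "(g has_derivative (\<lambda>h. h *\<^sub>R (cderiv H (t *\<^sub>R z) z - (t ^ d) *\<^sub>R S z))) (at t within {0..1})"
        proof -
          have "((\<lambda>t. t *\<^sub>R z) has_derivative (\<lambda>h. h *\<^sub>R z)) (at t)"
            by (auto intro!: derivative_eq_intros)
          from has_derivative_compose[OF this holo_mapD(1)[OF H tz(1)[OF t]]]
          have "((\<lambda>t. H (t *\<^sub>R z)) has_derivative (\<lambda>h. h *\<^sub>R cderiv H (t *\<^sub>R z) z)) (at t)"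
            by (simp only: scaleR_eq_smult holo_mapD(2)[OF H tz(1)[OF t], unfolded scaleR_eq_smult])
          moreover have "((\<lambda>t. (t ^ Suc d / real (Suc d)) *\<^sub>R S z) has_derivative (\<lambda>h. h *\<^sub>R (t ^ d *\<^sub>R S z))) (at t)"
            by (auto intro!: derivative_eq_intros simp del: power_Suc of_nat_Suc)
          ultimately have "(g has_derivative (\<lambda>h. h *\<^sub>R cderiv H (t *\<^sub>R z) z - h *\<^sub>R (t ^ d *\<^sub>R S z))) (at t)"
            unfolding g_def by (rule has_derivative_diff)
          then show ?thesis by (simp only: scaleR_right_diff_distrib has_derivative_at_withinI)
        qed
        show "onorm (\<lambda>h. h *\<^sub>R (cderiv H (t *\<^sub>R z) z - (t ^ d) *\<^sub>R S z)) \<le> K' * C * norm z ^ Suc (Suc d)"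
        proof (rule onorm_le)
          fix h :: real
          have "(t ^ d) *\<^sub>R S z = (\<Sum>j\<in>UNIV. z $ j *s (\<Sum>w\<in>words d. word_mon w (t *\<^sub>R z) *s p j w))"
            unfolding S_def scaleR_sum_right
            by (intro sum.cong refl)
              (auto simp: vec_eq_iff words_def word_mon_smult scaleR_eq_smult sum_distrib_left mult_ac intro!: sum.cong)
          then have "cderiv H (t *\<^sub>R z) z - (t ^ d) *\<^sub>R S z =
             (\<Sum>j\<in>UNIV. z $ j *s (cderiv H (t *\<^sub>R z) (axis j 1) - (\<Sum>w\<in>words d. word_mon w (t *\<^sub>R z) *s p j w)))"
            by (simp add: cderiv_expand[OF H tz(1)[OF t], of z] sum_subtractf vector_ssub_ldistrib)
          also have "norm \<dots> \<le> (\<Sum>j\<in>(UNIV::'n set). norm z * (K * (c * C) * norm z ^ Suc d))"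
          proof (rule sum_norm_le)
            fix j :: 'n
            have "norm (cderiv H (t *\<^sub>R z) (axis j 1) - (\<Sum>w\<in>words d. word_mon w (t *\<^sub>R z) *s p j w))
                \<le> K * (c * C) * norm (t *\<^sub>R z) ^ Suc d" using tz(2)[OF t] by (rule p(2))
            also have "\<dots> \<le> K * (c * C) * norm z ^ Suc d"
              using K c C tz(3)[OF t] by (intro mult_left_mono power_mono) auto
            finally show "norm (z $ j *s (cderiv H (t *\<^sub>R z) (axis j 1) - (\<Sum>w\<in>words d. word_mon w (t *\<^sub>R z) *s p j w)))
                \<le> norm z * (K * (c * C) * norm z ^ Suc d)"
              unfolding norm_smult by (intro mult_mono norm_component_le) auto
          qed
          also have "\<dots> = K' * C * norm z ^ Suc (Suc d)" by (simp add: K'_def)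
          finally show "norm (h *\<^sub>R (cderiv H (t *\<^sub>R z) z - (t ^ d) *\<^sub>R S z)) \<le> K' * C * norm z ^ Suc (Suc d) * norm h"
            using mult_left_mono[OF _ abs_ge_zero[of h]] by (simp only: norm_scaleR real_norm_def mult.commute[of _ "\<bar>h\<bar>"])
        qed
      qed auto
      moreover have "H 0 = 0" using b[of 0] Suc.prems by simp
      moreover have "(1 / real (Suc d)) *\<^sub>R S z = (\<Sum>w\<in>words (Suc d). word_mon w z *s q w)"
        unfolding qS by (simp add: scaleR_eq_smult del: of_nat_Suc)
      ultimately show ?thesis by (simp add: g_def)
    qed
    with q1 show "\<exists>p. (\<forall>w. norm (p w) \<le> K' * C) \<and>
       (\<forall>z\<in>ball 0 (min \<sigma> \<rho>). norm (H z - (\<Sum>w\<in>words (Suc d). word_mon w z *s p w)) \<le> K' * C * norm z ^ Suc (Suc d))"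
      by blast
  qed
qed

section \<open>Montel's theorem\<close>

lemma compact_subset_smaller_cball:
  fixes K :: "'a::euclidean_space set"
  assumes "compact K" "K \<subseteq> ball 0 1"
  obtains r where "0 \<le> r" "r < 1" "K \<subseteq> cball 0 r"
proof (cases "K = {}")
  case True
  then show ?thesis using that[of 0] by simp
next
  case False
  then obtain x where "x \<in> K" "\<And>y. y \<in> K \<Longrightarrow> norm y \<le> norm x"
    using continuous_attains_sup[OF assms(1) False continuous_on_norm_id] by auto
  then show ?thesis using that[of "norm x"] assms(2) by (auto simp: subset_iff)
qed

text \<open>Cauchy estimates turn bounds on smaller balls into equicontinuity. Arzela-Ascoli on each
  ball of an exhaustion and a diagonal subsequence do the rest.\<close>

lemma montel:
  fixes F :: "nat \<Rightarrow> complex ^ 'n \<Rightarrow> complex ^ 'm"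
  assumes F: "\<And>p. holomorphic_map_on (F p) (ball 0 1)"
    and bdd: "\<And>r. r < 1 \<Longrightarrow> \<exists>M. \<forall>p. \<forall>z\<in>cball 0 r. norm (F p z) \<le> M"
  shows "\<exists>k G. strict_mono (k :: nat \<Rightarrow> nat) \<and> holomorphic_map_on G (ball 0 1) \<and>
           (\<forall>K. compact K \<and> K \<subseteq> ball 0 1 \<longrightarrow> uniform_limit K (\<lambda>p. F (k p)) G sequentially)"
proof -
  define S where "S i = cball (0 :: complex ^ 'n) (1 - 1 / real (i + 2))" for i :: nat
  define P where "P i r \<longleftrightarrow> (\<exists>g. uniform_limit (S i) (\<lambda>p. F (r p)) g sequentially)" for i and r :: "nat \<Rightarrow> nat"
  have sub: "\<exists>k. strict_mono (k :: nat \<Rightarrow> nat) \<and> P i (r \<circ> k)" for i r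
  proof -
    \<comment> \<open>Half the distance from \<open>S i\<close> to the unit sphere: balls of this
      radius about points of \<open>S i\<close> lie where the family is still bounded.\<close>
    define s where "s = 1 / (2 * real (i + 2))"
    have s: "s > 0" "1 / real (i + 2) = 2 * s" by (auto simp: s_def field_simps)
    obtain M where M: "\<And>p z. z \<in> cball 0 (1 - s) \<Longrightarrow> norm (F p z) \<le> M"
      using bdd[of "1 - s"] s by fastforce
    define L where "L = 4 * real CARD('m) * \<bar>M\<bar> / s"
    have L: "L \<ge> 0" using s by (simp add: L_def)
    have lip: "norm (F p x - F p y) \<le> L * norm (x - y)" if "x \<in> S i" "norm (x - y) < s / 2" for p x y
      unfolding L_def
    proof (rule holomorphic_lipschitz[where z = x])
      have *: "ball x s \<subseteq> cball 0 (1 - s)"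
      proof
        fix y assume "y \<in> ball x s"
        then show "y \<in> cball 0 (1 - s)"
          using that(1) s(2) dist_triangle[of 0 y x] unfolding S_def by simp
      qed
      then show "holomorphic_map_on (F p) (ball x s)"
        using s by (intro holo_map_subset[OF F]) force
      show "norm (F p w) \<le> \<bar>M\<bar>" if "w \<in> ball x s" for w using M[of w p] that * by fastforce
    qed (use that s in \<open>auto simp: dist_norm\<close>)
    have cS: "compact (S i)" by (simp add: S_def)
    obtain g and k :: "nat \<Rightarrow> nat" where gk: "strict_mono k"
      "\<And>e. 0 < e \<Longrightarrow> \<exists>N. \<forall>n x. n \<ge> N \<and> x \<in> S i \<longrightarrow> norm (F (r (k n)) x - g x) < e"
    proof (rule Arzela_Ascoli[OF cS, of "\<lambda>p. F (r p)" M])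
      show "norm (F (r n) x) \<le> M" if "x \<in> S i" for n x
        using that s by (intro M) (auto simp: S_def)
      show "\<exists>d>0. \<forall>n y. y \<in> S i \<and> norm (x - y) < d \<longrightarrow> norm (F (r n) x - F (r n) y) < e"
        if x: "x \<in> S i" and e: "0 < e" for x e
      proof (intro exI[of _ "min (s / 2) (e / (L + 1))"] conjI allI impI)
        show "0 < min (s / 2) (e / (L + 1))" using s e L by simp
        fix n y assume y: "y \<in> S i \<and> norm (x - y) < min (s / 2) (e / (L + 1))"
        have "norm (F (r n) x - F (r n) y) \<le> L * norm (x - y)" using y by (intro lip x) simp
        also have "\<dots> \<le> L * (e / (L + 1))" using y L by (intro mult_left_mono) auto
        also have "\<dots> < e" using e L by (simp add: field_simps)
        finally show "norm (F (r n) x - F (r n) y) < e" .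
      qed
    qed (use that in blast)
    have "uniform_limit (S i) (\<lambda>p. F ((r \<circ> k) p)) g sequentially"
      unfolding uniform_limit_sequentially_iff dist_norm using gk(2) by (simp, meson)
    then show ?thesis using gk(1) unfolding P_def by blast
  qed
  \<comment> \<open>The stability under eventual refinement that the diagonal argument demands: from
    N on, \<open>k2\<close> takes values of \<open>k1\<close> at indices that are at least as
    large.\<close>
  have PP: "P i (r \<circ> k2)" if *: "P i (r \<circ> k1)" "\<And>j. N \<le> j \<Longrightarrow> \<exists>j'. j \<le> j' \<and> k2 j = k1 j'"
    for i N and r k1 k2 :: "nat \<Rightarrow> nat"
  proof -
    obtain g where g: "uniform_limit (S i) (\<lambda>p. F ((r \<circ> k1) p)) g sequentially"
      using *(1) unfolding P_def by blast
    have "uniform_limit (S i) (\<lambda>p. F ((r \<circ> k2) p)) g sequentially"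
      unfolding uniform_limit_sequentially_iff
    proof (intro allI impI)
      fix e :: real assume "e > 0"
      then obtain N' where N': "\<forall>n\<ge>N'. \<forall>x\<in>S i. dist (F ((r \<circ> k1) n) x) (g x) < e"
        using g unfolding uniform_limit_sequentially_iff by blast
      show "\<exists>N. \<forall>n\<ge>N. \<forall>x\<in>S i. dist (F ((r \<circ> k2) n) x) (g x) < e"
      proof (intro exI[of _ "max N N'"] allI impI)
        fix n assume n: "max N N' \<le> n"
        then obtain j' where "n \<le> j'" "k2 n = k1 j'" using *(2)[of n] by auto
        then show "\<forall>x\<in>S i. dist (F ((r \<circ> k2) n) x) (g x) < e" using N' n by simp
      qed
    qed
    then show ?thesis unfolding P_def by blast
  qed
  obtain k where k: "strict_mono (k :: nat \<Rightarrow> nat)" "\<And>i. P i (id \<circ> k)"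
  proof (rule subsequence_diagonalization_lemma[of P id])
    show "\<exists>k. strict_mono (k :: nat \<Rightarrow> nat) \<and> P i (r \<circ> k)" for i r by (rule sub)
    show "P i (r \<circ> k2)" if "P i (r \<circ> k1)" "\<And>j. N \<le> j \<Longrightarrow> \<exists>j'. j \<le> j' \<and> k2 j = k1 j'"
      for i N and r k1 k2 :: "nat \<Rightarrow> nat"
      by (rule PP[where ?k1.0 = k1 and N = N]) (fact that)+
  qed (rule that)
  \<comment> \<open>The pointwise limit glues the uniform limits found on the individual
    balls.\<close>
  define G where "G z = lim (\<lambda>p. F (k p) z)" for z
  have ul: "uniform_limit (S i) (\<lambda>p. F (k p)) G sequentially" for i
  proof -
    obtain g where g: "uniform_limit (S i) (\<lambda>p. F (k p)) g sequentially"
      using k(2)[of i] unfolding P_def by auto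
    have "g z = G z" if "z \<in> S i" for z
      using tendsto_uniform_limitI[OF g that] unfolding G_def by (simp add: limI)
    then show ?thesis using g by (simp cong: uniform_limit_cong')
  qed
  have exS: "\<exists>i. cball 0 r \<subseteq> S i" if r1: "r < 1" for r
  proof -
    obtain i where "inverse (real (Suc i)) < 1 - r" using reals_Archimedean[of "1 - r"] r1 by auto
    moreover have "1 / real (i + 2) \<le> inverse (real (Suc i))" by (simp add: field_simps)
    ultimately have "cball 0 r \<subseteq> S i" unfolding S_def by (intro subset_cball) simp
    then show ?thesis by blast
  qed
  have "\<exists>A. (G has_derivative (\<lambda>v. A *v v)) (at z)" if z: "z \<in> ball 0 1" for z
  proof -
    define r where "r = (norm z + 1) / 2"
    have r: "r < 1" "z \<in> ball 0 r" using z by (auto simp: r_def)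
    obtain i where i: "cball 0 r \<subseteq> S i" using exS[OF r(1)] by blast
    have "holomorphic_map_on G (ball 0 r)"
    proof (rule holo_map_uniform_limit)
      show "holomorphic_map_on (F (k p)) (ball 0 r)" for p
        using r by (intro holo_map_subset[OF F]) auto
      show "uniform_limit (ball 0 r) (\<lambda>p. F (k p)) G sequentially"
        using i ball_subset_cball[of 0 r] by (intro uniform_limit_on_subset[OF ul[of i]]) auto
    qed simp
    then show ?thesis using r unfolding holomorphic_map_on_def by blast
  qed
  then have "holomorphic_map_on G (ball 0 1)" unfolding holomorphic_map_on_def by blast
  moreover have "uniform_limit K (\<lambda>p. F (k p)) G sequentially" if K: "compact K" "K \<subseteq> ball 0 1" for K
  proof -
    obtain r where "r < 1" "K \<subseteq> cball 0 r" using compact_subset_smaller_cball[OF K] by metis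
    moreover from this obtain i where "cball 0 r \<subseteq> S i" using exS[of r] by blast
    ultimately show ?thesis by (intro uniform_limit_on_subset[OF ul[of i]]) auto
  qed
  ultimately show ?thesis using k(1) by blast
qed

section \<open>Schwarz--Pick estimates for self-maps of the ball\<close>

text \<open>Schwarz's lemma for \<open>h\<close> followed by the disc automorphism that moves
  \<open>h 0\<close> to the origin. The bound on \<open>h\<close> is not strict because
  \<open>h\<close> will be a quotient g(z)/z; the maximum principle together with |h 0| < 1 makes it
  strict.\<close>

lemma schwarz_pick_origin:
  assumes h: "h holomorphic_on ball 0 1" and le: "\<And>z. norm z < 1 \<Longrightarrow> norm (h z) \<le> 1"
    and h0: "norm (h 0) < 1" and \<zeta>: "norm \<zeta> < 1"
  shows "norm (h \<zeta> - h 0) \<le> norm \<zeta> * norm (1 - cnj (h 0) * h \<zeta>)"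
proof -
  have lt: "norm (h w) < 1" if w: "norm w < 1" for w
  proof (rule ccontr)
    assume "\<not> norm (h w) < 1"
    then have 1: "norm (h w) = 1" using le[OF w] by simp
    have "h constant_on ball 0 1"
    proof (rule Schwarz2[OF h, of "1 - norm w" w])
      show sub: "ball w (1 - norm w) \<subseteq> ball 0 1"
      proof
        fix y assume "y \<in> ball w (1 - norm w)"
        then show "y \<in> ball 0 1" using dist_triangle[of 0 y w] by simp
      qed
      show "norm (h z) \<le> norm (h w)" if "norm (w - z) < 1 - norm w" for z
        using that sub unfolding 1 by (intro le) (auto simp: dist_norm)
    qed (use w in simp)
    then have "h 0 = h w" using w unfolding constant_on_def by force
    then show False using 1 h0 by simp
  qed
  let ?m = "Moebius_function 0 (h 0)"
  have "norm ((?m \<circ> h) \<zeta>) \<le> norm \<zeta>"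
  proof (rule Schwarz_Lemma(1)[OF _ _ _ \<zeta>])
    show "?m \<circ> h holomorphic_on ball 0 1"
      using lt by (intro holomorphic_on_compose_gen[OF h Moebius_function_holomorphic[OF h0]]) auto
    show "(?m \<circ> h) 0 = 0" by (simp add: Moebius_function_eq_zero)
    show "norm ((?m \<circ> h) z) < 1" if "norm z < 1" for z
      using Moebius_function_norm_lt_1[OF h0 lt[OF that]] by simp
  qed
  moreover have "1 - cnj (h 0) * h \<zeta> \<noteq> 0"
  proof
    assume "1 - cnj (h 0) * h \<zeta> = 0"
    then have "norm (cnj (h 0) * h \<zeta>) = 1" by simp
    moreover have "norm (cnj (h 0) * h \<zeta>) \<le> norm (h 0) * 1"
      unfolding norm_mult using lt[OF \<zeta>] by (intro mult_mono) auto
    ultimately show False using h0 by simp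
  qed
  ultimately show ?thesis
    by (simp add: Moebius_function_simple norm_divide field_simps)
qed

text \<open>The Hermitian product, linear in the first argument: paired with a fixed vector, a
  holomorphic map on a complex line becomes a scalar holomorphic function.\<close>

definition herm :: "complex ^ 'n \<Rightarrow> complex ^ 'n \<Rightarrow> complex" where
  "herm x u = (\<Sum>i\<in>UNIV. x $ i * cnj (u $ i))"

lemma norm_herm_le: "norm (herm x u) \<le> norm x * norm u"
proof -
  have "norm (herm x u) \<le> (\<Sum>i\<in>UNIV. \<bar>norm (x $ i)\<bar> * \<bar>norm (u $ i)\<bar>)"
    unfolding herm_def by (rule sum_norm_le) (simp add: norm_mult)
  also have "\<dots> \<le> norm x * norm u" unfolding norm_vec_def by (rule L2_set_mult_ineq)
  finally show ?thesis .
qed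

lemma herm_self: "herm x x = of_real (norm x ^ 2)"
proof -
  have "norm x ^ 2 = (\<Sum>i\<in>UNIV. norm (x $ i) ^ 2)"
    by (simp add: norm_vec_def L2_set_def sum_nonneg)
  then show ?thesis
    by (simp add: herm_def complex_norm_square del: of_real_power)
qed

lemma Re_herm: "Re (herm x u) = x \<bullet> u"
  by (simp add: herm_def inner_vec_def inner_complex_def)

lemma herm_smult: "herm (c *s x) u = c * herm x u" "herm x (c *s u) = cnj c * herm x u"
  by (simp_all add: herm_def sum_distrib_left mult_ac)

lemma herm_diff: "herm (x - y) u = herm x u - herm y u"
  by (simp add: herm_def sum_subtractf algebra_simps)

text \<open>Reduction to one variable: \<open>w\<close> is the value at \<zeta> of the quotient by
  \<zeta> of the scalar function obtained from the complex line through \<open>v\<close> and the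
  functional of \<open>u\<close>. At 0 that quotient is a matrix entry of the derivative, of modulus
  at most a < 1, so Schwarz-Pick compares the two values.\<close>

lemma schwarz_quotient:
  assumes \<phi>: "holomorphic_self_map \<phi>" and \<phi>0: "\<phi> 0 = 0"
    and a: "\<And>x. norm (cderiv \<phi> 0 x) \<le> a * norm x" "a < 1"
    and uv: "norm u = 1" "norm v = 1" and \<zeta>: "norm \<zeta> < 1"
  obtains w where "herm (\<phi> (\<zeta> *s v)) u = \<zeta> * w" "norm w \<le> 1"
    "norm (w - herm (cderiv \<phi> 0 v) u) \<le> norm \<zeta> * norm (1 - cnj (herm (cderiv \<phi> 0 v) u) * w)"
proof -
  have hol: "holomorphic_map_on \<phi> (ball 0 1)" and self: "\<And>z. norm z < 1 \<Longrightarrow> norm (\<phi> z) < 1"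
    using \<phi> unfolding holomorphic_self_map_def by (auto simp: image_subset_iff)
  define g where "g \<zeta> = herm (\<phi> (0 + \<zeta> *s v)) u" for \<zeta>
  have g: "g holomorphic_on ball 0 1"
    unfolding g_def herm_def using uv
    by (intro holomorphic_intros slice_holomorphic[OF hol]) auto
  have g1: "norm (g z) < 1" if "norm z < 1" for z
  proof -
    have "norm (g z) \<le> norm (\<phi> (0 + z *s v)) * 1" unfolding g_def using norm_herm_le uv by metis
    also have "\<dots> < 1" using self[of "0 + z *s v"] that uv by simp
    finally show ?thesis .
  qed
  have g0: "g 0 = 0" using \<phi>0 by (simp add: g_def herm_def)
  obtain h where h: "h holomorphic_on ball 0 1" "\<And>z. norm z < 1 \<Longrightarrow> g z = z * h z" "deriv g 0 = h 0"
    using Schwarz3[OF g g0] by metis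
  have "(g has_field_derivative herm (cderiv \<phi> (0 + 0 *s v) v) u) (at 0)"
    unfolding g_def herm_def
    by (intro DERIV_sum DERIV_cmult_right slice_deriv[OF hol]) simp
  then have h0: "h 0 = herm (cderiv \<phi> 0 v) u" using h(3) DERIV_imp_deriv by fastforce
  have h0lt: "norm (h 0) < 1"
    using norm_herm_le[of "cderiv \<phi> 0 v" u] a(1)[of v] a(2) uv by (simp add: h0)
  have h1: "norm (h z) \<le> 1" if z: "norm z < 1" for z
  proof (cases "z = 0")
    case False
    have "norm z * norm (h z) \<le> norm z * 1"
      using Schwarz_Lemma(1)[OF g g0 g1 z] h(2)[OF z] by (simp add: norm_mult)
    then show ?thesis using False by (simp only: mult_le_cancel_left) auto
  qed (use h0lt in simp)
  show ?thesis
  proof (rule that)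
    show "herm (\<phi> (\<zeta> *s v)) u = \<zeta> * h \<zeta>" using h(2)[OF \<zeta>] by (simp add: g_def)
    show "norm (h \<zeta>) \<le> 1" by (rule h1[OF \<zeta>])
    show "norm (h \<zeta> - herm (cderiv \<phi> 0 v) u) \<le> norm \<zeta> * norm (1 - cnj (herm (cderiv \<phi> 0 v) u) * h \<zeta>)"
      using schwarz_pick_origin[OF h(1) h1 h0lt \<zeta>] by (simp add: h0)
  qed
qed

text \<open>A pseudo-hyperbolic ball of radius r < 1 about a point at distance at most a < 1 from 0
  stays away from the unit circle. This rests on |1 - cnj b w|^2 - |w - b|^2 = (1 - |b|^2)(1 -
  |w|^2), after which a factor 1 - |b| cancels.\<close>

lemma moebius_gap:
  fixes w b :: complex
  assumes "norm (w - b) \<le> r * norm (1 - cnj b * w)" "norm b \<le> a" "a < 1" "norm w \<le> 1" "0 \<le> r" "r < 1"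
  shows "norm w ^ 2 \<le> 1 - (1 - r\<^sup>2) * (1 - a) / 2"
proof -
  have b1: "norm b < 1" using assms by simp
  have id: "norm (1 - cnj b * w) ^ 2 - norm (w - b) ^ 2 = (1 - norm b ^ 2) * (1 - norm w ^ 2)"
    unfolding cmod_power2 by (cases w; cases b) (simp add: algebra_simps power2_eq_square)
  have "norm (w - b) ^ 2 \<le> r\<^sup>2 * norm (1 - cnj b * w) ^ 2"
    using power_mono[OF assms(1) norm_ge_zero, of 2] by (simp add: power_mult_distrib)
  then have 1: "(1 - r\<^sup>2) * norm (1 - cnj b * w) ^ 2 \<le> (1 - norm b ^ 2) * (1 - norm w ^ 2)"
    unfolding id[symmetric] by (simp add: algebra_simps)
  have "1 - norm b \<le> 1 - norm (cnj b * w)"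
    using mult_left_le[of "norm w" "norm b"] assms by (simp add: norm_mult)
  also have "\<dots> \<le> norm (1 - cnj b * w)" using norm_triangle_ineq2[of 1 "cnj b * w"] by simp
  finally have "(1 - norm b) ^ 2 \<le> norm (1 - cnj b * w) ^ 2" using b1 by (intro power_mono) auto
  moreover have r2: "1 - r\<^sup>2 \<ge> 0" using assms by (simp add: power_le_one)
  ultimately have "(1 - r\<^sup>2) * (1 - norm b) ^ 2 \<le> (1 - norm b ^ 2) * (1 - norm w ^ 2)"
    using 1 mult_left_mono order_trans by blast
  also have "1 - norm b ^ 2 = (1 - norm b) * (1 + norm b)" by (simp add: algebra_simps power2_eq_square)
  finally have "(1 - norm b) * ((1 - r\<^sup>2) * (1 - norm b)) \<le> (1 - norm b) * ((1 + norm b) * (1 - norm w ^ 2))"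
    by (simp add: power2_eq_square mult_ac)
  then have "(1 - r\<^sup>2) * (1 - norm b) \<le> (1 + norm b) * (1 - norm w ^ 2)"
    using b1 by (simp only: mult_le_cancel_left)
  also have "\<dots> \<le> 2 * (1 - norm w ^ 2)" using b1 assms(4) by (intro mult_right_mono) (auto simp: power_le_one)
  finally have "(1 - r\<^sup>2) * (1 - norm b) \<le> 2 * (1 - norm w ^ 2)" .
  moreover have "(1 - r\<^sup>2) * (1 - a) \<le> (1 - r\<^sup>2) * (1 - norm b)" using r2 assms by (intro mult_left_mono) auto
  ultimately show ?thesis by simp
qed

text \<open>Testing against the direction of the image makes the Hermitian product equal to its
  norm, so \<open>moebius_gap\<close> bounds the ratio of norms. The factor depends on
  \<open>r\<close> and \<open>a\<close> only, hence is common to all maps with the same linear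
  part.\<close>

lemma self_map_contraction:
  assumes \<phi>: "holomorphic_self_map \<phi>" and \<phi>0: "\<phi> 0 = 0"
    and a: "\<And>x. norm (cderiv \<phi> 0 x) \<le> a * norm x" "a < 1"
    and z: "norm z \<le> r" "r < 1"
  shows "norm (\<phi> z) \<le> sqrt (1 - (1 - r\<^sup>2) * (1 - a) / 2) * norm z"
proof (cases "z = 0 \<or> \<phi> z = 0")
  case True
  show ?thesis
  proof (cases "z = 0")
    case False
    have r0: "0 \<le> r" using z norm_ge_zero order_trans by blast
    have "0 \<le> a * norm z" using a(1)[of z] norm_ge_zero order_trans by blast
    then have "a \<ge> 0" using False by (simp add: zero_le_mult_iff)
    then have "(1 - r\<^sup>2) * (1 - a) \<le> 1 * 1" using r0 z a by (intro mult_mono) (auto simp: power_le_one)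
    then show ?thesis using True \<phi>0 by auto
  qed (use \<phi>0 in simp)
next
  case False
  have z1: "norm (complex_of_real (norm z)) < 1" using z by simp
  define v where "v = complex_of_real (1 / norm z) *s z"
  define u where "u = complex_of_real (1 / norm (\<phi> z)) *s \<phi> z"
  have uv: "norm u = 1" "norm v = 1" using False by (auto simp: u_def v_def norm_divide)
  have zv: "complex_of_real (norm z) *s v = z" using False by (simp add: v_def vector_smult_assoc)
  obtain w where w: "herm (\<phi> z) u = of_real (norm z) * w" "norm w \<le> 1"
    "norm (w - herm (cderiv \<phi> 0 v) u) \<le> norm z * norm (1 - cnj (herm (cderiv \<phi> 0 v) u) * w)"
    using schwarz_quotient[OF \<phi> \<phi>0 a uv z1] unfolding zv by (metis norm_of_real abs_norm_cancel)
  have "herm (\<phi> z) u = of_real (norm (\<phi> z))"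
    using False by (simp add: u_def herm_smult herm_self power2_eq_square)
  then have nw: "norm (\<phi> z) = norm z * norm w" using w(1)
    by (metis norm_mult norm_of_real abs_norm_cancel)
  have "norm w ^ 2 \<le> 1 - (1 - r\<^sup>2) * (1 - a) / 2"
  proof (rule moebius_gap[OF _ _ a(2) w(2)])
    show "norm (herm (cderiv \<phi> 0 v) u) \<le> a"
      using norm_herm_le[of "cderiv \<phi> 0 v" u] a(1)[of v] uv by simp
    show "norm (w - herm (cderiv \<phi> 0 v) u) \<le> r * norm (1 - cnj (herm (cderiv \<phi> 0 v) u) * w)"
      using w(3) mult_right_mono[OF z(1) norm_ge_zero] order_trans by blast
    show "0 \<le> r" using z norm_ge_zero order_trans by blast
  qed (rule z(2))
  then have "norm w \<le> sqrt (1 - (1 - r\<^sup>2) * (1 - a) / 2)" by (rule real_le_rsqrt)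
  then show ?thesis unfolding nw by (metis mult.commute mult_left_mono norm_ge_zero)
qed

lemma self_map_norm_le:
  assumes \<phi>: "holomorphic_self_map \<phi>" and \<phi>0: "\<phi> 0 = 0"
    and a: "\<And>x. norm (cderiv \<phi> 0 x) \<le> a * norm x" "a < 1" and z: "norm z < 1"
  shows "norm (\<phi> z) \<le> norm z"
proof -
  have "sqrt (1 - (1 - (norm z)\<^sup>2) * (1 - a) / 2) \<le> 1"
    using z a(2) by (simp add: power_le_one)
  then show ?thesis
    using self_map_contraction[OF \<phi> \<phi>0 a order_refl z] mult_right_mono[of _ 1 "norm z"] order_trans
    by (metis mult_1 norm_ge_zero)
qed

text \<open>Here both unit vectors are the direction of z. Schwarz-Pick controls only the radial
  part of the image, forcing Re w close to 1; together with |\<phi> z| \<le> |z| this controls the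
  other directions too, since |\<phi> z - z|^2 \<le> 2 |z|^2 (1 - Re w).\<close>

lemma self_map_near_identity:
  assumes \<phi>: "holomorphic_self_map \<phi>" and \<phi>0: "\<phi> 0 = 0"
    and a: "\<And>x. norm (cderiv \<phi> 0 x) \<le> a * norm x" "a < 1"
    and eps: "\<And>x. norm (cderiv \<phi> 0 x - x) \<le> \<epsilon> * norm x"
    and z: "norm z \<le> r" "r < 1"
  shows "norm (\<phi> z - z) ^ 2 \<le> 2 * (2 * \<epsilon> / (1 - r) + \<epsilon>) * norm z ^ 2"
proof (cases "z = 0")
  case True
  then show ?thesis using \<phi>0 by simp
next
  case False
  have z1: "norm (complex_of_real (norm z)) < 1" using z by simp
  define v where "v = complex_of_real (1 / norm z) *s z"
  have v: "norm v = 1" using False by (auto simp: v_def norm_divide)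
  have zv: "complex_of_real (norm z) *s v = z" using False by (simp add: v_def vector_smult_assoc)
  define b where "b = herm (cderiv \<phi> 0 v) v"
  obtain w where w: "herm (\<phi> z) v = of_real (norm z) * w" "norm w \<le> 1"
    "norm (w - b) \<le> norm z * norm (1 - cnj b * w)"
    using schwarz_quotient[OF \<phi> \<phi>0 a v v z1] unfolding zv b_def by (metis norm_of_real abs_norm_cancel)
  have "norm b \<le> a" using norm_herm_le[of "cderiv \<phi> 0 v" v] a(1)[of v] v by (simp add: b_def)
  then have b1: "norm b < 1" using a by simp
  have "b - 1 = herm (cderiv \<phi> 0 v - v) v" using v by (simp add: b_def herm_diff herm_self)
  then have be: "norm (b - 1) \<le> \<epsilon>" using norm_herm_le[of "cderiv \<phi> 0 v - v" v] eps[of v] v by simp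
  have e0: "\<epsilon> \<ge> 0" using be norm_ge_zero order_trans by blast
  have "1 - norm b \<le> \<epsilon>" using be norm_triangle_ineq2[of 1 b] by (simp add: norm_minus_commute)
  moreover have "1 - norm b ^ 2 = (1 - norm b) * (1 + norm b)" by (simp add: algebra_simps power2_eq_square)
  moreover have "(1 - norm b) * (1 + norm b) \<le> (1 - norm b) * 2" using b1 by (intro mult_left_mono) auto
  ultimately have bb: "1 - norm b ^ 2 \<le> 2 * \<epsilon>" by argo
  \<comment> \<open>Expanding around \<open>b\<close> bounds the Schwarz-Pick right-hand side by |w
    - b| itself with a factor r < 1 in front, so the inequality can be solved for |w - b|.\<close>
  have "1 - cnj b * w = of_real (1 - norm b ^ 2) - cnj b * (w - b)"
    by (simp add: algebra_simps complex_norm_square del: of_real_power)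
  also have "norm \<dots> \<le> norm (complex_of_real (1 - norm b ^ 2)) + norm (cnj b * (w - b))"
    by (rule norm_triangle_ineq4)
  also have "\<dots> \<le> 2 * \<epsilon> + norm (w - b)"
  proof -
    have "norm b ^ 2 \<le> 1" using b1 by (simp add: power_le_one)
    then have "norm (complex_of_real (1 - norm b ^ 2)) = 1 - norm b ^ 2" by (simp only: norm_of_real)
    moreover have "norm (cnj b * (w - b)) \<le> norm (w - b)"
      using b1 mult_right_mono[of "norm b" 1 "norm (w - b)"] by (simp add: norm_mult)
    ultimately show ?thesis using bb by linarith
  qed
  finally have "norm (w - b) \<le> norm z * (2 * \<epsilon> + norm (w - b))"
    using w(3) mult_left_mono norm_ge_zero order_trans by meson
  also have "\<dots> \<le> r * (2 * \<epsilon> + norm (w - b))"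
    using z e0 by (intro mult_right_mono) auto
  finally have "norm (w - b) * (1 - r) \<le> r * (2 * \<epsilon>)" by (simp add: algebra_simps)
  also have "\<dots> \<le> 2 * \<epsilon>"
    using z e0 mult_left_le_one_le[of "2 * \<epsilon>" r] order_trans[OF norm_ge_zero z(1)] by simp
  finally have "norm (w - b) \<le> 2 * \<epsilon> / (1 - r)" using z by (simp add: field_simps)
  then have "norm (1 - w) \<le> 2 * \<epsilon> / (1 - r) + \<epsilon>"
    using be norm_triangle_ineq[of "w - b" "b - 1"] by (simp add: norm_minus_commute)
  then have "1 - Re w \<le> 2 * \<epsilon> / (1 - r) + \<epsilon>" using complex_Re_le_cmod[of "1 - w"] by simp
  then have m: "2 * (1 - Re w) * norm z ^ 2 \<le> 2 * (2 * \<epsilon> / (1 - r) + \<epsilon>) * norm z ^ 2"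
    by (intro mult_right_mono) auto
  have "herm (\<phi> z) z = cnj (of_real (norm z)) * herm (\<phi> z) v"
    using herm_smult(2)[of "\<phi> z" "of_real (norm z)" v] unfolding zv by simp
  then have "herm (\<phi> z) z = of_real (norm z ^ 2) * w" unfolding w(1) by (simp add: power2_eq_square)
  then have in1: "\<phi> z \<bullet> z = norm z ^ 2 * Re w" by (metis Re_herm Re_complex_of_real times_complex.sel(1) Im_complex_of_real mult_zero_left diff_zero)
  have "norm (\<phi> z) \<le> norm z" using self_map_norm_le[OF \<phi> \<phi>0 a] z by simp
  then have "norm (\<phi> z) ^ 2 \<le> norm z ^ 2" by (intro power_mono) auto
  moreover have "norm (\<phi> z - z) ^ 2 = norm (\<phi> z) ^ 2 + norm z ^ 2 - 2 * (\<phi> z \<bullet> z)"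
    unfolding power2_norm_eq_inner by (simp add: inner_diff inner_commute algebra_simps)
  moreover have "2 * (1 - Re w) * norm z ^ 2 = 2 * norm z ^ 2 - 2 * (norm z ^ 2 * Re w)"
    by (simp add: algebra_simps)
  ultimately show ?thesis using m unfolding in1 by linarith
qed

section \<open>Germs with index-uniform bounds\<close>

text \<open>The neighbourhood is not punctured, so for d \<ge> 1 the bound includes the value 0 at
  the origin. Neither the constant nor the neighbourhood depends on n.\<close>

definition unif_bigo :: "nat \<Rightarrow> (nat \<Rightarrow> complex ^ 'n \<Rightarrow> complex ^ 'm) \<Rightarrow> bool" where
  "unif_bigo d H \<longleftrightarrow> (\<exists>C. \<forall>\<^sub>F z in nhds 0. \<forall>n. norm (H n z) \<le> C * norm z ^ d)"

definition unif_holo :: "(nat \<Rightarrow> complex ^ 'n \<Rightarrow> complex ^ 'm) \<Rightarrow> bool" where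
  "unif_holo F \<longleftrightarrow> (\<exists>\<rho>>0. \<exists>M. \<forall>n. holomorphic_map_on (F n) (ball 0 \<rho>) \<and> (\<forall>z\<in>ball 0 \<rho>. norm (F n z) \<le> M))"

lemma unif_bigoI: "\<sigma> > 0 \<Longrightarrow> (\<And>n z. norm z < \<sigma> \<Longrightarrow> norm (H n z) \<le> C * norm z ^ d) \<Longrightarrow> unif_bigo d H"
  unfolding unif_bigo_def eventually_nhds_metric by (rule exI[of _ C], rule exI[of _ \<sigma>]) auto

lemma unif_holoI:
  "\<rho> > 0 \<Longrightarrow> (\<And>n. holomorphic_map_on (F n) (ball 0 \<rho>)) \<Longrightarrow>
     (\<And>n z. norm z < \<rho> \<Longrightarrow> norm (F n z) \<le> M) \<Longrightarrow> unif_holo F"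
  unfolding unif_holo_def by (rule exI[of _ \<rho>], rule conjI, assumption, rule exI[of _ M]) auto

lemma unif_bigoE:
  assumes "unif_bigo d H" "\<epsilon> > 0"
  obtains C \<sigma> where "C \<ge> 0" "0 < \<sigma>" "\<sigma> \<le> \<epsilon>" "\<And>n z. norm z < \<sigma> \<Longrightarrow> norm (H n z) \<le> C * norm z ^ d"
proof -
  obtain C \<sigma> where *: "\<sigma> > 0" "\<And>n z. norm z < \<sigma> \<Longrightarrow> norm (H n z) \<le> C * norm z ^ d"
    using assms unfolding unif_bigo_def eventually_nhds_metric by auto
  show ?thesis
  proof (rule that[of "\<bar>C\<bar>" "min \<sigma> \<epsilon>"])
    show "norm (H n z) \<le> \<bar>C\<bar> * norm z ^ d" if "norm z < min \<sigma> \<epsilon>" for n z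
    proof -
      have "norm (H n z) \<le> C * norm z ^ d" using that by (intro *(2)) simp
      also have "\<dots> \<le> \<bar>C\<bar> * norm z ^ d" by (intro mult_right_mono) auto
      finally show ?thesis .
    qed
  qed (use * assms in auto)
qed

lemma unif_holoE:
  assumes "unif_holo F" "\<epsilon> > 0"
  obtains M \<rho> where "M \<ge> 0" "0 < \<rho>" "\<rho> \<le> \<epsilon>" "\<And>n. holomorphic_map_on (F n) (ball 0 \<rho>)"
    "\<And>n z. norm z < \<rho> \<Longrightarrow> norm (F n z) \<le> M"
proof -
  obtain M \<rho> where *: "\<rho> > 0" "\<And>n. holomorphic_map_on (F n) (ball 0 \<rho>)"
     "\<And>n z. z \<in> ball 0 \<rho> \<Longrightarrow> norm (F n z) \<le> M"
    using assms unfolding unif_holo_def by blast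
  show ?thesis
  proof (rule that[of "\<bar>M\<bar>" "min \<rho> \<epsilon>"])
    show "holomorphic_map_on (F n) (ball 0 (min \<rho> \<epsilon>))" for n
      by (rule holo_map_subset[OF *(2)]) auto
    show "norm (F n z) \<le> \<bar>M\<bar>" if "norm z < min \<rho> \<epsilon>" for n z
      using *(3)[of z n] that by simp
  qed (use * assms in auto)
qed

lemma unif_bigo_0 [simp]: "unif_bigo d (\<lambda>n z. 0)"
  by (rule unif_bigoI[of 1 _ 0]) auto

lemma unif_bigo_add:
  assumes "unif_bigo d F" "unif_bigo d G"
  shows "unif_bigo d (\<lambda>n z. F n z + G n z)"
proof -
  obtain C D where "\<forall>\<^sub>F z in nhds 0. \<forall>n. norm (F n z) \<le> C * norm z ^ d"
    "\<forall>\<^sub>F z in nhds 0. \<forall>n. norm (G n z) \<le> D * norm z ^ d"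
    using assms unfolding unif_bigo_def by blast
  then have "\<forall>\<^sub>F z in nhds 0. \<forall>n. norm (F n z + G n z) \<le> (C + D) * norm z ^ d"
    by eventually_elim (simp add: distrib_right norm_triangle_mono)
  then show ?thesis unfolding unif_bigo_def by blast
qed

lemma unif_bigo_bound:
  assumes "unif_bigo d F" "\<And>n z. norm (G n z) \<le> c * norm (F n z)" "c \<ge> 0"
  shows "unif_bigo d G"
proof -
  obtain C where "\<forall>\<^sub>F z in nhds 0. \<forall>n. norm (F n z) \<le> C * norm z ^ d"
    using assms(1) unfolding unif_bigo_def by blast
  then have "\<forall>\<^sub>F z in nhds 0. \<forall>n. norm (G n z) \<le> (c * C) * norm z ^ d"
    unfolding mult.assoc
    by eventually_elim (use assms(2,3) mult_left_mono order_trans in blast)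
  then show ?thesis unfolding unif_bigo_def by blast
qed

lemma unif_bigo_mono:
  assumes "unif_bigo d F" "d' \<le> d"
  shows "unif_bigo d' F"
proof -
  obtain C \<sigma> where C: "C \<ge> 0" "0 < \<sigma>" "\<sigma> \<le> 1" "\<And>n z. norm z < \<sigma> \<Longrightarrow> norm (F n z) \<le> C * norm z ^ d"
    by (rule unif_bigoE[OF assms(1) zero_less_one]) (rule that)
  have "norm (F n z) \<le> C * norm z ^ d'" if "norm z < \<sigma>" for n z
    by (rule order_trans[OF C(4)[OF that] mult_left_mono[OF power_decreasing]]) (use that C assms in auto)
  then show ?thesis by (rule unif_bigoI[OF C(2)])
qed

lemma unif_bigo_shift: "unif_bigo d F \<Longrightarrow> unif_bigo d (\<lambda>n. F (Suc n))"
  unfolding unif_bigo_def by (force elim: eventually_mono)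

lemma unif_holo_shift: "unif_holo F \<Longrightarrow> unif_holo (\<lambda>n. F (Suc n))"
  unfolding unif_holo_def by blast

lemma unif_bigo_id [simp]: "unif_bigo 1 (\<lambda>n z. z)"
  by (rule unif_bigoI[of 1 _ 1]) auto

lemma unif_bigo1_small:
  assumes "unif_bigo 1 G" "\<epsilon> > 0"
  shows "\<forall>\<^sub>F z in nhds 0. \<forall>n. norm (G n z) < \<epsilon>"
proof -
  obtain C where C: "\<forall>\<^sub>F z in nhds 0. \<forall>n. norm (G n z) \<le> C * norm z ^ 1"
    using assms(1) unfolding unif_bigo_def by blast
  have "((\<lambda>z::complex ^ 'a. C * norm z ^ 1) \<longlongrightarrow> C * norm (0 :: complex ^ 'a) ^ 1) (nhds 0)"
    by (intro tendsto_intros filterlim_ident)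
  then have "\<forall>\<^sub>F z :: complex ^ 'a in nhds 0. C * norm z ^ 1 < \<epsilon>" using assms(2) by (intro order_tendstoD(2)) auto
  with C show ?thesis by eventually_elim (use order_le_less_trans in blast)
qed

lemma unif_bigo_compose:
  assumes "unif_bigo d F" "unif_bigo 1 G"
  shows "unif_bigo d (\<lambda>n z. F n (G n z))"
proof -
  obtain C \<sigma> where C: "C \<ge> 0" "0 < \<sigma>" "\<And>n z. norm z < \<sigma> \<Longrightarrow> norm (F n z) \<le> C * norm z ^ d"
    by (rule unif_bigoE[OF assms(1) zero_less_one]) (rule that)
  obtain D where "\<forall>\<^sub>F z in nhds 0. \<forall>n. norm (G n z) \<le> D * norm z ^ 1"
    using assms(2) unfolding unif_bigo_def by blast
  with unif_bigo1_small[OF assms(2) C(2)]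
  have "\<forall>\<^sub>F z in nhds 0. \<forall>n. norm (F n (G n z)) \<le> (C * D ^ d) * norm z ^ d"
  proof eventually_elim
    case (elim z)
    show ?case
    proof
      fix n
      have "norm (F n (G n z)) \<le> C * norm (G n z) ^ d" using elim by (intro C) simp
      also have "\<dots> \<le> C * (D * norm z) ^ d" using elim C by (intro mult_left_mono power_mono) auto
      finally show "norm (F n (G n z)) \<le> C * D ^ d * norm z ^ d" by (simp add: power_mult_distrib mult.assoc)
    qed
  qed
  then show ?thesis unfolding unif_bigo_def by blast
qed

lemma unif_holo_id [simp]: "unif_holo (\<lambda>n z. z)"
  by (rule unif_holoI[of 1 _ 1]) auto

lemma unif_holo_0 [simp]: "unif_holo (\<lambda>n z. 0)"
  by (rule unif_holoI[of 1 _ 1]) auto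

lemma unif_holo_add:
  fixes F :: "nat \<Rightarrow> complex ^ 'n \<Rightarrow> complex ^ 'm"
  assumes "unif_holo F" "unif_holo G"
  shows "unif_holo (\<lambda>n z. F n z + G n z)"
proof -
  obtain M \<rho> where 1: "0 < \<rho>" "\<And>n. holomorphic_map_on (F n) (ball 0 \<rho>)" "\<And>n z. norm z < \<rho> \<Longrightarrow> norm (F n z) \<le> M"
    by (rule unif_holoE[OF assms(1), of 1]) auto
  obtain M' \<rho>' where 2: "0 < \<rho>'" "\<And>n. holomorphic_map_on (G n) (ball 0 \<rho>')" "\<And>n z. norm z < \<rho>' \<Longrightarrow> norm (G n z) \<le> M'"
    by (rule unif_holoE[OF assms(2), of 1]) auto
  show ?thesis
  proof (rule unif_holoI[of "min \<rho> \<rho>'" _ "M + M'"])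
    show "holomorphic_map_on (\<lambda>z. F n z + G n z) (ball 0 (min \<rho> \<rho>'))" for n
      by (intro holo_map_add holo_map_subset[OF 1(2)] holo_map_subset[OF 2(2)]) auto
    fix n and z :: "complex ^ 'n" assume z: "norm z < min \<rho> \<rho>'"
    show "norm (F n z + G n z) \<le> M + M'"
      using norm_triangle_ineq[of "F n z" "G n z"] 1(3)[of z n] 2(3)[of z n] z by simp
  qed (use 1 2 in simp)
qed

lemma unif_holo_compose:
  assumes "unif_holo F" "unif_holo G" "unif_bigo 1 G"
  shows "unif_holo (\<lambda>n z. F n (G n z))"
proof -
  obtain M \<rho> where 1: "0 < \<rho>" "\<And>n. holomorphic_map_on (F n) (ball 0 \<rho>)" "\<And>n z. norm z < \<rho> \<Longrightarrow> norm (F n z) \<le> M"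
    by (rule unif_holoE[OF assms(1), of 1]) auto
  obtain M' \<rho>' where 2: "0 < \<rho>'" "\<And>n. holomorphic_map_on (G n) (ball 0 \<rho>')"
    by (rule unif_holoE[OF assms(2), of 1]) auto
  obtain C \<sigma> where 3: "0 < \<sigma>" "\<And>n z. norm z < \<sigma> \<Longrightarrow> norm (G n z) < \<rho>"
    using unif_bigo1_small[OF assms(3) 1(1)] unfolding eventually_nhds_metric by auto
  show ?thesis
  proof (rule unif_holoI[of "min \<sigma> \<rho>'" _ M])
    show "holomorphic_map_on (\<lambda>z. F n (G n z)) (ball 0 (min \<sigma> \<rho>'))" for n
    proof (rule holo_map_compose[OF _ 1(2)])
      show "holomorphic_map_on (G n) (ball 0 (min \<sigma> \<rho>'))"
        by (rule holo_map_subset[OF 2(2)]) auto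
      show "G n ` ball 0 (min \<sigma> \<rho>') \<subseteq> ball 0 \<rho>" using 3(2) by auto
    qed
  qed (use 1 2 3 in auto)
qed

lemma unif_holo_linear:
  fixes L :: "complex ^ 'n \<Rightarrow> complex ^ 'm"
  assumes "bounded_linear L" "\<And>c v. L (c *s v) = c *s L v"
  shows "unif_holo (\<lambda>n. L)"
proof -
  obtain K where K: "\<And>x. norm (L x) \<le> norm x * K" using bounded_linear.bounded[OF assms(1)] by blast
  show ?thesis
  proof (rule unif_holoI[of 1 _ "\<bar>K\<bar>"])
    show "holomorphic_map_on L (ball 0 1)"
      by (rule holo_mapI[of _ _ "\<lambda>_. L"]) (use assms in \<open>auto intro: bounded_linear_imp_has_derivative\<close>)
    fix z :: "complex ^ 'n" assume z: "norm z < 1"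
    have "norm (L z) \<le> norm z * K" by (rule K)
    also have "\<dots> \<le> norm z * \<bar>K\<bar>" by (intro mult_left_mono) auto
    also have "\<dots> \<le> 1 * \<bar>K\<bar>" using z by (intro mult_right_mono) auto
    finally show "norm (L z) \<le> \<bar>K\<bar>" by simp
  qed simp
qed

section \<open>Lipschitz and Taylor estimates uniform in the index\<close>

lemma unif_holo_lipschitz:
  fixes F :: "nat \<Rightarrow> complex ^ 'n \<Rightarrow> complex ^ 'm"
  assumes "unif_holo F"
  obtains K \<sigma> where "K \<ge> 0" "\<sigma> > 0" "\<And>n x y. norm x < \<sigma> \<Longrightarrow> norm y < \<sigma> \<Longrightarrow> norm (F n x - F n y) \<le> K * norm (x - y)"
proof -
  obtain M \<rho> where 1: "M \<ge> 0" "0 < \<rho>" "\<And>n. holomorphic_map_on (F n) (ball 0 \<rho>)" "\<And>n z. norm z < \<rho> \<Longrightarrow> norm (F n z) \<le> M"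
    by (rule unif_holoE[OF assms, of 1]) auto
  show ?thesis
  proof (rule that[of "4 * real CARD('m) * M / \<rho>" "\<rho> / 2"])
    show "norm (F n x - F n y) \<le> 4 * real CARD('m) * M / \<rho> * norm (x - y)"
      if "norm x < \<rho> / 2" "norm y < \<rho> / 2" for n x y
      using that 1 by (intro holomorphic_lipschitz[where z = 0 and r = \<rho>]) auto
  qed (use 1 in auto)
qed

lemma unif_holo_imp_unif_bigo1:
  assumes "unif_holo F" "\<And>n. F n 0 = 0"
  shows "unif_bigo 1 F"
proof -
  obtain K \<sigma> where 1: "K \<ge> 0" "\<sigma> > 0" "\<And>n x y. norm x < \<sigma> \<Longrightarrow> norm y < \<sigma> \<Longrightarrow> norm (F n x - F n y) \<le> K * norm (x - y)"
    using unif_holo_lipschitz[OF assms(1)] by metis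
  show ?thesis
    by (rule unif_bigoI[of \<sigma> _ K]) (use 1(3)[of _ 0] 1 assms(2) in auto)
qed

lemma unif_holo_remainder:
  fixes F :: "nat \<Rightarrow> complex ^ 'n \<Rightarrow> complex ^ 'm"
  assumes "unif_holo F"
  obtains K \<sigma> where "K \<ge> 0" "\<sigma> > 0"
    "\<And>n x y s. norm x \<le> s \<Longrightarrow> norm y \<le> s \<Longrightarrow> s < \<sigma> \<Longrightarrow>
       norm (F n x - F n y - cderiv (F n) 0 (x - y)) \<le> K * s * norm (x - y)"
proof -
  obtain M \<rho> where 1: "M \<ge> 0" "0 < \<rho>" "\<And>n. holomorphic_map_on (F n) (ball 0 \<rho>)" "\<And>n z. norm z < \<rho> \<Longrightarrow> norm (F n z) \<le> M"
    by (rule unif_holoE[OF assms, of 1]) auto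
  show ?thesis
  proof (rule that[of "32 * (real CARD('m))\<^sup>2 * M / \<rho>\<^sup>2" "\<rho> / 4"])
    show "norm (F n x - F n y - cderiv (F n) 0 (x - y)) \<le> 32 * (real CARD('m))\<^sup>2 * M / \<rho>\<^sup>2 * s * norm (x - y)"
      if "norm x \<le> s" "norm y \<le> s" "s < \<rho> / 4" for n x y s
      using that 1 by (intro holomorphic_remainder_bound) auto
  qed (use 1 in auto)
qed

lemma unif_holo_imp_unif_bigo2:
  assumes "unif_holo F" "\<And>n. F n 0 = 0"
  shows "unif_bigo 2 (\<lambda>n z. F n z - cderiv (F n) 0 z)"
proof -
  obtain K \<sigma> where 1: "K \<ge> 0" "\<sigma> > 0"
    "\<And>n x y s. norm x \<le> s \<Longrightarrow> norm y \<le> s \<Longrightarrow> s < \<sigma> \<Longrightarrow>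
       norm (F n x - F n y - cderiv (F n) 0 (x - y)) \<le> K * s * norm (x - y)"
    using unif_holo_remainder[OF assms(1)] by metis
  show ?thesis
  proof (rule unif_bigoI[of \<sigma> _ K])
    show "norm (F n z - cderiv (F n) 0 z) \<le> K * (norm z)\<^sup>2" if "norm z < \<sigma>" for n z
      using 1(3)[of z "norm z" 0 n] that assms(2) by (simp add: power2_eq_square mult.assoc)
  qed (rule 1)
qed

text \<open>\<open>\<Phi> n x y\<close> is Lipschitz in x - y with a constant of order e in the size
  of its arguments, so the orders add. Used with e = 1 for Taylor remainders and with e = d - 1 for
  homogeneous polynomials of degree d.\<close>

lemma unif_bigo_lipschitz_compose:
  fixes G G' :: "nat \<Rightarrow> complex ^ 'k \<Rightarrow> complex ^ 'n"
  assumes \<Phi>: "\<And>n x y s. norm x \<le> s \<Longrightarrow> norm y \<le> s \<Longrightarrow> s < \<sigma> \<Longrightarrow> norm (\<Phi> n x y) \<le> K * s ^ e * norm (x - y)"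
    and K: "K \<ge> 0" "\<sigma> > 0" and G: "unif_bigo 1 G" "unif_bigo 1 G'" and d: "unif_bigo d (\<lambda>n z. G n z - G' n z)"
  shows "unif_bigo (e + d) (\<lambda>n z. \<Phi> n (G n z) (G' n z))"
proof -
  obtain D1 \<sigma>1 where D1: "D1 \<ge> 0" "0 < \<sigma>1" "\<And>n z. norm z < \<sigma>1 \<Longrightarrow> norm (G n z) \<le> D1 * norm z ^ 1"
    by (rule unif_bigoE[OF G(1) zero_less_one]) (rule that)
  obtain D2 \<sigma>2 where D2: "D2 \<ge> 0" "0 < \<sigma>2" "\<And>n z. norm z < \<sigma>2 \<Longrightarrow> norm (G' n z) \<le> D2 * norm z ^ 1"
    by (rule unif_bigoE[OF G(2) zero_less_one]) (rule that)
  obtain C \<sigma>3 where C: "C \<ge> 0" "0 < \<sigma>3" "\<And>n z. norm z < \<sigma>3 \<Longrightarrow> norm (G n z - G' n z) \<le> C * norm z ^ d"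
    by (rule unif_bigoE[OF d zero_less_one]) (rule that)
  define D where "D = D1 + D2 + 1"
  have D: "D > 0" "D1 * norm z \<le> D * norm z" "D2 * norm z \<le> D * norm z" for z :: "complex ^ 'k"
    using D1(1) D2(1) by (auto simp: D_def intro: mult_right_mono)
  show ?thesis
  proof (rule unif_bigoI[of "min (min \<sigma>1 \<sigma>2) (min \<sigma>3 (\<sigma> / D))" _ "K * D ^ e * C"])
    fix n and z :: "complex ^ 'k" assume z: "norm z < min (min \<sigma>1 \<sigma>2) (min \<sigma>3 (\<sigma> / D))"
    have "norm (\<Phi> n (G n z) (G' n z)) \<le> K * (D * norm z) ^ e * norm (G n z - G' n z)"
      using z D1(3)[of z n] D2(3)[of z n] D(2,3)[of z] D(1) by (intro \<Phi>) (auto simp: field_simps)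
    also have "\<dots> \<le> K * (D * norm z) ^ e * (C * norm z ^ d)"
      using z C(3)[of z n] K(1) D(1) by (intro mult_left_mono) auto
    finally show "norm (\<Phi> n (G n z) (G' n z)) \<le> K * D ^ e * C * norm z ^ (e + d)"
      by (simp add: power_mult_distrib power_add mult_ac)
  qed (use D1 D2 C K D in auto)
qed

lemma unif_bigo_compose_remainder:
  assumes F: "unif_holo F" and G: "unif_bigo 1 G" "unif_bigo 1 G'" "unif_bigo d (\<lambda>n z. G n z - G' n z)"
  shows "unif_bigo (Suc d) (\<lambda>n z. F n (G n z) - F n (G' n z) - cderiv (F n) 0 (G n z - G' n z))"
proof -
  obtain K \<sigma> where "K \<ge> 0" "\<sigma> > 0"
    "\<And>n x y s. norm x \<le> s \<Longrightarrow> norm y \<le> s \<Longrightarrow> s < \<sigma> \<Longrightarrow>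
       norm (F n x - F n y - cderiv (F n) 0 (x - y)) \<le> K * s * norm (x - y)"
    using unif_holo_remainder[OF F] by metis
  then show ?thesis
    using unif_bigo_lipschitz_compose[of \<sigma> "\<lambda>n x y. F n x - F n y - cderiv (F n) 0 (x - y)" K 1 G G' d] G by simp
qed

lemma has_derivative_of_quadratic:
  fixes F :: "'a::real_normed_vector \<Rightarrow> 'b::real_normed_vector"
  assumes L: "bounded_linear L" and \<sigma>: "\<sigma> > 0" and b: "\<And>z. norm z < \<sigma> \<Longrightarrow> norm (F z - L z) \<le> C * norm z ^ 2"
  shows "(F has_derivative L) (at 0)" "F 0 = 0"
proof -
  have "norm (F 0 - L 0) \<le> C * norm (0::'a) ^ 2" using \<sigma> by (intro b) simp
  then show F0: "F 0 = 0" using linear_0[OF bounded_linear.linear[OF L]] by simp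
  show "(F has_derivative L) (at 0)"
    unfolding has_derivative_at_within
  proof (intro conjI L)
    have "((\<lambda>z::'a. \<bar>C\<bar> * norm z) \<longlongrightarrow> \<bar>C\<bar> * norm (0::'a)) (at 0)" by (intro tendsto_intros)
    then have t: "((\<lambda>z::'a. \<bar>C\<bar> * norm z) \<longlongrightarrow> 0) (at 0)" by simp
    show "((\<lambda>y. (F y - F 0 - L (y - 0)) /\<^sub>R norm (y - 0)) \<longlongrightarrow> 0) (at 0)"
    proof (rule Lim_null_comparison[OF _ t])
      have "norm ((F y - F 0 - L (y - 0)) /\<^sub>R norm (y - 0)) \<le> \<bar>C\<bar> * norm y" if y: "y \<noteq> 0" "dist y 0 < \<sigma>" for y
      proof -
        have "norm (F y - L y) \<le> \<bar>C\<bar> * norm y * norm y"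
          using b[of y] y order_trans[OF _ mult_right_mono[OF abs_ge_self[of C], of "norm y * norm y"]]
          by (simp add: power2_eq_square mult.assoc)
        then have "inverse (norm y) * norm (F y - L y) \<le> inverse (norm y) * (\<bar>C\<bar> * norm y * norm y)"
          by (intro mult_left_mono) auto
        moreover have "inverse (norm y) * (\<bar>C\<bar> * norm y * norm y) = \<bar>C\<bar> * norm y" using y by simp
        moreover have "norm ((F y - F 0 - L (y - 0)) /\<^sub>R norm (y - 0)) = inverse (norm y) * norm (F y - L y)"
          using F0 by simp
        ultimately show ?thesis by (simp only:)
      qed
      then show "\<forall>\<^sub>F y in at 0. norm ((F y - F 0 - L (y - 0)) /\<^sub>R norm (y - 0)) \<le> \<bar>C\<bar> * norm y"
        unfolding eventually_at using \<sigma> by blast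
    qed
  qed
qed

lemma unif_bigo2_cderiv:
  assumes L: "bounded_linear L" and "unif_bigo 2 (\<lambda>n z. F n z - L z)"
  shows "cderiv (F n) 0 = L" "F n 0 = 0" "(F n has_derivative L) (at 0)"
proof -
  obtain C \<sigma> where 1: "C \<ge> 0" "0 < \<sigma>" "\<And>n z. norm z < \<sigma> \<Longrightarrow> norm (F n z - L z) \<le> C * norm z ^ 2"
    by (rule unif_bigoE[OF assms(2), of 1]) auto
  show "F n 0 = 0" "(F n has_derivative L) (at 0)"
    using has_derivative_of_quadratic[OF L 1(2,3)] by auto
  then show "cderiv (F n) 0 = L" by (simp add: cderiv_eq)
qed

section \<open>Homogeneous polynomials with uniformly bounded coefficients\<close>

definition hom_poly :: "nat \<Rightarrow> ('n::finite list \<Rightarrow> complex ^ 'm) \<Rightarrow> complex ^ 'n \<Rightarrow> complex ^ 'm" where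
  "hom_poly d q z = (\<Sum>w\<in>words d. word_mon w z *s q w)"

lemma holo_map_hom_poly: "holomorphic_map_on (hom_poly d q) U"
  unfolding hom_poly_def by (intro holo_map_sum holo_map_word_mon) auto

context
  fixes q :: "nat \<Rightarrow> 'n::finite list \<Rightarrow> complex ^ 'm" and C :: real and d :: nat
  assumes q: "\<And>n w. norm (q n w) \<le> C"
begin

lemma hom_poly_bound: "norm (hom_poly d (q n) z) \<le> real (card (words d :: 'n list set)) * C * norm z ^ d"
proof -
  have "norm (hom_poly d (q n) z) \<le> (\<Sum>w\<in>(words d :: 'n list set). norm z ^ d * C)"
    unfolding hom_poly_def
  proof (rule sum_norm_le)
    fix w :: "'n list" assume "w \<in> words d"
    then show "norm (word_mon w z *s q n w) \<le> norm z ^ d * C"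
      unfolding norm_smult using q norm_word_mon_le[of w z] by (intro mult_mono) (auto simp: words_def)
  qed
  then show ?thesis by (simp add: mult_ac)
qed

lemma hom_poly_unif_bigo: "unif_bigo d (\<lambda>n. hom_poly d (q n))"
  by (rule unif_bigoI[of 1], simp, rule hom_poly_bound)

lemma hom_poly_unif_holo: "unif_holo (\<lambda>n. hom_poly d (q n))"
proof -
  have C: "C \<ge> 0" using q norm_ge_zero order_trans by blast
  show ?thesis
  proof (rule unif_holoI[of 1 _ "real (card (words d :: 'n list set)) * C"])
    fix n and z :: "complex ^ 'n" assume "norm z < 1"
    then have "real (card (words d :: 'n list set)) * C * norm z ^ d \<le> real (card (words d :: 'n list set)) * C * 1"
      using C by (intro mult_left_mono) (auto simp: power_le_one)
    then show "norm (hom_poly d (q n) z) \<le> real (card (words d :: 'n list set)) * C"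
      using hom_poly_bound[of n z] by simp
  qed (auto intro: holo_map_hom_poly)
qed

text \<open>Exchanging the argument for one with the same linear part gains an order: the Lipschitz
  constant has order d - 1 and the arguments differ to order 2.\<close>

lemma hom_poly_unif_bigo_diff:
  fixes G :: "nat \<Rightarrow> complex ^ 'k \<Rightarrow> complex ^ 'n"
  assumes G: "unif_bigo 1 G" "unif_bigo 1 G'" and d: "unif_bigo 2 (\<lambda>n z. G n z - G' n z)" and d1: "d \<ge> 1"
  shows "unif_bigo (Suc d) (\<lambda>n z. hom_poly d (q n) (G n z) - hom_poly d (q n) (G' n z))"
proof -
  have C: "C \<ge> 0" using q norm_ge_zero order_trans by blast
  define K where "K = real (card (words d :: 'n list set)) * real d * C"
  have K: "K \<ge> 0" using C by (simp add: K_def)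
  have lip: "norm (hom_poly d (q n) x - hom_poly d (q n) y) \<le> K * s ^ (d - 1) * norm (x - y)"
    if "norm x \<le> s" "norm y \<le> s" for n x y s
  proof -
    have "hom_poly d (q n) x - hom_poly d (q n) y = (\<Sum>w\<in>words d. (word_mon w x - word_mon w y) *s q n w)"
      by (simp add: hom_poly_def sum_subtractf vector_sub_rdistrib)
    also have "norm \<dots> \<le> (\<Sum>w\<in>(words d :: 'n list set). (real d * s ^ (d - 1) * norm (x - y)) * C)"
    proof (rule sum_norm_le)
      fix w :: "'n list" assume "w \<in> words d"
      then have l: "length w = d" by (simp add: words_def)
      show "norm ((word_mon w x - word_mon w y) *s q n w) \<le> real d * s ^ (d - 1) * norm (x - y) * C"
        unfolding norm_smult
        using word_mon_diff_le[OF that, of w] q order_trans[OF norm_ge_zero that(1)] unfolding l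
        by (intro mult_mono) auto
    qed
    finally show ?thesis by (simp add: K_def mult_ac)
  qed
  have "unif_bigo (d - 1 + 2) (\<lambda>n z. hom_poly d (q n) (G n z) - hom_poly d (q n) (G' n z))"
    by (rule unif_bigo_lipschitz_compose[OF lip K zero_less_one G d])
  then show ?thesis using d1 by (simp add: numeral_2_eq_2)
qed

end

text \<open>The constants of \<open>leading_term_expansion\<close> serve all maps on a given ball,
  so coefficients chosen separately for each n remain uniformly bounded.\<close>

lemma unif_bigo_leading_term:
  fixes H :: "nat \<Rightarrow> complex ^ 'n \<Rightarrow> complex ^ 'm"
  assumes "unif_holo H" "unif_bigo d H"
  obtains p C where "\<And>n w. norm (p n w) \<le> C" "unif_bigo (Suc d) (\<lambda>n z. H n z - hom_poly d (p n) z)"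
proof -
  obtain M \<rho> where 1: "0 < \<rho>" "\<And>n. holomorphic_map_on (H n) (ball 0 \<rho>)"
    by (rule unif_holoE[OF assms(1), of 1]) auto
  obtain C \<sigma> where 2: "C \<ge> 0" "0 < \<sigma>" "\<sigma> \<le> \<rho>" "\<And>n z. norm z < \<sigma> \<Longrightarrow> norm (H n z) \<le> C * norm z ^ d"
    by (rule unif_bigoE[OF assms(2) 1(1)]) auto
  obtain K \<tau> where K: "\<tau> > 0" "\<forall>(H :: complex ^ 'n \<Rightarrow> complex ^ 'm) C.
    C \<ge> 0 \<and> holomorphic_map_on H (ball 0 \<sigma>) \<and> (\<forall>z\<in>ball 0 \<sigma>. norm (H z) \<le> C * norm z ^ d) \<longrightarrow>
    (\<exists>p. (\<forall>w. norm (p w) \<le> K * C) \<and>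
       (\<forall>z\<in>ball 0 \<tau>. norm (H z - (\<Sum>w\<in>words d. word_mon w z *s p w)) \<le> K * C * norm z ^ Suc d))"
    using leading_term_expansion[OF 2(2), of d] by (elim exE conjE) (rule that)
  have "\<exists>p. (\<forall>w. norm (p w) \<le> K * C) \<and> (\<forall>z\<in>ball 0 \<tau>. norm (H n z - (\<Sum>w\<in>words d. word_mon w z *s p w)) \<le> K * C * norm z ^ Suc d)" for n
  proof (rule K(2)[rule_format], intro conjI)
    show "holomorphic_map_on (H n) (ball 0 \<sigma>)" using 2 by (intro holo_map_subset[OF 1(2)]) auto
  qed (use 2 in auto)
  from choice[OF allI, OF this] obtain p where p: "\<forall>n. (\<forall>w. norm (p n w) \<le> K * C) \<and>
     (\<forall>z\<in>ball 0 \<tau>. norm (H n z - (\<Sum>w\<in>words d. word_mon w z *s p n w)) \<le> K * C * norm z ^ Suc d)" ..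
  show ?thesis
  proof (rule that[of p "K * C"])
    show "norm (p n w) \<le> K * C" for n w using p by blast
    show "unif_bigo (Suc d) (\<lambda>n z. H n z - hom_poly d (p n) z)"
      using p unfolding hom_poly_def by (intro unif_bigoI[OF K(1), of _ "K * C"]) simp
  qed
qed

section \<open>Normal form of a contracting sequence\<close>

text \<open>If |\<beta>| < 1, iterating the equation towards larger n gives a convergent series. If
  |\<beta>| > 1, solving for x(n+1) is a contracting recursion. On |\<beta>| = 1 neither direction
  yields bounds.\<close>

lemma cohomological_equation:
  fixes \<beta> :: complex and p :: "nat \<Rightarrow> complex"
  assumes p: "\<And>n. norm (p n) \<le> P" and \<beta>: "norm \<beta> \<noteq> 1" "\<beta> \<noteq> 0"
  shows "\<exists>x M. (\<forall>n. norm (x n) \<le> M) \<and> (\<forall>n. \<beta> * x (Suc n) - x n = - p n)"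
proof (cases "norm \<beta> < 1")
  case True
  have P: "P \<ge> 0" using p norm_ge_zero order_trans by blast
  have sg: "summable (\<lambda>k. norm \<beta> ^ k * P)" using True by (intro summable_mult2 summable_geometric) simp
  have b: "norm (\<beta> ^ k * p (n + k)) \<le> norm \<beta> ^ k * P" for n k
    unfolding norm_mult norm_power using p by (intro mult_left_mono) auto
  have sm: "summable (\<lambda>k. \<beta> ^ k * p (n + k))" for n
    by (rule summable_comparison_test'[OF sg b])
  define x where "x n = (\<Sum>k. \<beta> ^ k * p (n + k))" for n
  have "norm (x n) \<le> (\<Sum>k. norm \<beta> ^ k * P)" for n
    unfolding x_def by (rule norm_suminf_le[OF b sg])
  moreover have "\<beta> * x (Suc n) - x n = - p n" for n
  proof -
    have "x n = p n + (\<Sum>k. \<beta> ^ Suc k * p (n + Suc k))"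
      unfolding x_def using suminf_split_head[OF sm[of n]] by simp
    also have "(\<Sum>k. \<beta> ^ Suc k * p (n + Suc k)) = \<beta> * x (Suc n)"
      unfolding x_def by (subst suminf_mult[OF sm, symmetric]) (simp add: mult.assoc)
    finally show ?thesis by simp
  qed
  ultimately show ?thesis by blast
next
  case False
  then have b1: "norm \<beta> > 1" using \<beta> by simp
  have P: "P \<ge> 0" using p norm_ge_zero order_trans by blast
  \<comment> \<open>Started at 0, the recursion remains below the level \<open>M\<close> fixed by M
    = (M + P) / |\<beta>|.\<close>
  define x where "x = rec_nat 0 (\<lambda>n y. (y - p n) / \<beta>)"
  have x: "x 0 = 0" "\<And>n. x (Suc n) = (x n - p n) / \<beta>" by (simp_all add: x_def)
  define M where "M = P / (norm \<beta> - 1)"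
  have M: "M \<ge> 0" "M + P = M * norm \<beta>" using b1 P by (auto simp: M_def field_simps)
  have "norm (x n) \<le> M" for n
  proof (induction n)
    case (Suc n)
    have "norm (x n - p n) \<le> M * norm \<beta>" using norm_triangle_ineq4[of "x n" "p n"] Suc p[of n] M by simp
    then show ?case using b1 M(1) by (simp add: x norm_divide divide_le_eq)
  qed (simp add: x M)
  moreover have "\<beta> * x (Suc n) - x n = - p n" for n using \<beta> by (simp add: x)
  ultimately show ?thesis by blast
qed

section \<open>Diagonal linear maps\<close>

definition diag_map :: "('n \<Rightarrow> complex) \<Rightarrow> complex ^ 'n \<Rightarrow> complex ^ 'n::finite" where
  "diag_map c z = (\<chi> i. c i * z $ i)"

lemma diag_map_nth [simp]: "diag_map c z $ i = c i * z $ i"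
  by (simp add: diag_map_def)

lemma diag_map_diag_map: "diag_map c (diag_map c' z) = diag_map (\<lambda>i. c i * c' i) z"
  by (simp add: vec_eq_iff)

lemma diag_map_linear: "diag_map c (x + y) = diag_map c x + diag_map c y" "diag_map c (x - y) = diag_map c x - diag_map c y"
  "diag_map c (k *s x) = k *s diag_map c x" "diag_map c 0 = 0"
  by (simp_all add: vec_eq_iff algebra_simps)

lemma norm_diag_map_le:
  assumes "\<And>i. norm (c i) \<le> b"
  shows "norm (diag_map c z) \<le> b * norm (z :: complex ^ 'n)"
proof -
  have b: "b \<ge> 0" using assms norm_ge_zero order_trans by blast
  have "norm (diag_map c z) \<le> L2_set (\<lambda>i. b * norm (z $ i)) UNIV"
    unfolding norm_vec_def by (intro L2_set_mono) (auto simp: norm_mult intro: mult_right_mono assms)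
  also have "\<dots> = b * norm z" unfolding norm_vec_def by (rule L2_set_right_distrib[OF b, symmetric])
  finally show ?thesis .
qed

lemma bounded_linear_diag_map: "bounded_linear (diag_map c :: complex ^ 'n \<Rightarrow> _)"
proof (rule bounded_linear_intro)
  show "norm (diag_map c x) \<le> norm x * (\<Sum>i\<in>UNIV. norm (c i))" for x :: "complex ^ 'n"
    using norm_diag_map_le[of c "\<Sum>i\<in>UNIV. norm (c i)" x] member_le_sum[of _ UNIV "\<lambda>i. norm (c i)"]
    by (simp add: mult.commute)
qed (simp_all add: vec_eq_iff algebra_simps)

lemma holo_map_diag_map: "holomorphic_map_on (diag_map c) U"
  by (rule holo_mapI[of _ _ "\<lambda>_. diag_map c"])
    (auto intro: bounded_linear_imp_has_derivative bounded_linear_diag_map simp: diag_map_linear)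

lemma unif_holo_diag_map: "unif_holo (\<lambda>n. diag_map c)"
  by (rule unif_holo_linear[OF bounded_linear_diag_map diag_map_linear(3)])

lemma unif_bigo_diag_map: "unif_bigo d F \<Longrightarrow> unif_bigo d (\<lambda>n z. diag_map c (F n z))"
  by (rule unif_bigo_bound[of d F _ "\<Sum>i\<in>UNIV. norm (c i)"])
    (auto intro!: norm_diag_map_le member_le_sum sum_nonneg)

lemma unif_bigo1_diag_map: "unif_bigo 1 (\<lambda>n. diag_map c)"
  by (rule unif_holo_imp_unif_bigo1[OF unif_holo_diag_map diag_map_linear(4)])

text \<open>Only germs at 0 with a common diagonal linear part occur here. The unit ball is left
  out, so radii may shrink as long as they do not depend on n.\<close>

locale contracting_sequence =
  fixes a :: "'n::finite \<Rightarrow> complex" and \<phi> :: "nat \<Rightarrow> complex ^ 'n \<Rightarrow> complex ^ 'n"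
  assumes a: "a i \<noteq> 0" "norm (a i) < 1"
    and \<phi>_unif_holo: "unif_holo \<phi>" and \<phi>_unif_bigo2: "unif_bigo 2 (\<lambda>n z. \<phi> n z - diag_map a z)"
begin

definition word_weight :: "'n list \<Rightarrow> complex" where "word_weight w = prod_list (map a w)"

lemma word_weight_simps [simp]: "word_weight [] = 1" "word_weight (i # w) = a i * word_weight w"
  by (simp_all add: word_weight_def)

lemma word_weight_nonzero: "word_weight w \<noteq> 0" and norm_word_weight_le: "norm (word_weight w) \<le> 1"
proof -
  show "word_weight w \<noteq> 0" by (induction w) (auto simp: a)
  show "norm (word_weight w) \<le> 1"
  proof (induction w)
    case (Cons i w)
    have "norm (a i) * norm (word_weight w) \<le> 1 * 1" using a(2)[of i] Cons by (intro mult_mono) auto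
    then show ?case by (simp add: norm_mult)
  qed simp
qed

text \<open>After removing one letter \<open>j\<close>, at least one factor of modulus below 1 is
  left. Hence the coordinates in a resonant monomial of component \<open>l\<close> decay strictly
  more slowly than the \<open>l\<close>-th, the source of triangularity.\<close>

lemma norm_word_weight_less:
  assumes "j \<in> set w" "length w \<ge> 2"
  shows "norm (word_weight w) < norm (a j)"
proof -
  obtain u v where w: "w = u @ j # v" using assms(1) by (meson split_list)
  have eq: "word_weight w = a j * word_weight (u @ v)" unfolding w word_weight_def by (simp add: mult_ac)
  have "norm (word_weight (u @ v)) < 1"
  proof (cases "u @ v")
    case Nil
    then show ?thesis using assms w by simp
  next
    case (Cons i x)
    have "norm (a i) * norm (word_weight x) \<le> norm (a i) * 1" using norm_word_weight_le by (intro mult_left_mono) auto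
    then show ?thesis using a(2)[of i] Cons by (simp add: norm_mult)
  qed
  then show ?thesis unfolding eq norm_mult using a(1)[of j] by simp
qed

lemma word_mon_diag_map: "word_mon w (diag_map a z) = word_weight w * word_mon w z"
  by (induction w) auto

text \<open>Moduli are compared rather than eigenvalues, since a multiplier of modulus 1 already
  obstructs \<open>cohomological_equation\<close>.\<close>

definition resonant :: "'n \<Rightarrow> 'n list \<Rightarrow> bool" where
  "resonant l w \<longleftrightarrow> length w \<ge> 2 \<and> norm (word_weight w) = norm (a l)"

text \<open>The terms that survive in the normal form. The triangularity condition makes the model maps
  below invertible and forces their backward orbits to tend to \<open>0\<close>.\<close>

definition shear :: "(nat \<Rightarrow> complex ^ 'n \<Rightarrow> complex ^ 'n) \<Rightarrow> bool" where
  "shear R \<longleftrightarrow> (\<forall>n. entire_map (R n)) \<and> unif_holo R \<and> unif_bigo 2 R \<and>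
     (\<forall>n l z z'. (\<forall>j. norm (a j) > norm (a l) \<longrightarrow> z $ j = z' $ j) \<longrightarrow> R n z $ l = R n z' $ l) \<and>
     ((\<forall>l w. \<not> resonant l w) \<longrightarrow> (\<forall>n z. R n z = 0))"

definition lin :: "complex ^ 'n \<Rightarrow> complex ^ 'n" where "lin = diag_map a"
definition lin_inv :: "complex ^ 'n \<Rightarrow> complex ^ 'n" where "lin_inv = diag_map (\<lambda>i. 1 / a i)"

lemma lin_lin_inv [simp]: "lin (lin_inv z) = z" "lin_inv (lin z) = z"
  by (simp_all add: lin_def lin_inv_def vec_eq_iff a)

text \<open>Approximates the inverse of \<open>\<phi> n\<close>, not \<open>\<phi> n\<close> itself, so that the chain is a limit of
  compositions of these maps and no inverse enters its construction.\<close>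

definition model_map :: "(nat \<Rightarrow> complex ^ 'n \<Rightarrow> complex ^ 'n) \<Rightarrow> nat \<Rightarrow> complex ^ 'n \<Rightarrow> complex ^ 'n" where
  "model_map R n z = lin_inv z + R n z"

lemma shear_add:
  assumes "shear R" "shear R'"
  shows "shear (\<lambda>n z. R n z + R' n z)"
  using assms unfolding shear_def entire_map_def
  by (auto intro!: unif_holo_add unif_bigo_add holo_map_add arg_cong2[where f = "(+)"])

lemma unif_holo_model_map: "shear R \<Longrightarrow> unif_holo (model_map R)"
  unfolding model_map_def[abs_def] lin_inv_def shear_def by (auto intro: unif_holo_add unif_holo_diag_map)

lemma model_map_minus_lin_inv: "shear R \<Longrightarrow> unif_bigo 2 (\<lambda>n z. model_map R n z - lin_inv z)"
  unfolding model_map_def shear_def by simp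

text \<open>The equation decouples into one scalar equation per word and component, with multiplier
  \<open>word_weight w / a l\<close>: composing with \<open>lin\<close> multiplies a monomial by its
  weight and \<open>lin_inv\<close> divides component \<open>l\<close> by \<open>a l\<close>. Off
  resonance it is solved by \<open>x\<close> with r = 0, at resonance by \<open>r\<close> with x =
  0.\<close>

lemma homological_equation:
  fixes p :: "nat \<Rightarrow> 'n list \<Rightarrow> complex ^ 'n"
  assumes p: "\<And>n w. norm (p n w) \<le> P" and d: "d \<ge> 2"
  obtains x r C where "\<And>n w. norm (x n w) \<le> C" "\<And>n w. norm (r n w) \<le> C"
    "\<And>n w l. length w = d \<Longrightarrow> r n w $ l \<noteq> 0 \<Longrightarrow> resonant l w"
    "\<And>n w l. length w = d \<Longrightarrow> p n w + lin_inv (word_weight w *s x (Suc n) w) - x n w + word_weight w *s r n w = 0"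
proof -
  have P: "P \<ge> 0" using p norm_ge_zero order_trans by blast
  have pc: "norm (p n w $ l) \<le> P" for n w l using p norm_component_le order_trans by blast
  have "\<exists>y s M. (\<forall>n. norm (y n) \<le> M) \<and> (\<forall>n. norm (s n) \<le> M) \<and>
      (\<forall>n. s n \<noteq> 0 \<longrightarrow> resonant l w) \<and>
      (\<forall>n. p n w $ l + word_weight w * y (Suc n) / a l - y n + word_weight w * s n = 0)" if w: "length w = d" for w l
  proof (cases "norm (word_weight w) = norm (a l)")
    case True
    then have res: "resonant l w" using w d by (simp add: resonant_def)
    \<comment> \<open>The division by the weight compensates for evaluating the new term of the
      model map at \<open>lin z\<close>.\<close>
    show ?thesis
      by (rule exI[of _ "\<lambda>_. 0"], rule exI[of _ "\<lambda>n. - p n w $ l / word_weight w"], rule exI[of _ "P / norm (word_weight w)"])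
        (use res P pc word_weight_nonzero in \<open>auto simp: norm_divide divide_right_mono\<close>)
  next
    case False
    then have "norm (word_weight w / a l) \<noteq> 1" using a by (simp add: norm_divide)
    moreover have "word_weight w / a l \<noteq> 0" using a word_weight_nonzero by simp
    ultimately obtain y M where "\<forall>n. norm (y n) \<le> M" "\<forall>n. word_weight w / a l * y (Suc n) - y n = - p n w $ l"
      using cohomological_equation[of "\<lambda>n. p n w $ l" P "word_weight w / a l"] pc by blast
    moreover from this(1) have "M \<ge> 0" using norm_ge_zero order_trans by blast
    ultimately show ?thesis
      by (intro exI[of _ y] exI[of _ "\<lambda>_. 0"] exI[of _ M]) (simp add: algebra_simps)
  qed
  then have "\<forall>w l. \<exists>y s M. length w = d \<longrightarrow> (\<forall>n. norm (y n) \<le> M) \<and> (\<forall>n. norm (s n) \<le> M) \<and>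
      (\<forall>n. s n \<noteq> 0 \<longrightarrow> resonant l w) \<and>
      (\<forall>n. p n w $ l + word_weight w * y (Suc n) / a l - y n + word_weight w * s n = 0)" by blast
  then obtain y s M where ysM: "\<And>w l. length w = d \<Longrightarrow> (\<forall>n. norm (y w l n) \<le> M w l) \<and> (\<forall>n. norm (s w l n) \<le> M w l) \<and>
      (\<forall>n. s w l n \<noteq> 0 \<longrightarrow> resonant l w) \<and>
      (\<forall>n. p n w $ l + word_weight w * y w l (Suc n) / a l - y w l n + word_weight w * s w l n = 0)"
    unfolding choice_iff by blast
  \<comment> \<open>The bounds depend on word and component, but at a fixed degree there are
    finitely many, so their sum is a common bound.\<close>
  define C where "C = (\<Sum>w\<in>words d. \<Sum>l\<in>UNIV. M w l)"
  have M0: "M w l \<ge> 0" if "length w = d" for w l using ysM[OF that, of l] norm_ge_zero order_trans by blast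
  have C0: "C \<ge> 0" unfolding C_def by (intro sum_nonneg M0) (auto simp: words_def)
  have MC: "(\<Sum>l\<in>UNIV. M w l) \<le> C" if "length w = d" for w
    unfolding C_def
  proof (rule member_le_sum)
    show "w \<in> words d" using that by (simp add: words_def)
  qed (auto intro!: sum_nonneg M0 simp: words_def[THEN eqset_imp_iff])
  define x where "x n w = (if length w = d then (\<chi> l. y w l n) else 0)" for n w
  define r where "r n w = (if length w = d then (\<chi> l. s w l n) else 0)" for n w
  have bd: "norm v \<le> C" if "length w = d" "\<And>l. norm (v $ l) \<le> M w l" for v w
  proof -
    have "norm v \<le> (\<Sum>l\<in>UNIV. norm (v $ l))" by (simp add: norm_vec_def L2_set_le_sum)
    also have "\<dots> \<le> (\<Sum>l\<in>UNIV. M w l)" by (intro sum_mono that)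
    finally show ?thesis using MC[OF that(1)] by simp
  qed
  show ?thesis
  proof (rule that[of x C r])
    show "norm (x n w) \<le> C" for n w using C0 bd[of w "x n w"] ysM[of w] by (cases "length w = d") (auto simp: x_def)
    show "norm (r n w) \<le> C" for n w using C0 bd[of w "r n w"] ysM[of w] by (cases "length w = d") (auto simp: r_def)
    show "resonant l w" if "length w = d" "r n w $ l \<noteq> 0" for n w l
      using that ysM[OF that(1), of l] by (auto simp: r_def)
    show "p n w + lin_inv (word_weight w *s x (Suc n) w) - x n w + word_weight w *s r n w = 0" if "length w = d" for n w l
      using that ysM[OF that(1)] by (simp add: vec_eq_iff x_def r_def lin_inv_def)
  qed
qed

lemma shear_hom_poly:
  assumes d: "d \<ge> 2" and r: "\<And>n w. norm (r n w) \<le> C"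
    and res: "\<And>n w l. length w = d \<Longrightarrow> r n w $ l \<noteq> 0 \<Longrightarrow> resonant l w"
  shows "shear (\<lambda>n. hom_poly d (r n))"
  unfolding shear_def
proof (intro conjI allI impI)
  show "entire_map (hom_poly d (r n))" for n unfolding entire_map_def by (rule holo_map_hom_poly)
  show "unif_holo (\<lambda>n. hom_poly d (r n))" by (rule hom_poly_unif_holo[OF r])
  show "unif_bigo 2 (\<lambda>n. hom_poly d (r n))" by (rule unif_bigo_mono[OF hom_poly_unif_bigo[OF r] d])
  show "hom_poly d (r n) z $ l = hom_poly d (r n) z' $ l" if eq: "\<forall>j. norm (a l) < norm (a j) \<longrightarrow> z $ j = z' $ j" for n l z z'
  proof -
    have "word_mon w z * r n w $ l = word_mon w z' * r n w $ l" if w: "w \<in> words d" for w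
    proof (cases "r n w $ l = 0")
      case False
      then have "resonant l w" using w by (intro res) (auto simp: words_def)
      then have "norm (a l) < norm (a j)" if "j \<in> set w" for j
        using norm_word_weight_less[OF that] by (simp add: resonant_def)
      then have "map (($) z) w = map (($) z') w" using eq by simp
      then show ?thesis unfolding word_mon_def by (simp only:)
    qed simp
    then show ?thesis unfolding hom_poly_def sum_component vector_smult_component by (intro sum.cong refl)
  qed
  show "hom_poly d (r n) z = 0" if "\<forall>l w. \<not> resonant l w" for n z
  proof -
    have "r n w $ l = 0" if "w \<in> words d" for w l
      using that res[of w n l] \<open>\<forall>l w. \<not> resonant l w\<close> by (auto simp: words_def)
    then show ?thesis by (simp add: hom_poly_def vec_eq_iff)
  qed
qed

text \<open>Both unknowns have degree d: \<open>Q\<close> corrects the conjugacy and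
  \<open>\<rho>\<close> the model map. Modulo order d + 1, the new defect is the old leading term
  plus lin_inv Q(n+1)(lin z) - Q(n)(z) + \<rho>(n)(lin z), which is what
  \<open>homological_equation\<close> annihilates.\<close>

lemma normal_form_step:
  assumes d: "d \<ge> 2" and R: "shear R" and k: "unif_holo k" "unif_bigo 2 (\<lambda>n z. k n z - z)"
    and D: "unif_bigo d (\<lambda>n z. model_map R n (k (Suc n) (\<phi> n z)) - k n z)"
  shows "\<exists>R' k'. shear R' \<and> unif_holo k' \<and> unif_bigo 2 (\<lambda>n z. k' n z - z) \<and>
     unif_bigo (Suc d) (\<lambda>n z. model_map R' n (k' (Suc n) (\<phi> n z)) - k' n z)"
proof -
  have k1: "unif_bigo 1 k" using unif_bigo_add[OF unif_bigo_mono[OF k(2), of 1] unif_bigo_id] by simp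
  have \<phi>1: "unif_bigo 1 \<phi>" using unif_bigo_add[OF unif_bigo_mono[OF \<phi>_unif_bigo2, of 1] unif_bigo1_diag_map[of a]] by simp
  define u where "u n z = k (Suc n) (\<phi> n z)" for n z
  have u: "unif_holo u" "unif_bigo 1 u"
    unfolding u_def by (intro unif_holo_compose[OF unif_holo_shift[OF k(1)] \<phi>_unif_holo \<phi>1] unif_bigo_compose[OF unif_bigo_shift[OF k1] \<phi>1])+
  have BL: "bounded_linear lin_inv" unfolding lin_inv_def by (rule bounded_linear_diag_map)
  have S0: "model_map R n 0 = 0" "cderiv (model_map R n) 0 = lin_inv" for n
    using unif_bigo2_cderiv[OF BL model_map_minus_lin_inv[OF R]] by auto
  have SO1: "unif_bigo 1 (model_map R)" by (rule unif_holo_imp_unif_bigo1[OF unif_holo_model_map[OF R] S0(1)])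
  have Dh: "unif_holo (\<lambda>n z. model_map R n (u n z) - k n z)"
  proof -
    have "unif_holo (\<lambda>n z. diag_map (\<lambda>_. -1) (k n z))"
      by (rule unif_holo_compose[OF unif_holo_diag_map k(1) k1])
    moreover have "diag_map (\<lambda>_. -1) v = - v" for v :: "complex ^ 'n" by (simp add: vec_eq_iff)
    ultimately have "unif_holo (\<lambda>n z. - k n z)" by simp
    from unif_holo_add[OF unif_holo_compose[OF unif_holo_model_map[OF R] u] this] show ?thesis by simp
  qed
  obtain p P where p: "\<And>n w. norm (p n w) \<le> P" "unif_bigo (Suc d) (\<lambda>n z. model_map R n (u n z) - k n z - hom_poly d (p n) z)"
    by (rule unif_bigo_leading_term[OF Dh D[folded u_def]]) (rule that)
  obtain x r C where x: "\<And>n w. norm (x n w) \<le> C" and r: "\<And>n w. norm (r n w) \<le> C"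
    "\<And>n w l. length w = d \<Longrightarrow> r n w $ l \<noteq> 0 \<Longrightarrow> resonant l w"
    and eq: "\<And>n w l. length w = d \<Longrightarrow> p n w + lin_inv (word_weight w *s x (Suc n) w) - x n w + word_weight w *s r n w = 0"
    by (rule homological_equation[OF p(1) d]) (rule that)
  define Q where "Q n = hom_poly d (x n)" for n
  define \<rho> where "\<rho> n = hom_poly d (r n)" for n
  have Q: "unif_holo Q" "unif_bigo d Q" unfolding Q_def by (rule hom_poly_unif_holo[OF x] hom_poly_unif_bigo[OF x])+
  have sh: "shear \<rho>" unfolding \<rho>_def by (rule shear_hom_poly[OF d r])
  have sh': "shear (\<lambda>n z. R n z + \<rho> n z)" by (rule shear_add[OF R sh])
  define k' where "k' n z = k n z + Q n z" for n z
  have k': "unif_holo k'" "unif_bigo 2 (\<lambda>n z. k' n z - z)"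
  proof -
    show "unif_holo k'" unfolding k'_def by (intro unif_holo_add k Q)
    show "unif_bigo 2 (\<lambda>n z. k' n z - z)"
      using unif_bigo_add[OF k(2) unif_bigo_mono[OF Q(2) d]] by (simp add: k'_def algebra_simps)
  qed
  define v where "v n z = Q (Suc n) (\<phi> n z)" for n z
  have v: "unif_bigo d v" unfolding v_def by (intro unif_bigo_compose[OF unif_bigo_shift[OF Q(2)] \<phi>1])
  have uv: "unif_bigo 1 (\<lambda>n z. u n z + v n z)" using d by (intro unif_bigo_add u unif_bigo_mono[OF v]) simp
  have T1: "unif_bigo (Suc d) (\<lambda>n z. model_map R n (u n z + v n z) - model_map R n (u n z) - lin_inv (v n z))"
  proof -
    have "unif_bigo (Suc d) (\<lambda>n z. model_map R n (u n z + v n z) - model_map R n (u n z) - cderiv (model_map R n) 0 (u n z + v n z - u n z))"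
      by (rule unif_bigo_compose_remainder[OF unif_holo_model_map[OF R] uv u(2)]) (use v in simp)
    then show ?thesis by (simp add: S0)
  qed
  have T3: "unif_bigo (Suc d) (\<lambda>n z. lin_inv (Q (Suc n) (\<phi> n z) - Q (Suc n) (lin z)))"
    unfolding lin_inv_def Q_def lin_def using d
    by (intro unif_bigo_diag_map hom_poly_unif_bigo_diff[of "\<lambda>n. x (Suc n)" C] x \<phi>1 unif_bigo1_diag_map \<phi>_unif_bigo2) auto
  have T4: "unif_bigo (Suc d) (\<lambda>n z. \<rho> n (u n z + v n z) - \<rho> n (lin z))"
    unfolding \<rho>_def lin_def
  proof (rule hom_poly_unif_bigo_diff[OF r(1) uv unif_bigo1_diag_map])
    have "unif_bigo 2 (\<lambda>n z. k (Suc n) (\<phi> n z) - \<phi> n z)" by (rule unif_bigo_compose[OF unif_bigo_shift[OF k(2)] \<phi>1])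
    from unif_bigo_add[OF unif_bigo_add[OF this \<phi>_unif_bigo2] unif_bigo_mono[OF v d]]
    show "unif_bigo 2 (\<lambda>n z. u n z + v n z - diag_map a z)" by (simp add: u_def algebra_simps)
  qed (use d in simp)
  \<comment> \<open>The homological equation, summed against the monomials of degree d.\<close>
  have id: "hom_poly d (p n) z + lin_inv (Q (Suc n) (lin z)) - Q n z + \<rho> n (lin z) = 0" for n z
  proof -
    have Bs: "lin_inv (sum f I) = (\<Sum>i\<in>I. lin_inv (f i))" for f and I :: "'n list set"
      by (rule linear_sum[OF bounded_linear.linear[OF BL]])
    have Bc: "lin_inv (c *s y) = c *s lin_inv y" for c y by (simp add: lin_inv_def diag_map_linear)
    have "hom_poly d (p n) z + lin_inv (Q (Suc n) (lin z)) - Q n z + \<rho> n (lin z)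
      = (\<Sum>w\<in>words d. word_mon w z *s (p n w + lin_inv (word_weight w *s x (Suc n) w) - x n w + word_weight w *s r n w))"
      unfolding hom_poly_def Q_def \<rho>_def lin_def word_mon_diag_map Bs
      by (simp add: sum.distrib[symmetric] sum_subtractf[symmetric] Bc vector_smult_assoc
          vector_add_ldistrib vector_ssub_ldistrib mult.commute)
    also have "\<dots> = 0" using eq by (intro sum.neutral) (simp add: words_def)
    finally show ?thesis .
  qed
  \<comment> \<open>Subtracting the vanishing expression of \<open>id\<close> splits the new defect
    into four terms of order d + 1: the linearization error of the old model map, the old defect
    without its leading term, and two replacements of an argument by its linear part.\<close>
  have tot: "model_map (\<lambda>n z. R n z + \<rho> n z) n (k' (Suc n) (\<phi> n z)) - k' n z
    = (model_map R n (u n z + v n z) - model_map R n (u n z) - lin_inv (v n z))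
      + (model_map R n (u n z) - k n z - hom_poly d (p n) z)
      + (lin_inv (Q (Suc n) (\<phi> n z) - Q (Suc n) (lin z)))
      + (\<rho> n (u n z + v n z) - \<rho> n (lin z))" for n z
  proof -
    have Bd: "lin_inv (x - y) = lin_inv x - lin_inv y" for x y by (simp add: lin_inv_def diag_map_linear)
    have "model_map (\<lambda>n z. R n z + \<rho> n z) n y = model_map R n y + \<rho> n y" for y by (simp add: model_map_def)
    then show ?thesis using id[of n z] unfolding Bd
      by (simp add: k'_def u_def[symmetric] v_def[symmetric] algebra_simps)
  qed
  have "unif_bigo (Suc d) (\<lambda>n z. model_map (\<lambda>n z. R n z + \<rho> n z) n (k' (Suc n) (\<phi> n z)) - k' n z)"
    unfolding tot by (intro unif_bigo_add T1 p(2) T3 T4)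
  with sh' k' show ?thesis by blast
qed

lemma normal_form:
  assumes "d \<ge> 2"
  shows "\<exists>R k. shear R \<and> unif_holo k \<and> unif_bigo 2 (\<lambda>n z. k n z - z) \<and>
     unif_bigo d (\<lambda>n z. model_map R n (k (Suc n) (\<phi> n z)) - k n z)"
  using assms
proof (induction d rule: dec_induct)
  case base
  have "shear (\<lambda>n z. 0)" unfolding shear_def entire_map_def by auto
  \<comment> \<open>With no shear and the identity as conjugacy, the defect is
    \<open>lin_inv\<close> of \<phi> minus its linear part, already of order 2.\<close>
  moreover have "unif_bigo 2 (\<lambda>n z. model_map (\<lambda>n z. 0) n (\<phi> n z) - z)"
    using unif_bigo_diag_map[OF \<phi>_unif_bigo2, of "\<lambda>i. 1 / a i"] unfolding lin_inv_def[symmetric] lin_def[symmetric]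
    by (simp add: model_map_def lin_inv_def[THEN fun_cong] lin_def diag_map_linear) (simp add: lin_def[symmetric] lin_inv_def[symmetric])
  ultimately show ?case by (intro exI[of _ "\<lambda>n z. 0"] exI[of _ "\<lambda>n z. z"]) simp
next
  case (step d)
  then show ?case using normal_form_step by blast
qed

end

section \<open>Intertwining maps\<close>

context contracting_sequence
begin

lemma contraction_rate:
  obtains a1 where "0 < a1" "a1 < 1" "\<And>i. norm (a i) \<le> a1"
proof
  let ?m = "Max (range (\<lambda>i. norm (a i)))"
  show le: "norm (a i) \<le> ?m" for i by (intro Max_ge) auto
  have "?m \<in> range (\<lambda>i. norm (a i))" by (intro Max_in) auto
  then show "?m < 1" using a(2) by auto
  show "0 < ?m" using le[of undefined] a(1)[of undefined] by (meson less_le_trans zero_less_norm_iff)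
qed

lemma \<phi>_small_contraction:
  obtains q \<sigma> where "0 < q" "q < 1" "\<sigma> > 0" "\<And>n z. norm z < \<sigma> \<Longrightarrow> norm (\<phi> n z) \<le> q * norm z"
proof -
  obtain a1 where a1: "0 < a1" "a1 < 1" "\<And>i. norm (a i) \<le> a1" by (rule contraction_rate) (rule that)
  obtain C \<sigma> where C: "C \<ge> 0" "0 < \<sigma>" "\<And>n z. norm z < \<sigma> \<Longrightarrow> norm (\<phi> n z - diag_map a z) \<le> C * norm z ^ 2"
    by (rule unif_bigoE[OF \<phi>_unif_bigo2, of 1]) auto
  show ?thesis
  proof (rule that[of "(1 + a1) / 2" "min \<sigma> ((1 - a1) / (2 * (C + 1)))"])
    show "norm (\<phi> n z) \<le> (1 + a1) / 2 * norm z" if z: "norm z < min \<sigma> ((1 - a1) / (2 * (C + 1)))" for n z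
    proof -
      have "(C + 1) * norm z \<le> (1 - a1) / 2" using z C by (simp add: field_simps)
      then have Cz: "C * norm z \<le> (1 - a1) / 2" using norm_ge_zero[of z] by (simp add: algebra_simps del: norm_ge_zero)
      have "norm (\<phi> n z) \<le> norm (\<phi> n z - diag_map a z) + norm (diag_map a z)"
        using norm_triangle_ineq[of "\<phi> n z - diag_map a z" "diag_map a z"] by simp
      also have "\<dots> \<le> C * norm z * norm z + a1 * norm z"
        using C(3)[of z n] z norm_diag_map_le[of a a1 z, OF a1(3)] by (simp add: power2_eq_square mult.assoc)
      also have "\<dots> \<le> (1 - a1) / 2 * norm z + a1 * norm z" using Cz by (intro add_right_mono mult_right_mono) auto
      finally show ?thesis by (simp add: algebra_simps add_divide_distrib diff_divide_distrib)
    qed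
  qed (use a1 C in auto)
qed

text \<open>The rate \<open>g\<close> must not depend on \<open>R\<close>: the order of contact is
  chosen from \<open>g\<close>, and \<open>R\<close> is obtained only afterwards for that order. It
  exists because all model maps share the linear part \<open>lin_inv\<close>; only the radius
  depends on \<open>R\<close>.\<close>

lemma model_map_small_lipschitz:
  obtains g where "g > 0" "\<And>R. shear R \<Longrightarrow>
    \<exists>\<sigma>>0. \<forall>n x y. norm x < \<sigma> \<longrightarrow> norm y < \<sigma> \<longrightarrow> norm (model_map R n x - model_map R n y) \<le> g * norm (x - y)"
proof -
  have BL: "bounded_linear lin_inv" unfolding lin_inv_def by (rule bounded_linear_diag_map)
  obtain b where b: "b > 0" "\<And>x. norm (lin_inv x) \<le> norm x * b" using bounded_linear.pos_bounded[OF BL] by blast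
  show ?thesis
  proof (rule that[of "b + 1"])
    fix R assume R: "shear R"
    have S0: "cderiv (model_map R n) 0 = lin_inv" for n using unif_bigo2_cderiv[OF BL model_map_minus_lin_inv[OF R]] by auto
    obtain K \<sigma> where K: "K \<ge> 0" "\<sigma> > 0"
      "\<And>n x y s. norm x \<le> s \<Longrightarrow> norm y \<le> s \<Longrightarrow> s < \<sigma> \<Longrightarrow>
       norm (model_map R n x - model_map R n y - cderiv (model_map R n) 0 (x - y)) \<le> K * s * norm (x - y)"
      using unif_holo_remainder[OF unif_holo_model_map[OF R]] by metis
    show "\<exists>\<sigma>>0. \<forall>n x y. norm x < \<sigma> \<longrightarrow> norm y < \<sigma> \<longrightarrow> norm (model_map R n x - model_map R n y) \<le> (b + 1) * norm (x - y)"
    proof (intro exI[of _ "min \<sigma> (1 / (K + 1))"] conjI allI impI)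
      show "0 < min \<sigma> (1 / (K + 1))" using K by simp
      fix n and x y :: "complex ^ 'n" assume xy: "norm x < min \<sigma> (1 / (K + 1))" "norm y < min \<sigma> (1 / (K + 1))"
      define s where "s = max (norm x) (norm y)"
      have s: "s < \<sigma>" "(K + 1) * s \<le> 1" "s \<ge> 0" using xy K by (auto simp: s_def field_simps max_def le_max_iff_disj)
      then have Ks: "K * s \<le> 1" by (simp add: algebra_simps)
      have "norm (model_map R n x - model_map R n y - lin_inv (x - y)) \<le> K * s * norm (x - y)"
        using K(3)[of x s y n] s by (simp add: S0 s_def)
      also have "\<dots> \<le> 1 * norm (x - y)" using Ks by (intro mult_right_mono) auto
      finally have "norm (model_map R n x - model_map R n y - lin_inv (x - y)) \<le> norm (x - y)" by simp
      then show "norm (model_map R n x - model_map R n y) \<le> (b + 1) * norm (x - y)"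
        using b(2)[of "x - y"] norm_triangle_ineq[of "model_map R n x - model_map R n y - lin_inv (x - y)" "lin_inv (x - y)"]
        by (simp add: algebra_simps)
    qed
  qed (use b in simp)
qed

lemma holomorphic_model_map: "shear R \<Longrightarrow> holomorphic_map_on (model_map R n) U"
  unfolding model_map_def[abs_def] lin_inv_def shear_def entire_map_def
  by (intro holo_map_add holo_map_diag_map) (auto intro: holo_map_subset)

text \<open>With m = n + p these are the compositions whose limit in p is sought. Peeling off the
  outermost map lets an induction on p apply its hypothesis at \<open>Suc n\<close> and
  \<open>\<phi> n z\<close>.\<close>

primrec iter_model_map :: "(nat \<Rightarrow> complex ^ 'n \<Rightarrow> complex ^ 'n) \<Rightarrow> (nat \<Rightarrow> complex ^ 'n \<Rightarrow> complex ^ 'n) \<Rightarrow>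
    nat \<Rightarrow> nat \<Rightarrow> complex ^ 'n \<Rightarrow> complex ^ 'n" where
  "iter_model_map R k 0 n z = k n z"
| "iter_model_map R k (Suc p) n z = model_map R n (iter_model_map R k p (Suc n) (\<phi> n z))"

text \<open>The order of contact \<open>d\<close> is chosen so large that the \<open>d\<close>-th power of the contraction rate of
  \<open>\<phi>\<close> beats the expansion rate \<open>g\<close> of the shears; the iterates then shadow \<open>k\<close> and converge.\<close>

lemma intertwining_maps:
  obtains R F r where "shear R" "r > 0" "r \<le> 1"
    "\<And>n. holomorphic_map_on (F n) (ball 0 r)"
    "unif_bigo 2 (\<lambda>n z. F n z - z)" "\<And>n. F n 0 = 0"
    "\<And>n z. norm z < r \<Longrightarrow> norm (\<phi> n z) \<le> norm z"
    "\<And>n z. norm z < r \<Longrightarrow> F n z = model_map R n (F (Suc n) (\<phi> n z))"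
    "\<And>n x y. norm x < r \<Longrightarrow> norm y < r \<Longrightarrow> norm (F n x - F n y - (x - y)) \<le> norm (x - y) / 2"
proof -
  obtain q \<sigma>1 where q: "0 < q" "q < 1" "\<sigma>1 > 0" "\<And>n z. norm z < \<sigma>1 \<Longrightarrow> norm (\<phi> n z) \<le> q * norm z"
    using \<phi>_small_contraction by metis
  obtain g where g: "g > 0" "\<And>R. shear R \<Longrightarrow>
    \<exists>\<sigma>>0. \<forall>n x y. norm x < \<sigma> \<longrightarrow> norm y < \<sigma> \<longrightarrow> norm (model_map R n x - model_map R n y) \<le> g * norm (x - y)"
    by (rule model_map_small_lipschitz) (rule that)
  have "(\<lambda>d. q ^ d) \<longlonglongrightarrow> 0" using q by (intro LIMSEQ_power_zero) simp
  then have "(\<lambda>d. g * q ^ d) \<longlonglongrightarrow> g * 0" by (intro tendsto_mult_left)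
  then have "\<forall>\<^sub>F d in sequentially. g * q ^ d < 1 / 2" by (rule order_tendstoD(2)) simp
  from eventually_happens'[OF sequentially_bot eventually_conj[OF this eventually_ge_at_top[of 2]]]
  obtain d where d: "d \<ge> 2" "g * q ^ d \<le> 1 / 2" by (auto intro: less_imp_le)
  obtain R k where R: "shear R" and k: "unif_holo k" "unif_bigo 2 (\<lambda>n z. k n z - z)"
    and D: "unif_bigo d (\<lambda>n z. model_map R n (k (Suc n) (\<phi> n z)) - k n z)" using normal_form[OF d(1)] by blast
  obtain \<sigma>2 where \<sigma>2: "\<sigma>2 > 0" "\<And>n x y. norm x < \<sigma>2 \<Longrightarrow> norm y < \<sigma>2 \<Longrightarrow> norm (model_map R n x - model_map R n y) \<le> g * norm (x - y)"
    using g(2)[OF R] by blast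
  obtain C \<sigma>3 where C: "C \<ge> 0" "0 < \<sigma>3" "\<And>n z. norm z < \<sigma>3 \<Longrightarrow> norm (model_map R n (k (Suc n) (\<phi> n z)) - k n z) \<le> C * norm z ^ d"
    by (rule unif_bigoE[OF D, of 1]) auto
  obtain M \<sigma>4 where M: "0 < \<sigma>4" "\<And>n. holomorphic_map_on (k n) (ball 0 \<sigma>4)" "\<And>n z. norm z < \<sigma>4 \<Longrightarrow> norm (k n z) \<le> M"
    by (rule unif_holoE[OF k(1), of 1]) auto
  obtain M' \<sigma>6 where M': "0 < \<sigma>6" "\<And>n. holomorphic_map_on (\<phi> n) (ball 0 \<sigma>6)"
    by (rule unif_holoE[OF \<phi>_unif_holo, of 1]) auto
  have k1: "unif_bigo 1 k" using unif_bigo_add[OF unif_bigo_mono[OF k(2), of 1] unif_bigo_id] by simp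
  \<comment> \<open>Each step halves the inherited error and adds at most \<open>C\<close>, so 2C
    reproduces itself.\<close>
  define C' where "C' = 2 * C"
  have "\<sigma>2 / 2 > 0" using \<sigma>2 by simp
  from unif_bigo1_small[OF k1 this] obtain \<sigma>5 where \<sigma>5: "\<sigma>5 > 0" "\<And>n z. norm z < \<sigma>5 \<Longrightarrow> norm (k n z) < \<sigma>2 / 2"
    unfolding eventually_nhds_metric by auto
  \<comment> \<open>The last entry keeps the deviation from \<open>k\<close> at most
    \<open>\<sigma>2 / 2\<close>. With |k| < \<open>\<sigma>2 / 2\<close>, all iterates remain where
    the Lipschitz bound for the model maps holds.\<close>
  define \<rho> where "\<rho> = min (min 1 (min \<sigma>1 \<sigma>3)) (min (min \<sigma>4 \<sigma>6) (min \<sigma>5 (\<sigma>2 / (2 * (C' + 1)))))"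
  have \<rho>: "\<rho> > 0" "\<rho> \<le> 1" "\<rho> \<le> \<sigma>1" "\<rho> \<le> \<sigma>3" "\<rho> \<le> \<sigma>4" "\<rho> \<le> \<sigma>5" "\<rho> \<le> \<sigma>6" "(C' + 1) * \<rho> \<le> \<sigma>2 / 2"
  proof -
    show "\<rho> > 0" using q \<sigma>2 C M M' \<sigma>5 by (auto simp: \<rho>_def C'_def)
    have "\<rho> \<le> \<sigma>2 / (2 * (C' + 1))" by (simp add: \<rho>_def)
    moreover have "C' + 1 > 0" using C by (simp add: C'_def)
    ultimately show "(C' + 1) * \<rho> \<le> \<sigma>2 / 2" by (simp add: field_simps)
  qed (auto simp: \<rho>_def)
  have C': "C' \<ge> 0" using C by (simp add: C'_def)
  have \<phi>q: "norm (\<phi> n z) \<le> q * norm z" "norm (\<phi> n z) \<le> norm z" if "norm z < \<rho>" for n z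
  proof -
    show 1: "norm (\<phi> n z) \<le> q * norm z" using that \<rho> by (intro q) simp
    show "norm (\<phi> n z) \<le> norm z" using 1 q mult_right_mono[of q 1 "norm z"] by simp
  qed
  have pw: "C' * norm z ^ d \<le> \<sigma>2 / 2" if "norm z < \<rho>" for z :: "complex ^ 'n"
  proof -
    have "norm z ^ d \<le> norm z ^ 1" using that \<rho> d by (intro power_decreasing) auto
    then have "C' * norm z ^ d \<le> (C' + 1) * \<rho>" using that C' by (intro mult_mono) auto
    then show ?thesis using \<rho> by simp
  qed
  let ?X = "iter_model_map R k"
  have Xs: "norm (?X p n z - k n z) \<le> C' * norm z ^ d" if "norm z < \<rho>" for p n z
    using that
  proof (induction p arbitrary: n z)
    case 0
    then show ?case using C' by simp
  next
    case (Suc p)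
    let ?y = "\<phi> n z"
    have y: "norm ?y < \<rho>" using \<phi>q[OF Suc.prems, of n] Suc.prems by simp
    have IH: "norm (?X p (Suc n) ?y - k (Suc n) ?y) \<le> C' * norm ?y ^ d" by (rule Suc.IH[OF y])
    have k2: "norm (k (Suc n) ?y) < \<sigma>2 / 2" using y \<rho> by (intro \<sigma>5) simp
    have x2: "norm (?X p (Suc n) ?y) < \<sigma>2"
      using IH pw[OF y] k2 norm_triangle_ineq[of "?X p (Suc n) ?y - k (Suc n) ?y" "k (Suc n) ?y"] by simp
    have "norm (model_map R n (?X p (Suc n) ?y) - model_map R n (k (Suc n) ?y)) \<le> g * norm (?X p (Suc n) ?y - k (Suc n) ?y)"
      using x2 k2 \<sigma>2(1) by (intro \<sigma>2(2)) auto
    also have "\<dots> \<le> g * (C' * (q * norm z) ^ d)"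
      using IH g C' \<phi>q(1)[OF Suc.prems, of n] order_trans[OF IH mult_left_mono[OF power_mono]]
      by (intro mult_left_mono) auto
    also have "\<dots> = g * q ^ d * (C' * norm z ^ d)" by (simp add: power_mult_distrib)
    also have "\<dots> \<le> 1 / 2 * (C' * norm z ^ d)" using d C' by (intro mult_right_mono) auto
    finally have 1: "norm (model_map R n (?X p (Suc n) ?y) - model_map R n (k (Suc n) ?y)) \<le> C * norm z ^ d" by (simp add: C'_def)
    have 2: "norm (model_map R n (k (Suc n) ?y) - k n z) \<le> C * norm z ^ d" using Suc.prems \<rho> by (intro C) simp
    have "norm (?X (Suc p) n z - k n z) \<le> norm (model_map R n (?X p (Suc n) ?y) - model_map R n (k (Suc n) ?y)) + norm (model_map R n (k (Suc n) ?y) - k n z)"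
      using norm_triangle_ineq[of "model_map R n (?X p (Suc n) ?y) - model_map R n (k (Suc n) ?y)" "model_map R n (k (Suc n) ?y) - k n z"] by simp
    then show ?case using 1 2 by (simp add: C'_def)
  qed
  have Xb: "norm (?X p n z) < \<sigma>2" if "norm z < \<rho>" for p n z
  proof -
    have "norm (k n z) < \<sigma>2 / 2" using that \<rho> by (intro \<sigma>5) simp
    then show ?thesis
      using Xs[OF that, of p n] pw[OF that] norm_triangle_ineq[of "?X p n z - k n z" "k n z"] by simp
  qed
  have Xd: "norm (?X (Suc p) n z - ?X p n z) \<le> (1 / 2) ^ p * (C' * norm z ^ d)" if "norm z < \<rho>" for p n z
    using that
  proof (induction p arbitrary: n z)
    case 0
    then show ?case using Xs[OF 0, of 1 n] by simp
  next
    case (Suc p)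
    let ?y = "\<phi> n z"
    have y: "norm ?y < \<rho>" using \<phi>q[OF Suc.prems, of n] Suc.prems by simp
    have "norm (?X (Suc (Suc p)) n z - ?X (Suc p) n z) \<le> g * norm (?X (Suc p) (Suc n) ?y - ?X p (Suc n) ?y)"
      using \<sigma>2(2)[OF Xb[OF y, of "Suc p" "Suc n"] Xb[OF y, of p "Suc n"], of n] by simp
    also have "\<dots> \<le> g * ((1 / 2) ^ p * (C' * norm ?y ^ d))" using g by (intro mult_left_mono Suc.IH[OF y]) auto
    also have "\<dots> \<le> g * ((1 / 2) ^ p * (C' * (q * norm z) ^ d))"
      using g C' \<phi>q(1)[OF Suc.prems] by (intro mult_left_mono power_mono) auto
    also have "\<dots> = g * q ^ d * ((1 / 2) ^ p * (C' * norm z ^ d))" by (simp add: power_mult_distrib)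
    also have "\<dots> \<le> 1 / 2 * ((1 / 2) ^ p * (C' * norm z ^ d))" using d C' by (intro mult_right_mono) auto
    finally show ?case by (simp only: power_Suc mult.assoc)
  qed
  have Xh: "holomorphic_map_on (?X p n) (ball 0 \<rho>)" for p n
  proof (induction p arbitrary: n)
    case 0
    show ?case using \<rho> by (simp, intro holo_map_subset[OF M(2)]) auto
  next
    case (Suc p)
    have "holomorphic_map_on (\<lambda>z. ?X p (Suc n) (\<phi> n z)) (ball 0 \<rho>)"
    proof (rule holo_map_compose[OF _ Suc])
      show "holomorphic_map_on (\<phi> n) (ball 0 \<rho>)" using \<rho> by (intro holo_map_subset[OF M'(2)]) auto
      show "\<phi> n ` ball 0 \<rho> \<subseteq> ball 0 \<rho>" using order_le_less_trans[OF \<phi>q(2)] by (auto simp: image_subset_iff)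
    qed
    from holo_map_compose[OF this holomorphic_model_map[OF R, of n UNIV]] show ?case by simp
  qed
  \<comment> \<open>The limit is written as a telescoping series, so that the M-test gives uniform
    convergence.\<close>
  define F where "F n z = k n z + (\<Sum>i. ?X (Suc i) n z - ?X i n z)" for n z
  have ul: "uniform_limit (ball 0 \<rho>) (\<lambda>p. ?X p n) (F n) sequentially" for n
  proof -
    have "uniform_limit (ball 0 \<rho>) (\<lambda>p z. \<Sum>i<p. ?X (Suc i) n z - ?X i n z) (\<lambda>z. \<Sum>i. ?X (Suc i) n z - ?X i n z) sequentially"
    proof (rule Weierstrass_m_test)
      show "norm (?X (Suc i) n z - ?X i n z) \<le> (1 / 2) ^ i * C'" if "z \<in> ball 0 \<rho>" for i z
      proof -
        have "norm (?X (Suc i) n z - ?X i n z) \<le> (1 / 2) ^ i * (C' * norm z ^ d)" using that by (intro Xd) simp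
        also have "\<dots> \<le> (1 / 2) ^ i * (C' * 1)" using that \<rho> C' by (intro mult_left_mono) (auto simp: power_le_one)
        finally show ?thesis by simp
      qed
      show "summable (\<lambda>i. (1 / 2) ^ i * C')" by (intro summable_mult2 summable_geometric) simp
    qed
    then have "uniform_limit (ball 0 \<rho>) (\<lambda>p z. k n z + (\<Sum>i<p. ?X (Suc i) n z - ?X i n z)) (F n) sequentially"
      unfolding F_def[abs_def] by (intro uniform_limit_add uniform_limit_const)
    moreover have "k n z + (\<Sum>i<p. ?X (Suc i) n z - ?X i n z) = ?X p n z" for p z
      using sum_lessThan_telescope[of "\<lambda>i. ?X i n z" p] by (simp del: iter_model_map.simps(2))
    ultimately show ?thesis by (simp only:)
  qed
  have Fh: "holomorphic_map_on (F n) (ball 0 \<rho>)" for n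
    by (rule holo_map_uniform_limit[OF Xh open_ball ul])
  have tend: "(\<lambda>p. ?X p n z) \<longlonglongrightarrow> F n z" if "norm z < \<rho>" for n z
    using tendsto_uniform_limitI[OF ul] that by simp
  have Fk: "norm (F n z - k n z) \<le> C' * norm z ^ d" if "norm z < \<rho>" for n z
  proof (rule tendsto_upperbound)
    show "(\<lambda>p. norm (?X p n z - k n z)) \<longlonglongrightarrow> norm (F n z - k n z)" by (intro tendsto_intros tend that)
  qed (use Xs[OF that] in auto)
  have Feq: "F n z = model_map R n (F (Suc n) (\<phi> n z))" if z: "norm z < \<rho>" for n z
  proof (rule LIMSEQ_unique)
    show "(\<lambda>p. ?X (Suc p) n z) \<longlonglongrightarrow> F n z" by (rule LIMSEQ_Suc[OF tend[OF z]])
    have "isCont (model_map R n) (F (Suc n) (\<phi> n z))"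
      using holo_map_continuous[OF holomorphic_model_map[OF R, of n UNIV]]
      by (simp add: continuous_on_eq_continuous_at)
    moreover have "norm (\<phi> n z) < \<rho>" using \<phi>q(2)[OF z, of n] z by simp
    ultimately show "(\<lambda>p. ?X (Suc p) n z) \<longlonglongrightarrow> model_map R n (F (Suc n) (\<phi> n z))"
      using isCont_tendsto_compose[OF _ tend] by simp
  qed
  have FO: "unif_bigo 2 (\<lambda>n z. F n z - z)"
  proof -
    have "unif_bigo d (\<lambda>n z. F n z - k n z)" by (rule unif_bigoI[OF \<rho>(1) Fk])
    from unif_bigo_add[OF unif_bigo_mono[OF this d(1)] k(2)] show ?thesis by simp
  qed
  have F0: "cderiv (F n) 0 = (\<lambda>z. z)" "F n 0 = 0" for n
    using unif_bigo2_cderiv[OF bounded_linear_ident FO] by auto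
  have FH: "unif_holo F"
  proof (rule unif_holoI[OF \<rho>(1) Fh])
    show "norm (F n z) \<le> M + C'" if "norm z < \<rho>" for n z
    proof -
      have "norm z ^ d \<le> 1" using that \<rho> by (simp add: power_le_one)
      then have "C' * norm z ^ d \<le> C' * 1" using C' by (rule mult_left_mono)
      moreover have "norm (k n z) \<le> M" using that \<rho> by (intro M) simp
      ultimately show ?thesis using Fk[OF that, of n] norm_triangle_ineq[of "F n z - k n z" "k n z"] by simp
    qed
  qed
  obtain K \<tau> where K: "K \<ge> 0" "\<tau> > 0"
    "\<And>n x y s. norm x \<le> s \<Longrightarrow> norm y \<le> s \<Longrightarrow> s < \<tau> \<Longrightarrow>
       norm (F n x - F n y - cderiv (F n) 0 (x - y)) \<le> K * s * norm (x - y)"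
    using unif_holo_remainder[OF FH] by metis
  \<comment> \<open>On this ball the factor \<open>K * s\<close> of the Taylor remainder is at most
    1/2.\<close>
  define r where "r = min \<rho> (min \<tau> (1 / (2 * (K + 1))))"
  have r: "r > 0" "r \<le> \<rho>" "r \<le> \<tau>" "r \<le> 1 / (2 * (K + 1))" using \<rho> K by (auto simp: r_def)
  show ?thesis
  proof (rule that[OF R, of r F])
    show "r > 0" "r \<le> 1" using r \<rho> by auto
    show "holomorphic_map_on (F n) (ball 0 r)" for n using r by (intro holo_map_subset[OF Fh]) auto
    show "norm (\<phi> n z) \<le> norm z" if "norm z < r" for n z using that r by (intro \<phi>q(2)) simp
    show "F n z = model_map R n (F (Suc n) (\<phi> n z))" if "norm z < r" for n z using that r by (intro Feq) simp
    show "norm (F n x - F n y - (x - y)) \<le> norm (x - y) / 2" if xy: "norm x < r" "norm y < r" for n x y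
    proof -
      define s where "s = max (norm x) (norm y)"
      have s: "s < r" using xy by (simp add: s_def)
      have s0: "0 \<le> s" using order_trans[OF norm_ge_zero, of x s] by (simp add: s_def)
      have "s \<le> 1 / (2 * (K + 1))" using s r by simp
      then have "2 * (K + 1) * s \<le> 1" using K by (simp add: field_simps)
      then have Ks: "K * s \<le> 1 / 2" using s0 by (simp add: algebra_simps)
      have "norm (F n x - F n y - (x - y)) \<le> K * s * norm (x - y)"
        using K(3)[of x s y n] s r F0 by (simp add: s_def)
      also have "\<dots> \<le> 1 / 2 * norm (x - y)" using Ks by (intro mult_right_mono) auto
      finally show ?thesis by simp
    qed
  qed (rule FO F0)+
qed

end

section \<open>Inverses of the model maps\<close>

text \<open>Once the perturbations are below (e/2)(1 - q), the level e/2 is fixed by the majorizing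
  recursion, and the excess over it decays like q^k.\<close>

lemma perturbed_contraction_tendsto_0:
  fixes u \<epsilon> :: "nat \<Rightarrow> real"
  assumes u: "\<And>n. 0 \<le> u n" "\<And>n. u (Suc n) \<le> q * u n + \<epsilon> n" and q: "0 \<le> q" "q < 1"
    and \<epsilon>: "\<epsilon> \<longlonglongrightarrow> 0"
  shows "u \<longlonglongrightarrow> 0"
proof (rule LIMSEQ_I)
  fix e :: real assume e: "e > 0"
  have "\<forall>\<^sub>F n in sequentially. \<epsilon> n < e / 2 * (1 - q)"
    using e q by (intro order_tendstoD(2)[OF \<epsilon>]) simp
  then obtain N where N: "\<And>n. n \<ge> N \<Longrightarrow> \<epsilon> n < e / 2 * (1 - q)" unfolding eventually_sequentially by blast
  have le: "u (N + k) \<le> e / 2 + q ^ k * u N" for k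
  proof (induction k)
    case 0
    then show ?case using e by simp
  next
    case (Suc k)
    have "u (N + Suc k) \<le> q * u (N + k) + e / 2 * (1 - q)" using u(2)[of "N + k"] N[of "N + k"] by simp
    also have "\<dots> \<le> q * (e / 2 + q ^ k * u N) + e / 2 * (1 - q)" using Suc q by (intro add_right_mono mult_left_mono)
    also have "\<dots> = e / 2 + q ^ Suc k * u N" by (simp add: field_simps)
    finally show ?case .
  qed
  have "(\<lambda>k. q ^ k) \<longlonglongrightarrow> 0" using q by (intro LIMSEQ_power_zero) simp
  then have "(\<lambda>k. q ^ k * u N) \<longlonglongrightarrow> 0" by (rule tendsto_mult_left_zero)
  then have "\<forall>\<^sub>F k in sequentially. q ^ k * u N < e / 2" using e by (intro order_tendstoD(2)) auto
  then obtain K where K: "\<And>k. k \<ge> K \<Longrightarrow> q ^ k * u N < e / 2" unfolding eventually_sequentially by blast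
  show "\<exists>no. \<forall>n\<ge>no. norm (u n - 0) < e"
  proof (intro exI[of _ "N + K"] allI impI)
    fix n assume "n \<ge> N + K"
    then obtain k where "n = N + k" "k \<ge> K" by (metis add.assoc le_Suc_ex le_add1)
    then show "norm (u n - 0) < e" using le[of k] K[of k] u(1)[of n] by simp
  qed
qed

context contracting_sequence
begin

definition slower :: "'n \<Rightarrow> 'n set" where
  "slower l = {j. norm (a j) > norm (a l)}"

text \<open>Moduli strictly increase along the relation, so the number of slower coordinates is a
  terminating measure. Coordinates of equal modulus are treated at the same level.\<close>

lemma slower_induct:
  assumes "\<And>l. (\<And>j. norm (a j) > norm (a l) \<Longrightarrow> P j) \<Longrightarrow> P l"
  shows "P l"
proof (induction "card (slower l)" arbitrary: l rule: less_induct)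
  case less
  show ?case
  proof (rule assms)
    fix j assume j: "norm (a j) > norm (a l)"
    then have "slower j \<subset> slower l" by (auto simp: slower_def)
    then have "card (slower j) < card (slower l)" by (intro psubset_card_mono) auto
    then show "P j" by (rule less)
  qed
qed

lemma shear_cong:
  "shear R \<Longrightarrow> (\<And>j. norm (a j) > norm (a l) \<Longrightarrow> z $ j = z' $ j) \<Longrightarrow> R n z $ l = R n z' $ l"
  unfolding shear_def by blast

text \<open>In this fixed-point form, component \<open>l\<close> of the right-hand side involves
  only slower coordinates of \<open>w\<close> when \<open>R\<close> is a shear. Uniqueness, the
  inverse and the decay of backward orbits all start from it.\<close>

lemma model_map_eq_iff: "model_map R n w = z \<longleftrightarrow> w = lin (z - R n w)"
proof
  assume "model_map R n w = z"
  then have "lin_inv w = z - R n w" by (simp add: model_map_def algebra_simps)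
  then have "lin (lin_inv w) = lin (z - R n w)" by (rule arg_cong)
  then show "w = lin (z - R n w)" by simp
next
  assume "w = lin (z - R n w)"
  then have "lin_inv w = lin_inv (lin (z - R n w))" by (rule arg_cong)
  then have "lin_inv w = z - R n w" by (simp only: lin_lin_inv)
  then show "model_map R n w = z" by (simp add: model_map_def)
qed

lemma model_map_inj:
  assumes R: "shear R" and eq: "model_map R n w = model_map R n w'"
  shows "w = w'"
proof -
  have "w $ l = w' $ l" for l
  proof (induction l rule: slower_induct)
    case (1 l)
    have "w = lin (model_map R n w - R n w)" "w' = lin (model_map R n w - R n w')" using model_map_eq_iff eq by metis+
    moreover have "R n w $ l = R n w' $ l" by (rule shear_cong[OF R 1])
    ultimately show ?case unfolding lin_def by (metis diag_map_nth vector_minus_component)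
  qed
  then show ?thesis by (simp add: vec_eq_iff)
qed

text \<open>The fixed-point iteration for the inverse of a shear stabilises after finitely many steps,
  one coordinate level at a time, so the inverse is entire.\<close>

lemma model_map_inverse:
  assumes R: "shear R"
  obtains T where "entire_map T" "\<And>z. model_map R n (T z) = z" "\<And>z. T (model_map R n z) = z"
proof -
  define J where "J = rec_nat (\<lambda>z. 0) (\<lambda>p f z. lin (z - R n (f z)))"
  have J: "J 0 z = 0" "J (Suc p) z = lin (z - R n (J p z))" for p z by (simp_all add: J_def)
  have stab: "J (Suc p) z $ l = J p z $ l" if "p > card (slower l)" for p z l
    using that
  proof (induction l arbitrary: p rule: slower_induct)
    case (1 l)
    then obtain p' where p: "p = Suc p'" by (cases p) auto
    have "R n (J (Suc p') z) $ l = R n (J p' z) $ l"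
    proof (rule shear_cong[OF R])
      fix j assume j: "norm (a j) > norm (a l)"
      then have "slower j \<subset> slower l" by (auto simp: slower_def)
      then have "card (slower j) < card (slower l)" by (intro psubset_card_mono) auto
      then show "J (Suc p') z $ j = J p' z $ j" using 1 j p by simp
    qed
    then show ?case unfolding p J(2)[of "Suc p'"] J(2)[of p'] by (simp add: lin_def)
  qed
  \<comment> \<open>One more than the number of coordinates exceeds every level, so at this stage
    all components have stabilised simultaneously.\<close>
  define P where "P = Suc (card (UNIV :: 'n set))"
  have fx: "J (Suc P) z = J P z" for z
  proof -
    have "card (slower l) < P" for l
      using card_mono[of UNIV "slower l"] by (simp add: P_def)
    then show ?thesis using stab by (simp add: vec_eq_iff)
  qed
  have Jh: "holomorphic_map_on (J p) UNIV" for p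
  proof (induction p)
    case 0
    have "J 0 = (\<lambda>z. 0)" by (simp add: J(1) fun_eq_iff)
    then show ?case by simp
  next
    case (Suc p)
    have Rn: "holomorphic_map_on (R n) UNIV" using R by (simp add: shear_def entire_map_def)
    have "holomorphic_map_on (\<lambda>z. lin (z - R n (J p z))) UNIV"
      unfolding lin_def
      by (rule holo_map_compose[OF holo_map_diff[OF holo_map_id
            holo_map_compose[OF Suc Rn]] holo_map_diag_map]) auto
    moreover have "J (Suc p) = (\<lambda>z. lin (z - R n (J p z)))" by (simp add: J(2) fun_eq_iff)
    ultimately show ?case by simp
  qed
  have S: "model_map R n (J P z) = z" for z unfolding model_map_eq_iff using fx[of z] J(2) by metis
  show ?thesis
  proof (rule that[of "J P"])
    show "entire_map (J P)" unfolding entire_map_def by (rule Jh)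
    show "J P (model_map R n z) = z" for z by (rule model_map_inj[OF R, of n]) (rule S)
  qed (rule S)
qed

text \<open>Level by level: once the slower coordinates tend to 0, the next one satisfies a linear
  contraction with factor |a l| and a perturbation tending to 0.\<close>

lemma model_map_backward_orbit_tendsto_0:
  assumes R: "shear R" and x: "\<And>n. model_map R n (x (Suc n)) = x n"
  shows "x \<longlonglongrightarrow> 0"
proof (rule vec_tendstoI)
  fix l
  have R2: "unif_bigo 2 R" using R by (simp add: shear_def)
  show "(\<lambda>n. x n $ l) \<longlonglongrightarrow> 0 $ l"
  proof (induction l rule: slower_induct)
    case (1 l)
    \<comment> \<open>Cutting off the other coordinates leaves component \<open>l\<close> of the
      shear unchanged, and \<open>y\<close> tends to 0 before anything is known about the rest of
      \<open>x\<close>, so the quadratic bound applies. The index \<open>Suc n\<close> is where the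
      fixed-point equation evaluates the shear.\<close>
    define y where "y n = (\<chi> j. if norm (a j) > norm (a l) then x (Suc n) $ j else 0)" for n
    have y0: "y \<longlonglongrightarrow> 0"
    proof (rule vec_tendstoI)
      fix j
      show "(\<lambda>n. y n $ j) \<longlonglongrightarrow> 0 $ j"
        using LIMSEQ_Suc[OF 1, of j] by (cases "norm (a j) > norm (a l)") (simp_all add: y_def)
    qed
    obtain C \<sigma> where C: "C \<ge> 0" "0 < \<sigma>" "\<And>n z. norm z < \<sigma> \<Longrightarrow> norm (R n z) \<le> C * norm z ^ 2"
      by (rule unif_bigoE[OF R2, of 1]) auto
    have "(\<lambda>n. C * norm (y n) ^ 2) \<longlonglongrightarrow> C * norm (0 :: complex ^ 'n) ^ 2" by (intro tendsto_intros y0)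
    then have lim: "(\<lambda>n. C * norm (y n) ^ 2) \<longlonglongrightarrow> 0" by simp
    have "\<forall>\<^sub>F n in sequentially. norm (y n) < \<sigma>"
      using order_tendstoD(2)[OF tendsto_norm[OF y0], of \<sigma>] C by simp
    then have "\<forall>\<^sub>F n in sequentially. norm (R n (y n)) \<le> C * norm (y n) ^ 2"
      by eventually_elim (rule C)
    then have Ry: "(\<lambda>n. R n (y n)) \<longlonglongrightarrow> 0" by (rule Lim_null_comparison[OF _ lim])
    have \<epsilon>: "(\<lambda>n. norm (R n (y n) $ l)) \<longlonglongrightarrow> 0"
      using tendsto_norm[OF tendsto_vec_nth[OF Ry, of l]] by simp
    have "(\<lambda>n. norm (x n $ l)) \<longlonglongrightarrow> 0"
    proof (rule perturbed_contraction_tendsto_0[OF _ _ _ _ \<epsilon>])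
      show "norm (x (Suc n) $ l) \<le> norm (a l) * norm (x n $ l) + norm (R n (y n) $ l)" for n
      proof -
        have "x (Suc n) = lin (x n - R n (x (Suc n)))" using x[of n] model_map_eq_iff by blast
        then have "x (Suc n) $ l = a l * (x n $ l - R n (x (Suc n)) $ l)"
          unfolding lin_def by (metis diag_map_nth vector_minus_component)
        also have "R n (x (Suc n)) $ l = R n (y n) $ l" by (rule shear_cong[OF R]) (simp add: y_def)
        finally have "norm (x (Suc n) $ l) \<le> norm (a l * x n $ l) + norm (a l * R n (y n) $ l)"
          by (simp add: right_diff_distrib norm_triangle_ineq4)
        moreover have "norm (a l) * norm (R n (y n) $ l) \<le> 1 * norm (R n (y n) $ l)"
          using a(2)[of l] by (intro mult_right_mono) auto
        ultimately show ?thesis by (simp add: norm_mult)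
      qed
    qed (use a(2) in auto)
    then show ?case by (simp add: tendsto_norm_zero_iff)
  qed
qed

end

section \<open>Dilation evolution families\<close>

lemma linear_expansionD:
  assumes "linear_expansion F M"
  shows "F 0 = 0" "(F has_derivative (\<lambda>v. M *v v)) (at 0)" "cderiv F 0 = (\<lambda>v. M *v v)"
proof -
  obtain c where "c > 0" "\<forall>\<^sub>F z in nhds 0. norm (norm (F z - M *v z)) \<le> c * norm ((norm z)\<^sup>2)"
    using landau_o.bigE[OF assms[unfolded linear_expansion_def]] by blast
  then obtain \<sigma> where \<sigma>: "\<sigma> > 0" "\<And>z. norm z < \<sigma> \<Longrightarrow> norm (F z - M *v z) \<le> c * (norm z)\<^sup>2"
    unfolding eventually_nhds_metric by auto
  have L: "bounded_linear ((*v) M)" by (rule matrix_vector_mul_bounded_linear)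
  show "F 0 = 0" "(F has_derivative (\<lambda>v. M *v v)) (at 0)"
    using has_derivative_of_quadratic[OF L \<sigma>(1), of F c] \<sigma>(2) by auto
  then show "cderiv F 0 = (\<lambda>v. M *v v)" by (intro cderiv_eq)
qed

text \<open>The map is viewed as a constant sequence, so that the index-uniform Taylor bound
  supplies the quadratic error.\<close>

lemma linear_expansionI:
  assumes F: "holomorphic_map_on F (ball 0 r)" "r > 0" and F0: "F 0 = 0"
    and D: "(F has_derivative (\<lambda>v. M *v v)) (at 0)"
  shows "linear_expansion F M"
proof -
  have "continuous_on (cball 0 (r / 2)) F"
    using F by (intro holo_map_continuous holo_map_subset[OF F(1)]) auto
  then have "compact (F ` cball 0 (r / 2))" by (intro compact_continuous_image) auto
  then obtain B where B: "\<And>z. z \<in> cball 0 (r / 2) \<Longrightarrow> norm (F z) \<le> B"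
    using compact_imp_bounded[of "F ` cball 0 (r / 2)"] unfolding bounded_iff by blast
  have "unif_holo (\<lambda>n::nat. F)"
  proof (rule unif_holoI[of "r / 2" _ B])
    show "holomorphic_map_on F (ball 0 (r / 2))" using F by (intro holo_map_subset[OF F(1)]) auto
  qed (use B F in auto)
  then have "unif_bigo 2 (\<lambda>n::nat. \<lambda>z. F z - cderiv F 0 z)" by (rule unif_holo_imp_unif_bigo2) (rule F0)
  then obtain C \<sigma> where C: "\<sigma> > 0" "\<And>n::nat. \<And>z. norm z < \<sigma> \<Longrightarrow> norm (F z - cderiv F 0 z) \<le> C * norm z ^ 2"
    by (rule unif_bigoE[of _ _ 1]) auto
  show ?thesis unfolding linear_expansion_def
  proof (rule bigoI[of _ C])
    show "\<forall>\<^sub>F z in nhds 0. norm (norm (F z - M *v z)) \<le> C * norm ((norm z)\<^sup>2)"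
      unfolding eventually_nhds_metric cderiv_eq[OF D, symmetric]
      using C by (intro exI[of _ \<sigma>]) auto
  qed
qed

locale dilation_family =
  fixes \<alpha> :: "'n::finite \<Rightarrow> complex" and \<phi> :: "real \<Rightarrow> real \<Rightarrow> complex ^ 'n \<Rightarrow> complex ^ 'n"
  assumes Re_neg: "\<And>i. Re (\<alpha> i) < 0" and evolution: "dilation_evolution_family (Diag \<alpha>) \<phi>"
begin

definition dil :: "real \<Rightarrow> complex ^ 'n \<Rightarrow> complex ^ 'n" where
  "dil t = diag_map (\<lambda>i. exp (of_real t * \<alpha> i))"

lemma mat_exp_eq_dil: "mat_exp (t *\<^sub>R Diag \<alpha>) *v z = dil t z"
  by (simp add: mat_exp_scaleR_Diag_mult_vec dil_def diag_map_def)

lemma dil_add: "dil s (dil t z) = dil (s + t) z"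
  by (simp add: dil_def diag_map_diag_map exp_add ring_distribs)

lemma dil_0 [simp]: "dil 0 z = z"
  by (simp add: dil_def vec_eq_iff)

lemma self_map: "0 \<le> s \<Longrightarrow> s \<le> t \<Longrightarrow> holomorphic_self_map (\<phi> s t)"
  and phi_same: "0 \<le> s \<Longrightarrow> norm z < 1 \<Longrightarrow> \<phi> s s z = z"
  and phi_trans: "0 \<le> s \<Longrightarrow> s \<le> u \<Longrightarrow> u \<le> t \<Longrightarrow> norm z < 1 \<Longrightarrow> \<phi> s t z = \<phi> u t (\<phi> s u z)"
  and expansion: "0 \<le> s \<Longrightarrow> s \<le> t \<Longrightarrow> linear_expansion (\<phi> s t) (mat_exp ((t - s) *\<^sub>R Diag \<alpha>))"
  using evolution unfolding dilation_evolution_family_def by auto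

lemma phi_holomorphic: "0 \<le> s \<Longrightarrow> s \<le> t \<Longrightarrow> holomorphic_map_on (\<phi> s t) (ball 0 1)"
  and phi_in_ball: "0 \<le> s \<Longrightarrow> s \<le> t \<Longrightarrow> norm z < 1 \<Longrightarrow> norm (\<phi> s t z) < 1"
  using self_map[of s t] unfolding holomorphic_self_map_def by (auto simp: image_subset_iff)

lemma phi_0: "0 \<le> s \<Longrightarrow> s \<le> t \<Longrightarrow> \<phi> s t 0 = 0"
  and phi_derivative: "0 \<le> s \<Longrightarrow> s \<le> t \<Longrightarrow> (\<phi> s t has_derivative dil (t - s)) (at 0)"
  and phi_cderiv: "0 \<le> s \<Longrightarrow> s \<le> t \<Longrightarrow> cderiv (\<phi> s t) 0 = dil (t - s)"
  using linear_expansionD[OF expansion[of s t]] by (simp_all add: mat_exp_eq_dil)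

lemma max_Re:
  obtains m where "m < 0" "\<And>i. Re (\<alpha> i) \<le> m"
proof
  show le: "Re (\<alpha> i) \<le> Max (range (\<lambda>i. Re (\<alpha> i)))" for i by (intro Max_ge) auto
  have "Max (range (\<lambda>i. Re (\<alpha> i))) \<in> range (\<lambda>i. Re (\<alpha> i))" by (intro Max_in) auto
  then show "Max (range (\<lambda>i. Re (\<alpha> i))) < 0" using Re_neg by auto
qed

lemma norm_dil_le:
  assumes "0 \<le> h" "\<And>i. Re (\<alpha> i) \<le> m"
  shows "norm (dil h x) \<le> exp (h * m) * norm x"
  unfolding dil_def using assms by (intro norm_diag_map_le) (simp add: mult_left_mono)

lemma phi_norm_le:
  assumes "0 \<le> s" "s \<le> t" "norm z < 1"
  shows "norm (\<phi> s t z) \<le> norm z"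
\<comment> \<open>For s = t the linear part is the identity and leaves no factor below 1 for the
  Schwarz-Pick estimate.\<close>
proof (cases "s = t")
  case True
  then show ?thesis using assms by (simp add: phi_same)
next
  case False
  obtain m where m: "m < 0" "\<And>i. Re (\<alpha> i) \<le> m" by (rule max_Re) (rule that)
  show ?thesis
  proof (rule self_map_norm_le[OF self_map[OF assms(1,2)] phi_0[OF assms(1,2)]])
    show "norm (cderiv (\<phi> s t) 0 x) \<le> exp ((t - s) * m) * norm x" for x
      unfolding phi_cderiv[OF assms(1,2)] using assms m by (intro norm_dil_le) auto
    show "exp ((t - s) * m) < 1" using assms False m by (simp add: mult_pos_neg)
  qed (rule assms(3))
qed

text \<open>Over unit time the linear part always has norm at most exp m < 1, which gives a
  contraction factor common to all starting times.\<close>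

lemma phi_unit_contraction:
  assumes "\<rho> < 1"
  obtains q where "0 \<le> q" "q < 1" "\<And>s z. 0 \<le> s \<Longrightarrow> norm z \<le> \<rho> \<Longrightarrow> norm (\<phi> s (s + 1) z) \<le> q * norm z"
proof (cases "\<rho> < 0")
  case True
  have "\<not> norm z \<le> \<rho>" for z :: "complex ^ 'n" using True norm_ge_zero[of z] by linarith
  then show ?thesis using that[of 0] by auto
next
  case False
  obtain m where m: "m < 0" "\<And>i. Re (\<alpha> i) \<le> m" by (rule max_Re) (rule that)
  have e: "0 < exp m" "exp m < 1" using m by auto
  define q where "q = sqrt (1 - (1 - \<rho>\<^sup>2) * (1 - exp m) / 2)"
  have r2: "0 \<le> 1 - \<rho>\<^sup>2" "1 - \<rho>\<^sup>2 \<le> 1" "0 < 1 - \<rho>\<^sup>2"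
    using assms False by (auto simp: power_le_one abs_square_less_1)
  have "(1 - \<rho>\<^sup>2) * (1 - exp m) \<le> 1 * 1" using r2 e by (intro mult_mono) auto
  moreover have "0 < (1 - \<rho>\<^sup>2) * (1 - exp m)" using r2 e by simp
  ultimately have q: "0 \<le> q" "q < 1" by (auto simp: q_def)
  show ?thesis
  proof (rule that[OF q])
    fix s z assume s: "0 \<le> (s::real)" and z: "norm (z :: complex ^ 'n) \<le> \<rho>"
    have s1: "s \<le> s + 1" by simp
    show "norm (\<phi> s (s + 1) z) \<le> q * norm z"
      unfolding q_def
    proof (rule self_map_contraction[OF self_map[OF s s1] phi_0[OF s s1] _ e(2) z assms])
      show "norm (cderiv (\<phi> s (s + 1)) 0 x) \<le> exp m * norm x" for x
        unfolding phi_cderiv[OF s s1] using norm_dil_le[of 1 m x] m by simp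
    qed
  qed
qed

text \<open>The unit-time contraction can be iterated since norms never grow, so orbits stay in the
  ball of radius \<rho>. The remaining, possibly fractional, time does no harm for the same
  reason.\<close>

lemma phi_tends_to_0_uniformly:
  assumes "\<rho> < 1" "\<epsilon> > 0"
  obtains p :: nat where "\<And>s t z. 0 \<le> s \<Longrightarrow> s + real p \<le> t \<Longrightarrow> norm z \<le> \<rho> \<Longrightarrow> norm (\<phi> s t z) < \<epsilon>"
proof -
  obtain q where q: "0 \<le> q" "q < 1" "\<And>s z. 0 \<le> s \<Longrightarrow> norm z \<le> \<rho> \<Longrightarrow> norm (\<phi> s (s + 1) z) \<le> q * norm z"
    by (rule phi_unit_contraction[OF assms(1)]) (rule that)
  have it: "norm (\<phi> s (s + real p) z) \<le> q ^ p * norm z" if "0 \<le> s" "norm z \<le> \<rho>" for p s z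
  proof (induction p)
    case 0
    then show ?case using that assms by (simp add: phi_same)
  next
    case (Suc p)
    have z1: "norm z < 1" using that assms by simp
    have eq: "\<phi> s (s + real (Suc p)) z = \<phi> (s + real p) ((s + real p) + 1) (\<phi> s (s + real p) z)"
      using that z1 phi_trans[of s "s + real p" "s + real (Suc p)" z] by (simp add: add_ac)
    have "norm (\<phi> s (s + real p) z) \<le> \<rho>"
      using phi_norm_le[of s "s + real p" z] that z1 by simp
    then have "norm (\<phi> s (s + real (Suc p)) z) \<le> q * norm (\<phi> s (s + real p) z)"
      unfolding eq using that by (intro q) auto
    also have "\<dots> \<le> q * (q ^ p * norm z)" using Suc q by (intro mult_left_mono) auto
    finally show ?case by simp
  qed
  have "(\<lambda>p. q ^ p) \<longlonglongrightarrow> 0" using q by (intro LIMSEQ_power_zero) simp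
  then have "\<forall>\<^sub>F p in sequentially. q ^ p < \<epsilon>" using assms by (intro order_tendstoD(2)) auto
  then obtain p where p: "q ^ p < \<epsilon>" by (auto simp: eventually_sequentially)
  show ?thesis
  proof (rule that[of p])
    fix s t z assume *: "0 \<le> s" "s + real p \<le> t" "norm (z :: complex ^ 'n) \<le> \<rho>"
    have z1: "norm z < 1" using * assms by simp
    have y: "norm (\<phi> s (s + real p) z) < 1" using * z1 by (intro phi_in_ball) auto
    have "norm (\<phi> s t z) = norm (\<phi> (s + real p) t (\<phi> s (s + real p) z))"
      using * z1 by (subst phi_trans[of s "s + real p" t]) auto
    also have "\<dots> \<le> norm (\<phi> s (s + real p) z)" using * y by (intro phi_norm_le) auto
    also have "\<dots> \<le> q ^ p * norm z" using * by (intro it)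
    also have "\<dots> \<le> q ^ p * 1" using z1 q by (intro mult_left_mono) auto
    finally show "norm (\<phi> s t z) < \<epsilon>" using p by simp
  qed
qed

section \<open>Univalence of the evolution family\<close>

lemma dil_near_identity:
  assumes "\<epsilon> > 0"
  obtains \<delta> where "\<delta> > 0" "\<And>h x. 0 \<le> h \<Longrightarrow> h \<le> \<delta> \<Longrightarrow> norm (dil h x - x) \<le> \<epsilon> * norm x"
proof -
  have "\<forall>\<^sub>F h in at_right 0. \<forall>i\<in>UNIV. norm (exp (of_real h * \<alpha> i) - 1) < \<epsilon>"
  proof (rule eventually_ball_finite)
    show "\<forall>i\<in>UNIV. \<forall>\<^sub>F h in at_right 0. norm (exp (of_real h * \<alpha> i) - 1) < \<epsilon>"
    proof
      fix i
      have "((\<lambda>h::real. norm (exp (of_real h * \<alpha> i) - 1)) \<longlongrightarrow> norm (exp (of_real 0 * \<alpha> i) - 1)) (at_right 0)"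
        by (intro tendsto_intros)
      then show "\<forall>\<^sub>F h in at_right 0. norm (exp (of_real h * \<alpha> i) - 1) < \<epsilon>"
        using assms by (intro order_tendstoD(2)) auto
    qed
  qed simp
  then obtain b where b: "b > 0" "\<And>h i. 0 < h \<Longrightarrow> h < b \<Longrightarrow> norm (exp (complex_of_real h * \<alpha> i) - 1) < \<epsilon>"
    unfolding eventually_at_right_field by auto
  show ?thesis
  proof (rule that[of "b / 2"])
    fix h :: real and x :: "complex ^ 'n" assume h: "0 \<le> h" "h \<le> b / 2"
    have "norm (exp (complex_of_real h * \<alpha> i) - 1) \<le> \<epsilon>" for i
      using b h assms by (cases "h = 0") (auto intro: less_imp_le)
    then have "norm (diag_map (\<lambda>i. exp (of_real h * \<alpha> i) - 1) x) \<le> \<epsilon> * norm x" by (rule norm_diag_map_le)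
    moreover have "diag_map (\<lambda>i. exp (of_real h * \<alpha> i) - 1) x = dil h x - x"
      by (simp add: dil_def vec_eq_iff algebra_simps)
    ultimately show "norm (dil h x - x) \<le> \<epsilon> * norm x" by simp
  qed (use b in simp)
qed

text \<open>For short times the linear part is close to the identity, hence by
  \<open>self_map_near_identity\<close> so is the map on a larger ball. Cauchy's estimate then makes
  the map minus the identity a 1/2-contraction on the \<rho>-ball. The admissible time does not
  depend on s.\<close>

lemma phi_locally_injective:
  assumes \<rho>: "0 < \<rho>" "\<rho> < 1"
  obtains \<delta> where "\<delta> > 0" "\<And>s t. 0 \<le> s \<Longrightarrow> s \<le> t \<Longrightarrow> t \<le> s + \<delta> \<Longrightarrow> inj_on (\<phi> s t) (ball 0 \<rho>)"
proof -
  define \<rho>' where "\<rho>' = (1 + \<rho>) / 2"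
  define c where "c = 2 * real CARD('n) / (\<rho>' - \<rho>)"
  have \<rho>': "\<rho> < \<rho>'" "\<rho>' < 1" "0 < \<rho>'" using \<rho> by (auto simp: \<rho>'_def)
  have c: "c > 0" using \<rho>' by (simp add: c_def)
  \<comment> \<open>A bound \<eta> on \<open>G\<close> in the larger ball becomes 1/2 for its
    derivative, \<open>c\<close> being the constant of the Cauchy estimate.\<close>
  define \<eta> where "\<eta> = 1 / (2 * c)"
  have \<eta>: "\<eta> > 0" using c by (simp add: \<eta>_def)
  \<comment> \<open>The coefficient of \<epsilon> in \<open>self_map_near_identity\<close> at radius
    \<rho>'; with \<epsilon> = \<eta>^2 / \<kappa> that bound becomes \<eta>^2 |z|^2.\<close>
  define \<kappa> where "\<kappa> = 2 * (2 / (1 - \<rho>') + 1)"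
  have \<kappa>: "\<kappa> > 0" using \<rho>' by (simp add: \<kappa>_def add_pos_pos)
  have "\<eta>\<^sup>2 / \<kappa> > 0" using \<eta> \<kappa> by simp
  then obtain \<delta> where \<delta>: "\<delta> > 0" "\<And>h x. 0 \<le> h \<Longrightarrow> h \<le> \<delta> \<Longrightarrow> norm (dil h x - x) \<le> \<eta>\<^sup>2 / \<kappa> * norm x"
    by (rule dil_near_identity) (rule that)
  show ?thesis
  proof (rule that[OF \<delta>(1)])
    fix s t assume st: "0 \<le> s" "s \<le> t" "t \<le> s + \<delta>"
    show "inj_on (\<phi> s t) (ball 0 \<rho>)"
    proof (cases "s = t")
      case True
      then show ?thesis using st \<rho> by (auto simp: inj_on_def phi_same)
    next
      case False
      obtain m where m: "m < 0" "\<And>i. Re (\<alpha> i) \<le> m" by (rule max_Re) (rule that)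
      define G where "G z = \<phi> s t z - z" for z
      have Gh: "holomorphic_map_on G (ball 0 1)" unfolding G_def
        by (intro holo_map_diff phi_holomorphic st holo_map_id)
      have Gb: "norm (G z) \<le> \<eta>" if z: "norm z \<le> \<rho>'" for z
      proof -
        have "norm (\<phi> s t z - z) ^ 2 \<le> 2 * (2 * (\<eta>\<^sup>2 / \<kappa>) / (1 - \<rho>') + \<eta>\<^sup>2 / \<kappa>) * norm z ^ 2"
        proof (rule self_map_near_identity[OF self_map[OF st(1,2)] phi_0[OF st(1,2)] _ _ _ z \<rho>'(2)])
          show "norm (cderiv (\<phi> s t) 0 x) \<le> exp ((t - s) * m) * norm x" for x
            unfolding phi_cderiv[OF st(1,2)] using st m by (intro norm_dil_le) auto
          show "exp ((t - s) * m) < 1" using st False m by (simp add: mult_pos_neg)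
          show "norm (cderiv (\<phi> s t) 0 x - x) \<le> \<eta>\<^sup>2 / \<kappa> * norm x" for x
            unfolding phi_cderiv[OF st(1,2)] using st by (intro \<delta>) auto
        qed
        also have "2 * (2 * X / (1 - \<rho>') + X) = X * \<kappa>" for X :: real
          by (simp add: \<kappa>_def algebra_simps)
        also have "\<eta>\<^sup>2 / \<kappa> * \<kappa> = \<eta>\<^sup>2" using \<kappa> by simp
        also have "\<eta>\<^sup>2 * norm z ^ 2 \<le> \<eta>\<^sup>2 * 1" using z \<rho>' by (intro mult_left_mono) (auto simp: power_le_one)
        finally have "norm (G z) ^ 2 \<le> \<eta>\<^sup>2" by (simp add: G_def)
        then show ?thesis using \<eta> by (simp add: power2_le_iff_abs_le)
      qed
      show ?thesis
      proof (rule inj_onI)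
        fix x y assume xy: "x \<in> ball 0 \<rho>" "y \<in> ball 0 \<rho>" and eq: "\<phi> s t x = \<phi> s t y"
        have "norm (G x - G y) \<le> 1 / 2 * norm (x - y)"
        proof (rule differentiable_bound[OF convex_ball _ _ xy])
          fix z :: "complex ^ 'n" assume z: "z \<in> ball 0 \<rho>"
          then have z1: "z \<in> ball 0 1" using \<rho> by simp
          have sub: "ball z (\<rho>' - \<rho>) \<subseteq> cball 0 \<rho>'"
          proof
            fix w assume "w \<in> ball z (\<rho>' - \<rho>)"
            then show "w \<in> cball 0 \<rho>'" using z dist_triangle[of 0 w z] by simp
          qed
          then have sub1: "ball z (\<rho>' - \<rho>) \<subseteq> ball 0 1" using \<rho>' by auto
          show "(G has_derivative cderiv G z) (at z within ball 0 \<rho>)"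
            by (rule has_derivative_at_withinI[OF holo_mapD(1)[OF Gh z1]])
          show "onorm (cderiv G z) \<le> 1 / 2"
          proof (rule onorm_le)
            fix v
            have "norm (cderiv G z v) \<le> 2 * real CARD('n) * \<eta> / (\<rho>' - \<rho>) * norm v"
              using sub \<rho>' by (intro cderiv_bound holo_map_subset[OF Gh sub1] Gb) auto
            also have "2 * real CARD('n) * \<eta> / (\<rho>' - \<rho>) = c * \<eta>" by (simp add: c_def)
            also have "c * \<eta> = 1 / 2" using c by (simp add: \<eta>_def)
            finally show "norm (cderiv G z v) \<le> 1 / 2 * norm v" .
          qed
        qed
        moreover have "G x - G y = y - x" using eq by (simp add: G_def)
        ultimately show "x = y" by (simp add: norm_minus_commute)
      qed
    qed
  qed
qed

text \<open>The time interval is cut into steps no longer than \<delta>, each injective on the same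
  ball, which all orbits from it never leave.\<close>

lemma phi_injective:
  assumes st: "0 \<le> s" "s \<le> t"
  shows "inj_on (\<phi> s t) (ball 0 1)"
proof (rule inj_onI)
  fix x y assume xy: "x \<in> ball 0 1" "y \<in> ball 0 1" "\<phi> s t x = \<phi> s t y"
  define \<rho> where "\<rho> = (1 + max (norm x) (norm y)) / 2"
  have \<rho>: "0 < \<rho>" "\<rho> < 1" "x \<in> ball 0 \<rho>" "y \<in> ball 0 \<rho>"
    using xy norm_ge_zero[of x] by (auto simp: \<rho>_def max_def simp del: norm_ge_zero)
  obtain \<delta> where \<delta>: "\<delta> > 0" "\<And>s t. 0 \<le> s \<Longrightarrow> s \<le> t \<Longrightarrow> t \<le> s + \<delta> \<Longrightarrow> inj_on (\<phi> s t) (ball 0 \<rho>)"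
    by (rule phi_locally_injective[OF \<rho>(1,2)]) (rule that)
  have inj: "inj_on (\<phi> s u) (ball 0 \<rho>)" if "s \<le> u" "u \<le> s + real k * \<delta>" for k u
    using that
  proof (induction k arbitrary: u)
    case 0
    then have "u = s" by simp
    then show ?case using \<delta> st by simp
  next
    case (Suc k)
    \<comment> \<open>Splits off a last step of length at most \<delta> without going back beyond
      s.\<close>
    define u' where "u' = max s (u - \<delta>)"
    have u': "s \<le> u'" "u' \<le> s + real k * \<delta>" "u' \<le> u" "u \<le> u' + \<delta>"
      using Suc.prems \<delta>(1) by (auto simp: u'_def algebra_simps)
    have I: "inj_on (\<phi> s u') (ball 0 \<rho>)" using Suc.IH u' by blast
    have J: "inj_on (\<phi> u' u) (ball 0 \<rho>)" using \<delta>(2) u' st by simp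
    show ?case
    proof (rule inj_onI)
      fix v w assume vw: "v \<in> ball 0 \<rho>" "w \<in> ball 0 \<rho>" "\<phi> s u v = \<phi> s u w"
      have in\<rho>: "\<phi> s u' p \<in> ball 0 \<rho>" if "p \<in> ball 0 \<rho>" for p
        using that phi_norm_le[of s u' p] st u' \<rho> by simp
      have "\<phi> u' u (\<phi> s u' v) = \<phi> u' u (\<phi> s u' w)"
        using vw(3) phi_trans[of s u' u v] phi_trans[of s u' u w] st u' vw \<rho> by simp
      then have "\<phi> s u' v = \<phi> s u' w" using J in\<rho> vw by (meson inj_onD)
      then show "v = w" using I vw by (meson inj_onD)
    qed
  qed
  obtain k :: nat where "(t - s) / \<delta> < real k" using reals_Archimedean2 by blast
  then have "t \<le> s + real k * \<delta>" using \<delta>(1) by (simp add: field_simps)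
  then have "inj_on (\<phi> s t) (ball 0 \<rho>)" using inj st by blast
  then show "x = y" using \<rho> xy by (meson inj_onD)
qed

end

text \<open>All sampled maps take values in the unit ball, so Cauchy estimates bound their quadratic
  remainders for all n at once.\<close>

sublocale dilation_family \<subseteq> cs: contracting_sequence "\<lambda>i. exp (\<alpha> i)" "\<lambda>n. \<phi> (real n) (real n + 1)"
proof
  show "exp (\<alpha> i) \<noteq> 0" for i by simp
  show "norm (exp (\<alpha> i)) < 1" for i using Re_neg[of i] by simp
  show u: "unif_holo (\<lambda>n. \<phi> (real n) (real n + 1))"
  proof (rule unif_holoI[of 1 _ 1])
    show "holomorphic_map_on (\<phi> (real n) (real n + 1)) (ball 0 1)" for n by (intro phi_holomorphic) auto
    show "norm (\<phi> (real n) (real n + 1) z) \<le> 1" if "norm z < 1" for n z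
      using phi_in_ball[of "real n" "real n + 1" z] that by simp
  qed simp
  have "unif_bigo 2 (\<lambda>n z. \<phi> (real n) (real n + 1) z - cderiv (\<phi> (real n) (real n + 1)) 0 z)"
    by (rule unif_holo_imp_unif_bigo2[OF u]) (simp add: phi_0)
  then show "unif_bigo 2 (\<lambda>n z. \<phi> (real n) (real n + 1) z - diag_map (\<lambda>i. exp (\<alpha> i)) z)"
    by (simp add: phi_cderiv dil_def)
qed

section \<open>The Loewner chain\<close>

text \<open>The increment is tested along t v for a t so small that the differentiability error is
  negligible. This carries \<open>F_near_id\<close> over to derivatives.\<close>

lemma derivative_bound_of_lipschitz:
  assumes f: "(f has_derivative L) (at y)" and U: "open U" "y \<in> U"
    and lip: "\<And>x. x \<in> U \<Longrightarrow> norm (f x - f y) \<le> K * norm (x - y)"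
  shows "norm (L v) \<le> K * norm v"
proof (cases "v = 0")
  case True
  then show ?thesis using linear_0[OF bounded_linear.linear[OF has_derivative_bounded_linear[OF f]]] by simp
next
  case False
  interpret L: bounded_linear L by (rule has_derivative_bounded_linear[OF f])
  show ?thesis
  proof (rule field_le_epsilon)
    fix e :: real assume "e > 0"
    then have e: "e / norm v > 0" using False by simp
    obtain d where d: "d > 0" "\<And>x. norm (x - y) < d \<Longrightarrow> norm (f x - f y - L (x - y)) \<le> e / norm v * norm (x - y)"
      using f[unfolded has_derivative_at_alt] e by blast
    obtain d' where d': "d' > 0" "ball y d' \<subseteq> U" using U open_contains_ball by blast
    define t where "t = min d d' / (2 * norm v)"
    have t: "t > 0" "t * norm v < d" "t * norm v < d'" using d d' False by (auto simp: t_def)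
    let ?x = "y + t *\<^sub>R v"
    have "norm (f ?x - f y) \<le> K * norm (?x - y)" using t d' by (intro lip) (auto simp: dist_norm subset_iff)
    moreover have "norm (f ?x - f y - L (?x - y)) \<le> e / norm v * norm (?x - y)" using t by (intro d) simp
    ultimately have "norm (L (?x - y)) \<le> K * norm (?x - y) + e / norm v * norm (?x - y)"
      using norm_triangle_ineq4[of "f ?x - f y" "f ?x - f y - L (?x - y)"] by simp
    then have "t * norm (L v) \<le> t * (K * norm v + e)" using t False by (simp add: L.scaleR algebra_simps)
    then show "norm (L v) \<le> K * norm v + e" using t by simp
  qed
qed

text \<open>Fixes one outcome of \<open>intertwining_maps\<close>, so that the chain can be defined
  outright.\<close>

locale intertwined_family = dilation_family \<alpha> \<phi>
  for \<alpha> :: "'n::finite \<Rightarrow> complex" and \<phi> :: "real \<Rightarrow> real \<Rightarrow> complex ^ 'n \<Rightarrow> complex ^ 'n" +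
  fixes R F :: "nat \<Rightarrow> complex ^ 'n \<Rightarrow> complex ^ 'n" and r :: real
  assumes R: "cs.shear R" and r: "0 < r" "r \<le> 1"
    and F_holomorphic: "\<And>n. holomorphic_map_on (F n) (ball 0 r)"
    and F_tangent: "unif_bigo 2 (\<lambda>n z. F n z - z)" and F_0: "\<And>n. F n 0 = 0"
    and F_intertwines: "\<And>n z. norm z < r \<Longrightarrow>
      F n z = cs.model_map R n (F (Suc n) (\<phi> (real n) (real n + 1) z))"
    and F_near_id: "\<And>n x y. norm x < r \<Longrightarrow> norm y < r \<Longrightarrow>
      norm (F n x - F n y - (x - y)) \<le> norm (x - y) / 2"
begin

primrec shears :: "nat \<Rightarrow> complex ^ 'n \<Rightarrow> complex ^ 'n" where
  "shears 0 w = w"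
| "shears (Suc m) w = shears m (cs.model_map R m w)"

lemma shears_holomorphic: "holomorphic_map_on (shears m) UNIV"
proof (induction m)
  case 0
  have "shears 0 = (\<lambda>w. w)" by (simp add: fun_eq_iff)
  then show ?case by simp
next
  case (Suc m)
  have "shears (Suc m) = (\<lambda>w. shears m (cs.model_map R m w))" by (simp add: fun_eq_iff)
  moreover have "holomorphic_map_on (\<lambda>w. shears m (cs.model_map R m w)) UNIV"
    by (rule holo_map_compose[OF cs.holomorphic_model_map[OF R] Suc]) simp
  ultimately show ?case by simp
qed

lemma shears_inverse:
  obtains T where "entire_map T" "\<And>z. T (shears m z) = z"
proof -
  have "\<exists>T. entire_map T \<and> (\<forall>z. T (shears m z) = z)"
  proof (induction m)
    case 0
    then show ?case by (intro exI[of _ "\<lambda>z. z"]) (simp add: entire_map_def)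
  next
    case (Suc m)
    then obtain T where T: "entire_map T" "\<And>z. T (shears m z) = z" by blast
    obtain T' where T': "entire_map T'" "\<And>z. T' (cs.model_map R m z) = z"
      by (rule cs.model_map_inverse[OF R, of m]) (rule that)
    have "entire_map (\<lambda>z. T' (T z))"
      using holo_map_compose[of T UNIV T' UNIV] T(1) T'(1) by (simp add: entire_map_def)
    then show ?case using T T' by (intro exI[of _ "\<lambda>z. T' (T z)"]) simp
  qed
  then show ?thesis using that by blast
qed

lemma shears_0: "shears m 0 = 0" and shears_derivative: "(shears m has_derivative dil (- real m)) (at 0)"
proof -
  have BL: "bounded_linear cs.lin_inv" unfolding cs.lin_inv_def by (rule bounded_linear_diag_map)
  have S0: "cs.model_map R n 0 = 0" "(cs.model_map R n has_derivative cs.lin_inv) (at 0)" for n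
    using unif_bigo2_cderiv[OF BL cs.model_map_minus_lin_inv[OF R]] by auto
  have B: "cs.lin_inv = dil (- 1)"
    by (simp add: cs.lin_inv_def dil_def exp_minus inverse_eq_divide)
  show s0: "shears m 0 = 0" for m by (induction m) (simp_all add: S0)
  show "(shears m has_derivative dil (- real m)) (at 0)"
  proof (induction m)
    case 0
    have "shears 0 = (\<lambda>w. w)" "dil 0 = (\<lambda>w. w)" by (simp_all add: fun_eq_iff)
    then show ?case by simp
  next
    case (Suc m)
    have "((\<lambda>w. shears m (cs.model_map R m w)) has_derivative (\<lambda>v. dil (- real m) (cs.lin_inv v))) (at 0)"
      by (rule has_derivative_compose[OF S0(2)]) (simp add: S0 Suc)
    moreover have "shears (Suc m) = (\<lambda>w. shears m (cs.model_map R m w))" by (simp add: fun_eq_iff)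
    moreover have "(\<lambda>v. dil (- real m) (cs.lin_inv v)) = dil (- real (Suc m))"
      by (simp add: B dil_add fun_eq_iff algebra_simps)
    ultimately show ?case by (simp only:)
  qed
qed

lemma F_derivative: "(F n has_derivative (\<lambda>v. v)) (at 0)"
  using unif_bigo2_cderiv[OF bounded_linear_ident F_tangent] by auto

lemma F_inj: "inj_on (F n) (ball 0 r)"
proof (rule inj_onI)
  fix x y assume "x \<in> ball 0 r" "y \<in> ball 0 r" "F n x = F n y"
  then show "x = y" using F_near_id[of x y n] by (simp add: norm_minus_commute)
qed

lemma F_bound: "norm z < r \<Longrightarrow> norm (F n z) \<le> 2 * norm z"
  using F_near_id[of z 0 n] r norm_triangle_ineq[of "F n z - z" z] norm_ge_zero[of z]
  by (simp add: F_0 del: norm_ge_zero)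

text \<open>The preimage is the fixed point of y -> x - (F n y - y), a 1/2-contraction by
  \<open>F_near_id\<close>; r/4 + (r/2)/2 = r/2 keeps the closed ball invariant.\<close>

lemma F_surj:
  assumes x: "norm x \<le> r / 4"
  obtains y where "norm y < r" "F n y = x"
proof -
  have small: "norm y < r" if "y \<in> cball 0 (r / 2)" for y :: "complex ^ 'n" using that r by simp
  have "\<exists>!y. y \<in> cball 0 (r / 2) \<and> x - (F n y - y) = y"
  proof (rule Banach_fix[where c = "1 / 2"])
    show "complete (cball (0 :: complex ^ 'n) (r / 2))" by (intro compact_imp_complete) simp
    show "cball (0 :: complex ^ 'n) (r / 2) \<noteq> {}" using r by simp
    show "(\<lambda>y. x - (F n y - y)) ` cball 0 (r / 2) \<subseteq> cball 0 (r / 2)"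
    proof clarify
      fix y :: "complex ^ 'n" assume y: "y \<in> cball 0 (r / 2)"
      have "norm (F n y - y) \<le> norm y / 2" using F_near_id[OF small[OF y], of 0 n] r by (simp add: F_0)
      then show "x - (F n y - y) \<in> cball 0 (r / 2)"
        using y x norm_triangle_ineq4[of x "F n y - y"] by simp
    qed
    show "dist (x - (F n y - y)) (x - (F n z - z)) \<le> 1 / 2 * dist y z"
      if "y \<in> cball 0 (r / 2)" "z \<in> cball 0 (r / 2)" for y z
      using F_near_id[OF small[OF that(2)] small[OF that(1)], of n]
      by (simp add: dist_norm norm_minus_commute algebra_simps)
  qed auto
  then obtain y where "y \<in> cball 0 (r / 2)" "x - (F n y - y) = y" by blast
  then show ?thesis using that[of y] small by (simp add: algebra_simps)
qed

text \<open>The least admissible index varies with z and merely selects a value;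
  \<open>chain_eq\<close> shows that every admissible index gives the same one.\<close>

definition chain :: "real \<Rightarrow> complex ^ 'n \<Rightarrow> complex ^ 'n" where
  "chain s z = (let m = LEAST m. s \<le> real m \<and> norm (\<phi> s (real m) z) < r in shears m (F m (\<phi> s (real m) z)))"

lemma shears_F_step:
  assumes "m \<le> n" "norm z < r"
  shows "shears n (F n (\<phi> (real m) (real n) z)) = shears m (F m z)"
  using assms(1)
proof (induction n rule: dec_induct)
  case base
  then show ?case using assms r by (simp add: phi_same)
next
  case (step n)
  have z1: "norm z < 1" using assms r by simp
  have y: "norm (\<phi> (real m) (real n) z) < r"
    using phi_norm_le[of "real m" "real n" z] step assms z1 by simp
  have "\<phi> (real m) (real (Suc n)) z = \<phi> (real n) (real n + 1) (\<phi> (real m) (real n) z)"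
    using phi_trans[of "real m" "real n" "real (Suc n)" z] step z1 by (simp add: add.commute)
  then show ?case using F_intertwines[OF y] step by simp
qed

lemma chain_eq:
  assumes s: "0 \<le> s" "s \<le> real m" and z: "norm z < 1" "norm (\<phi> s (real m) z) < r"
  shows "chain s z = shears m (F m (\<phi> s (real m) z))"
proof -
  let ?P = "\<lambda>m. s \<le> real m \<and> norm (\<phi> s (real m) z) < r"
  define m0 where "m0 = (LEAST m. ?P m)"
  have Pm: "?P m" using assms by simp
  have P0: "?P m0" unfolding m0_def by (rule LeastI[of ?P, OF Pm])
  have le: "m0 \<le> m" unfolding m0_def by (rule Least_le[of ?P, OF Pm])
  have "\<phi> s (real m) z = \<phi> (real m0) (real m) (\<phi> s (real m0) z)"
    using P0 le s z by (intro phi_trans) auto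
  then have "shears m (F m (\<phi> s (real m) z)) = shears m0 (F m0 (\<phi> s (real m0) z))"
    using shears_F_step[OF le] P0 by simp
  then show ?thesis unfolding chain_def Let_def m0_def by (rule sym)
qed

text \<open>The lag between s and the index depends on \<rho> only. A common index for a whole ball
  gives holomorphy, and a lag independent of s gives normality.\<close>

lemma chain_representation:
  assumes "\<rho> < 1"
  obtains p :: nat where "\<And>s m z. 0 \<le> s \<Longrightarrow> s + real p \<le> real m \<Longrightarrow> norm z \<le> \<rho> \<Longrightarrow>
      norm (\<phi> s (real m) z) < r \<and> chain s z = shears m (F m (\<phi> s (real m) z))"
proof -
  obtain p :: nat where p: "\<And>s t z. 0 \<le> s \<Longrightarrow> s + real p \<le> t \<Longrightarrow> norm z \<le> \<rho> \<Longrightarrow> norm (\<phi> s t z) < r"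
    by (rule phi_tends_to_0_uniformly[OF assms r(1)]) (rule that)
  show ?thesis
  proof (rule that[of p])
    fix s m z assume *: "0 \<le> s" "s + real p \<le> real m" "norm (z :: complex ^ 'n) \<le> \<rho>"
    then have "norm (\<phi> s (real m) z) < r" by (rule p)
    then show "norm (\<phi> s (real m) z) < r \<and> chain s z = shears m (F m (\<phi> s (real m) z))"
      using * assms by (intro conjI chain_eq) auto
  qed
qed

section \<open>Holomorphy, univalence and normalization of the chain\<close>

lemma chain_holomorphic:
  assumes s: "0 \<le> s"
  shows "holomorphic_map_on (chain s) (ball 0 1)"
  unfolding holomorphic_map_on_def
proof
  fix z :: "complex ^ 'n" assume z: "z \<in> ball 0 1"
  define \<rho> where "\<rho> = (1 + norm z) / 2"
  have \<rho>: "\<rho> < 1" "z \<in> ball 0 \<rho>" using z by (auto simp: \<rho>_def)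
  obtain p :: nat where p: "\<And>s m z. 0 \<le> s \<Longrightarrow> s + real p \<le> real m \<Longrightarrow> norm z \<le> \<rho> \<Longrightarrow>
      norm (\<phi> s (real m) z) < r \<and> chain s z = shears m (F m (\<phi> s (real m) z))"
    by (rule chain_representation[OF \<rho>(1)]) (rule that)
  obtain m where m: "s + real p \<le> real m" using real_arch_simple by blast
  have sm: "s \<le> real m" using m by simp
  have "holomorphic_map_on (\<lambda>z. F m (\<phi> s (real m) z)) (ball 0 \<rho>)"
  proof (rule holo_map_compose[OF _ F_holomorphic])
    show "holomorphic_map_on (\<phi> s (real m)) (ball 0 \<rho>)"
      using \<rho> by (intro holo_map_subset[OF phi_holomorphic[OF s sm]]) auto
    show "\<phi> s (real m) ` ball 0 \<rho> \<subseteq> ball 0 r" using p[OF s m] by auto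
  qed
  from holo_map_compose[OF this shears_holomorphic]
  have "holomorphic_map_on (\<lambda>z. shears m (F m (\<phi> s (real m) z))) (ball 0 \<rho>)" by simp
  then have "holomorphic_map_on (chain s) (ball 0 \<rho>)"
    by (rule holo_map_transform) (use p[OF s m] in auto)
  then show "\<exists>A. (chain s has_derivative (*v) A) (at z)" using \<rho> unfolding holomorphic_map_on_def by blast
qed

text \<open>The index may be pushed beyond any given time and stays admissible from then on, so two
  times or two points can share one.\<close>

lemma chain_common_index:
  assumes "0 \<le> s" "norm z < 1"
  obtains m where "s \<le> real m" "t \<le> real m" "norm (\<phi> s (real m) z) < r" "chain s z = shears m (F m (\<phi> s (real m) z))"
    "\<And>m'. m \<le> m' \<Longrightarrow> norm (\<phi> s (real m') z) < r"
proof -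
  obtain p :: nat where p: "\<And>s m w. 0 \<le> s \<Longrightarrow> s + real p \<le> real m \<Longrightarrow> norm w \<le> norm z \<Longrightarrow>
      norm (\<phi> s (real m) w) < r \<and> chain s w = shears m (F m (\<phi> s (real m) w))"
    by (rule chain_representation[OF assms(2)]) (rule that)
  obtain m where m: "max (s + real p) t \<le> real m" using real_arch_simple by blast
  show ?thesis
  proof (rule that[of m])
    show "norm (\<phi> s (real m') z) < r" if "m \<le> m'" for m'
      using p[of s m' z] m that assms of_nat_mono[OF that, where 'a = real] by simp
  qed (use p[of s m z] m assms in auto)
qed

lemma chain_associated:
  assumes st: "0 \<le> s" "s \<le> t" and z: "norm z < 1"
  shows "chain s z = chain t (\<phi> s t z)"
proof -
  obtain m where m: "s \<le> real m" "t \<le> real m" "norm (\<phi> s (real m) z) < r"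
    "chain s z = shears m (F m (\<phi> s (real m) z))"
    by (rule chain_common_index[OF st(1) z, of t]) (rule that)
  have "\<phi> s (real m) z = \<phi> t (real m) (\<phi> s t z)" using st m z by (intro phi_trans) auto
  then show ?thesis
    using chain_eq[of t m "\<phi> s t z"] m st phi_in_ball[OF st z] by simp
qed

lemma shears_F_inj: "inj_on (\<lambda>z. shears m (F m z)) (ball 0 r)"
proof -
  obtain T where "\<And>z. T (shears m z) = z" by (rule shears_inverse[of m]) (rule that)
  then have "inj (shears m)" by (metis injI)
  then show ?thesis using comp_inj_on[OF F_inj, of "shears m" m] by (simp add: o_def inj_on_subset)
qed

lemma chain_inj:
  assumes s: "0 \<le> s"
  shows "inj_on (chain s) (ball 0 1)"
proof (rule inj_onI)
  fix x y assume xy: "x \<in> ball 0 1" "y \<in> ball 0 1" "chain s x = chain s y"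
  then have x1: "norm x < 1" and y1: "norm y < 1" by auto
  obtain m where m: "s \<le> real m" "\<And>m'. m \<le> m' \<Longrightarrow> norm (\<phi> s (real m') x) < r"
    by (rule chain_common_index[OF s x1, of 0]) (rule that)
  obtain m' where m': "s \<le> real m'" "\<And>m. m' \<le> m \<Longrightarrow> norm (\<phi> s (real m) y) < r"
    by (rule chain_common_index[OF s y1, of 0]) (rule that)
  define M where "M = max m m'"
  have M: "s \<le> real M" "norm (\<phi> s (real M) x) < r" "norm (\<phi> s (real M) y) < r"
    using m(1) m(2)[of M] m'(2)[of M] by (auto simp: M_def)
  have "shears M (F M (\<phi> s (real M) x)) = shears M (F M (\<phi> s (real M) y))"
    using chain_eq[OF s M(1) x1 M(2)] chain_eq[OF s M(1) y1 M(3)] xy by simp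
  then have "\<phi> s (real M) x = \<phi> s (real M) y" using inj_onD[OF shears_F_inj] M by simp
  then show "x = y" using inj_onD[OF phi_injective[OF s M(1)]] xy by blast
qed

lemma chain_linear_expansion:
  assumes s: "0 \<le> s"
  shows "linear_expansion (chain s) (mat_exp (- s *\<^sub>R Diag \<alpha>))"
proof -
  obtain m where m: "s \<le> real m" using real_arch_simple by blast
  have eq: "chain s z = shears m (F m (\<phi> s (real m) z))" if "norm z < r" for z
  proof (rule chain_eq[OF s m])
    show "norm z < 1" using that r by simp
    then show "norm (\<phi> s (real m) z) < r" using phi_norm_le[OF s m, of z] that by simp
  qed
  have "((\<lambda>z. F m (\<phi> s (real m) z)) has_derivative (\<lambda>v. dil (real m - s) v)) (at 0)"
    by (rule has_derivative_compose[OF phi_derivative[OF s m]]) (simp add: phi_0[OF s m] F_derivative)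
  then have "((\<lambda>z. shears m (F m (\<phi> s (real m) z))) has_derivative (\<lambda>v. dil (- real m) (dil (real m - s) v))) (at 0)"
    by (rule has_derivative_compose) (simp add: phi_0[OF s m] F_0 shears_derivative)
  then have "((\<lambda>z. shears m (F m (\<phi> s (real m) z))) has_derivative dil (- s)) (at 0)"
    by (simp add: dil_add)
  then have D: "(chain s has_derivative dil (- s)) (at 0)"
    by (rule has_derivative_transform_within_open[OF _ open_ball[of 0 r]]) (use r eq in auto)
  show ?thesis
  proof (rule linear_expansionI[OF chain_holomorphic[OF s]])
    show "chain s 0 = 0" using eq[of 0] r by (simp add: phi_0[OF s m] F_0 shears_0)
    show "(chain s has_derivative (*v) (mat_exp (- s *\<^sub>R Diag \<alpha>))) (at 0)"
      using D mat_exp_eq_dil[of "- s"] by (metis (no_types, lifting) ext)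
  qed simp
qed

text \<open>Pulling w back through the inverses of the model maps gives a backward orbit, which
  tends to 0 and so enters the ball of radius r/4 contained in the image of every
  \<open>F n\<close>.\<close>

lemma chain_covers:
  obtains n y where "norm y < r" "shears n (F n y) = w" "chain (real n) y = w"
proof -
  have "\<exists>T. \<forall>z. cs.model_map R n (T z) = z" for n
    by (rule cs.model_map_inverse[OF R, of n]) blast
  then obtain T where T: "\<And>n z. cs.model_map R n (T n z) = z" by metis
  define x where "x = rec_nat w (\<lambda>n x. T n x)"
  have x: "x 0 = w" "x (Suc n) = T n (x n)" for n by (simp_all add: x_def)
  have sh: "shears n (x n) = w" for n by (induction n) (simp_all add: x T)
  have "x \<longlonglongrightarrow> 0" by (rule cs.model_map_backward_orbit_tendsto_0[OF R]) (simp add: x T)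
  then have "\<forall>\<^sub>F n in sequentially. norm (x n) < r / 4"
    using order_tendstoD(2)[OF tendsto_norm, of x 0 sequentially "r / 4"] r by simp
  then obtain n where "norm (x n) < r / 4" by (auto simp: eventually_sequentially)
  then obtain y where y: "norm y < r" "F n y = x n" using F_surj[of "x n" n] by (metis less_imp_le)
  have y1: "norm y < 1" using y r by simp
  have "chain (real n) y = shears n (F n (\<phi> (real n) (real n) y))"
    using y y1 by (intro chain_eq) (auto simp: phi_same)
  then show ?thesis using that[of y n] y sh y1 by (simp add: phi_same)
qed

lemma chain_union: "(\<Union>s\<in>{0..}. chain s ` unit_ball) = UNIV"
proof -
  have "w \<in> (\<Union>s\<in>{0..}. chain s ` unit_ball)" for w
  proof -
    obtain n y where "norm y < r" "chain (real n) y = w"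
      by (rule chain_covers[of w]) (rule that)
    then show ?thesis using r by (intro UN_I[of "real n"] image_eqI[of _ _ y]) auto
  qed
  then show ?thesis by blast
qed

section \<open>Associated chains and their factorization\<close>

lemma subordination_chain_of_associated:
  assumes "\<And>s. s \<ge> 0 \<Longrightarrow> holomorphic_map_on (g s) unit_ball" "associated_to g \<phi>"
  shows "subordination_chain g"
  using assms self_map unfolding subordination_chain_def associated_to_def by blast

lemma chain_is_Loewner: "dilation_Loewner_chain (Diag \<alpha>) chain" "associated_to chain \<phi>"
proof -
  show as: "associated_to chain \<phi>" unfolding associated_to_def using chain_associated by auto
  show "dilation_Loewner_chain (Diag \<alpha>) chain"
    unfolding dilation_Loewner_chain_def univalent_on_def
    using subordination_chain_of_associated[OF _ as] chain_holomorphic chain_inj chain_linear_expansion by blast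
qed

text \<open>Univalence makes the factor well defined on the union of the images, which is the whole
  space. Near a given w it is a member of \<open>g\<close> composed with a local inverse of the
  chain on the small ball, where the chain is \<open>shears n\<close> after \<open>F n\<close> and
  its derivative is visibly invertible.\<close>

lemma factorization:
  assumes g: "\<And>s. s \<ge> 0 \<Longrightarrow> holomorphic_map_on (g s) unit_ball" and as: "associated_to g \<phi>"
  shows "\<exists>\<Psi>. entire_map \<Psi> \<and> (\<forall>s\<ge>0. \<forall>z\<in>unit_ball. g s z = \<Psi> (chain s z))"
proof -
  have gas: "g s z = g t (\<phi> s t z)" if "0 \<le> s" "s \<le> t" "norm z < 1" for s t z
    using as that unfolding associated_to_def by simp
  have wd: "g s z = g t z'" if eq: "chain s z = chain t z'" and st: "0 \<le> s" "s \<le> t" and z: "norm z < 1" "norm z' < 1"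
    for s t z z'
  proof -
    have "chain t (\<phi> s t z) = chain t z'" using chain_associated[OF st z(1)] eq by simp
    then have "\<phi> s t z = z'"
      using inj_onD[OF chain_inj[of t]] st z phi_in_ball[OF st z(1)] by simp
    then show ?thesis using gas[OF st z(1)] by simp
  qed
  \<comment> \<open>By \<open>wd\<close> the choice is immaterial: transporting both representations
    to the later time identifies the points.\<close>
  define \<Psi> where "\<Psi> w = (SOME v. \<exists>s z. 0 \<le> s \<and> norm z < 1 \<and> chain s z = w \<and> v = g s z)" for w
  have \<Psi>: "\<Psi> (chain s z) = g s z" if "0 \<le> s" "norm z < 1" for s z
  proof -
    have "\<exists>s' z'. 0 \<le> s' \<and> norm z' < 1 \<and> chain s' z' = chain s z \<and> \<Psi> (chain s z) = g s' z'"
      unfolding \<Psi>_def by (rule someI[of _ "g s z"]) (use that in blast)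
    then obtain s' z' where *: "0 \<le> s'" "norm z' < 1" "chain s' z' = chain s z" "\<Psi> (chain s z) = g s' z'" by blast
    then show ?thesis using that wd[of s' z' s z] wd[of s z s' z'] by (cases "s \<le> s'") auto
  qed
  have "\<exists>L. (\<Psi> has_derivative L) (at w) \<and> (\<forall>c v. L (c *s v) = c *s L v)" for w
  proof -
    obtain n y where ny: "norm y < r" "shears n (F n y) = w" "chain (real n) y = w"
      by (rule chain_covers[of w]) (rule that)
    have y1: "norm y < 1" using ny r by simp
    let ?f = "\<lambda>z. shears n (F n z)"
    let ?U = "ball (0 :: complex ^ 'n) r"
    have fe: "chain (real n) z = ?f z" if "norm z < r" for z
    proof -
      have "norm z < 1" using that r by simp
      then show ?thesis using chain_eq[of "real n" n z] that by (simp add: phi_same)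
    qed
    have fh: "holomorphic_map_on ?f ?U"
      using holo_map_compose[OF F_holomorphic[of n] shears_holomorphic[of n]] by simp
    have yU: "y \<in> ?U" using ny by simp
    obtain T where T: "entire_map T" "\<And>z. T (shears n z) = z" by (rule shears_inverse[of n]) (rule that)
    let ?D = "cderiv ?f y"
    have D: "(?f has_derivative ?D) (at y)" "\<And>c v. ?D (c *s v) = c *s ?D v"
      using holo_mapD[OF fh yU] by auto
    have TF: "((\<lambda>z. F n z) has_derivative (\<lambda>v. cderiv T w (?D v))) (at y)"
    proof -
      have "(T has_derivative cderiv T w) (at (?f y))"
        using holo_mapD(1)[of T UNIV w] T(1) ny(2) by (simp add: entire_map_def)
      from has_derivative_compose[OF D(1) this] show ?thesis by (simp add: T(2))
    qed
    \<comment> \<open>The derivative of \<open>F n\<close> lies within 1/2 of the identity, hence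
      has no kernel; the left inverse \<open>T\<close> transfers this to \<open>?D\<close>.\<close>
    have lb: "norm (cderiv (F n) y v - v) \<le> norm v / 2" for v
    proof -
      have "((\<lambda>z. F n z - z) has_derivative (\<lambda>v. cderiv (F n) y v - v)) (at y)"
        by (intro has_derivative_diff has_derivative_ident holo_mapD(1)[OF F_holomorphic yU])
      moreover have "norm ((F n x - x) - (F n y - y)) \<le> 1 / 2 * norm (x - y)" if "x \<in> ?U" for x
        using F_near_id[of x y n] that ny by (simp add: algebra_simps)
      ultimately show ?thesis using derivative_bound_of_lipschitz[OF _ open_ball yU] by fastforce
    qed
    have inj: "inj ?D"
    proof (rule linear_injective_0[OF bounded_linear.linear[OF has_derivative_bounded_linear[OF D(1)]], THEN iffD2], intro allI impI)
      fix v assume "?D v = 0"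
      moreover have "cderiv (F n) y v = cderiv T w (?D v)" using cderiv_eq[OF TF] by simp
      moreover have "cderiv T w 0 = 0" using T(1) cderiv_zero[of T UNIV w] by (simp add: entire_map_def)
      ultimately have "cderiv (F n) y v = 0" by simp
      then show "v = 0" using lb[of v] by simp
    qed
    obtain D' where D': "linear D'" "?D \<circ> D' = id"
      using linear_injective_isomorphism[OF bounded_linear.linear[OF has_derivative_bounded_linear[OF D(1)]] inj]
      by (auto simp: fun_eq_iff)
    define h where "h = inv_into ?U ?f"
    have hf: "h (?f z) = z" if "z \<in> ?U" for z
      unfolding h_def by (rule inv_into_f_f[OF shears_F_inj that])
    have hD: "(h has_derivative D') (at w)"
      using has_derivative_inverse_strong[OF open_ball yU holo_map_continuous[OF fh] hf D(1) D'(2)] ny by simp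
    \<comment> \<open>The inverse is so far only real linear; cancelling the injective, complex
      linear \<open>?D\<close> makes it complex linear.\<close>
    have D'c: "D' (c *s v) = c *s D' v" for c v
    proof -
      have "?D (D' (c *s v)) = ?D (c *s D' v)" using D'(2) D(2) by (simp add: fun_eq_iff)
      then show ?thesis using inj by (simp add: inj_eq)
    qed
    have hw: "h w = y" using hf[OF yU] ny by simp
    have gh: "(g (real n) has_derivative cderiv (g (real n)) y) (at (h w))" "\<And>c v. cderiv (g (real n)) y (c *s v) = c *s cderiv (g (real n)) y v"
      unfolding hw using holo_mapD[OF g[of "real n"], of y] y1 by auto
    have "((\<lambda>x. g (real n) (h x)) has_derivative (\<lambda>v. cderiv (g (real n)) y (D' v))) (at w)"
      by (rule has_derivative_compose[OF hD gh(1)])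
    then have "(\<Psi> has_derivative (\<lambda>v. cderiv (g (real n)) y (D' v))) (at w)"
    proof (rule has_derivative_transform_within_open)
      show "open (?f ` ?U)"
        by (rule invariance_of_domain[OF holo_map_continuous[OF fh] open_ball shears_F_inj])
      show "w \<in> ?f ` ?U" using ny yU by blast
      show "g (real n) (h x) = \<Psi> x" if x: "x \<in> ?f ` ?U" for x
      proof -
        obtain z where z: "z \<in> ?U" "x = ?f z" using x by blast
        then show ?thesis using \<Psi>[of "real n" z] fe[of z] hf[OF z(1)] r by simp
      qed
    qed
    then show ?thesis using gh(2) D'c by (intro exI[of _ "\<lambda>v. cderiv (g (real n)) y (D' v)"]) simp
  qed
  then have "entire_map \<Psi>" unfolding entire_map_def holo_map_iff by blast
  then show ?thesis using \<Psi> by auto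
qed

section \<open>Normality in the absence of real resonances\<close>

lemma norm_dil_backward_le:
  assumes "0 \<le> h"
  shows "norm (dil (- h) x) \<le> exp (h * (\<Sum>i\<in>UNIV. norm (\<alpha> i))) * norm x"
  unfolding dil_def
proof (rule norm_diag_map_le)
  fix i
  have "- Re (\<alpha> i) \<le> norm (\<alpha> i)" using abs_Re_le_cmod[of "\<alpha> i"] by simp
  also have "\<dots> \<le> (\<Sum>i\<in>UNIV. norm (\<alpha> i))" by (intro member_le_sum) auto
  finally have "h * - Re (\<alpha> i) \<le> h * (\<Sum>i\<in>UNIV. norm (\<alpha> i))" using assms by (rule mult_left_mono)
  then show "norm (exp (complex_of_real (- h) * \<alpha> i)) \<le> exp (h * (\<Sum>i\<in>UNIV. norm (\<alpha> i)))" by simp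
qed

text \<open>The modulus of an exponential is the exponential of the real part, and the letter counts
  of a word are the exponents of its monomial, adding up to its length.\<close>

lemma not_resonant:
  assumes "\<not> has_real_resonance \<alpha>"
  shows "\<not> cs.resonant l w"
proof
  assume res: "cs.resonant l w"
  have word_weight: "norm (cs.word_weight w) = exp (Re (\<Sum>j\<in>UNIV. of_nat (count_list w j) * \<alpha> j))"
  proof (induction w)
    case (Cons i w)
    have "of_nat (count_list (i # w) j) * \<alpha> j = (if j = i then \<alpha> i else 0) + of_nat (count_list w j) * \<alpha> j" for j
      by (simp add: algebra_simps)
    then have "(\<Sum>j\<in>UNIV. of_nat (count_list (i # w) j) * \<alpha> j)
        = \<alpha> i + (\<Sum>j\<in>UNIV. of_nat (count_list w j) * \<alpha> j)"
      by (simp only: sum.distrib) simp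
    then show ?case by (simp add: norm_mult Cons exp_add)
  qed simp
  have len: "(\<Sum>j\<in>UNIV. count_list w j) = length w"
  proof (induction w)
    case (Cons i w)
    have "count_list (i # w) j = (if j = i then 1 else 0) + count_list w j" for j by simp
    then show ?case using Cons by (simp only: sum.distrib) simp
  qed simp
  have "norm (cs.word_weight w) = exp (Re (\<alpha> l))" "length w \<ge> 2" using res by (auto simp: cs.resonant_def)
  then have "has_real_resonance \<alpha>"
    unfolding has_real_resonance_def using word_weight len by (intro exI[of _ "count_list w"] exI[of _ l]) simp
  then show False using assms by simp
qed

text \<open>Without resonances \<open>shears m\<close> is just \<open>dil (- m)\<close>, so the
  rescaled chain is \<open>dil (- (m - s))\<close> of a bounded quantity. The uniform lag bounds m -
  s, and \<open>montel\<close> applies.\<close>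

lemma chain_normal:
  assumes nr: "\<not> has_real_resonance \<alpha>"
  shows "normal_chain (Diag \<alpha>) chain"
proof -
  have "R n z = 0" for n z using R not_resonant[OF nr] unfolding cs.shear_def by blast
  then have model_map: "cs.model_map R n z = dil (- 1) z" for n z
    by (simp add: cs.model_map_def cs.lin_inv_def dil_def exp_minus inverse_eq_divide)
  have sh: "shears m z = dil (- real m) z" for m z
    by (induction m arbitrary: z) (simp_all add: model_map dil_add algebra_simps)
  have bdd: "\<exists>M. \<forall>s\<ge>0. \<forall>z\<in>cball 0 \<rho>. norm (dil s (chain s z)) \<le> M" if \<rho>: "\<rho> < 1" for \<rho>
  proof -
    obtain p :: nat where p: "\<And>s m z. 0 \<le> s \<Longrightarrow> s + real p \<le> real m \<Longrightarrow> norm z \<le> \<rho> \<Longrightarrow>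
      norm (\<phi> s (real m) z) < r \<and> chain s z = shears m (F m (\<phi> s (real m) z))"
      by (rule chain_representation[OF \<rho>]) (rule that)
    define a where "a = (\<Sum>i\<in>UNIV. norm (\<alpha> i))"
    have a: "a \<ge> 0" by (simp add: a_def sum_nonneg)
    have "norm (dil s (chain s z)) \<le> exp ((real p + 1) * a) * (2 * r)" if s: "0 \<le> s" and z: "z \<in> cball 0 \<rho>" for s z
    proof -
      \<comment> \<open>Rounding s up adds at most one unit to the lag \<open>p\<close>, which
        explains the exponent p + 1 in the bound.\<close>
      define m where "m = nat \<lceil>s\<rceil> + p"
      have m: "s + real p \<le> real m" "real m \<le> s + (real p + 1)" using s by (auto simp: m_def)
      let ?y = "F m (\<phi> s (real m) z)"
      have y: "norm (\<phi> s (real m) z) < r" "chain s z = shears m ?y" using p[OF s m(1)] z by auto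
      have "dil s (chain s z) = dil (- (real m - s)) ?y" by (simp add: y sh dil_add algebra_simps)
      also have "norm \<dots> \<le> exp ((real m - s) * a) * norm ?y"
        unfolding a_def using m(1) by (intro norm_dil_backward_le) simp
      also have "\<dots> \<le> exp ((real p + 1) * a) * (2 * r)"
        using F_bound[OF y(1), of m] y(1) m(2) a by (intro mult_mono) (auto intro: mult_right_mono)
      finally show ?thesis .
    qed
    then show ?thesis by blast
  qed
  show ?thesis
    unfolding normal_chain_def normal_family_def
  proof (intro allI impI)
    fix G assume "\<forall>n::nat. G n \<in> {\<lambda>z. mat_exp (s *\<^sub>R Diag \<alpha>) *v chain s z |s. s \<ge> 0}"
    then have "\<forall>n. \<exists>s\<ge>0. G n = (\<lambda>z. dil s (chain s z))" by (auto simp: mat_exp_eq_dil)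
    then obtain s where s: "\<And>n. s n \<ge> 0" "\<And>n. G n = (\<lambda>z. dil (s n) (chain (s n) z))" by metis
    show "\<exists>k H. strict_mono (k :: nat \<Rightarrow> nat) \<and> holomorphic_map_on H unit_ball \<and>
      (\<forall>K. compact K \<and> K \<subseteq> unit_ball \<longrightarrow> uniform_limit K (\<lambda>n. G (k n)) H sequentially)"
    proof (rule montel)
      show "holomorphic_map_on (G n) unit_ball" for n
        unfolding s(2) dil_def
        by (rule holo_map_compose[OF chain_holomorphic[OF s(1)] holo_map_diag_map]) (rule subset_UNIV)
      show "\<exists>M. \<forall>n. \<forall>z\<in>cball 0 \<rho>. norm (G n z) \<le> M" if "\<rho> < 1" for \<rho>
        using bdd[OF that] s by metis
    qed
  qed
qed

end

theorem theorem8p6: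
  fixes \<alpha> :: "'n::{finite,linorder} \<Rightarrow> complex"
    and \<Lambda> :: "complex ^ ('n::{finite,linorder}) ^ ('n::{finite,linorder})"
    and \<phi> :: "real \<Rightarrow> real \<Rightarrow> complex ^ ('n::{finite,linorder}) \<Rightarrow> complex ^ ('n::{finite,linorder})"
  assumes "CARD('n) \<ge> 2"
    and "\<Lambda> = Diag \<alpha>"
    and "\<And>i j. i \<le> j \<Longrightarrow> Re (\<alpha> j) \<le> Re (\<alpha> i)"
    and "\<And>i. Re (\<alpha> i) < 0"
    and "dilation_evolution_family \<Lambda> \<phi>"
  shows "\<exists>f.
      dilation_Loewner_chain \<Lambda> f \<and> associated_to f \<phi> \<and>
      (\<Union>s\<in>{0..}. f s ` unit_ball) = UNIV \<and>
      (\<not> has_real_resonance \<alpha> \<longrightarrow> normal_chain \<Lambda> f) \<and>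
      (\<forall>g.
         (\<forall>s\<ge>0. holomorphic_map_on (g s) unit_ball) \<longrightarrow>
         (subordination_chain g \<and> associated_to g \<phi> \<longleftrightarrow>
          (\<exists>\<Psi>. entire_map \<Psi> \<and>
             (\<forall>s\<ge>0. \<forall>z\<in>unit_ball. g s z = \<Psi> (f s z)))))"
proof -
  interpret dilation_family \<alpha> \<phi>
    by unfold_locales (use assms in auto)
  obtain R F r where "cs.shear R" "r > 0" "r \<le> 1"
    "\<And>n. holomorphic_map_on (F n) (ball 0 r)"
    "unif_bigo 2 (\<lambda>n z. F n z - z)" "\<And>n. F n 0 = 0"
    "\<And>n z. norm z < r \<Longrightarrow> F n z = cs.model_map R n (F (Suc n) (\<phi> (real n) (real n + 1) z))"
    "\<And>n x y. norm x < r \<Longrightarrow> norm y < r \<Longrightarrow> norm (F n x - F n y - (x - y)) \<le> norm (x - y) / 2"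
    by (rule cs.intertwining_maps) (rule that)
  then interpret intertwined_family \<alpha> \<phi> R F r
    by unfold_locales
  have "subordination_chain g \<and> associated_to g \<phi> \<longleftrightarrow>
      (\<exists>\<Psi>. entire_map \<Psi> \<and> (\<forall>s\<ge>0. \<forall>z\<in>unit_ball. g s z = \<Psi> (chain s z)))"
    if g: "\<forall>s\<ge>0. holomorphic_map_on (g s) unit_ball" for g
  proof
    assume "subordination_chain g \<and> associated_to g \<phi>"
    then show "\<exists>\<Psi>. entire_map \<Psi> \<and> (\<forall>s\<ge>0. \<forall>z\<in>unit_ball. g s z = \<Psi> (chain s z))"
      using factorization[of g] g by blast
  next
    assume "\<exists>\<Psi>. entire_map \<Psi> \<and> (\<forall>s\<ge>0. \<forall>z\<in>unit_ball. g s z = \<Psi> (chain s z))"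
    then obtain \<Psi> where \<Psi>: "\<And>s z. s \<ge> 0 \<Longrightarrow> z \<in> unit_ball \<Longrightarrow> g s z = \<Psi> (chain s z)" by blast
    have "associated_to g \<phi>"
      unfolding associated_to_def
    proof (intro allI impI ballI)
      fix s t :: real and z :: "complex ^ ('n::{finite,linorder})" assume st: "0 \<le> s \<and> s \<le> t" and z: "z \<in> unit_ball"
      then have "\<phi> s t z \<in> unit_ball" using phi_in_ball[of s t z] by simp
      then show "g s z = g t (\<phi> s t z)" using \<Psi>[of s z] \<Psi>[of t "\<phi> s t z"] chain_associated[of s t z] st z by simp
    qed
    then show "subordination_chain g \<and> associated_to g \<phi>"
      using subordination_chain_of_associated[of g] g by blast
  qed
  then show ?thesis
    using chain_is_Loewner chain_union chain_normal unfolding assms(2)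
    by (intro exI[of _ chain] conjI allI impI) auto
qed

end
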